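(* Let $H=H(\mathcal D)$ be the Hopf algebra of a simply linked datum $\mathcal D$ of nilpotent type (see context) and let $\gamma\in\widehat G$. Then: (1) For every $m<\ell(\gamma)$, $R^m(\gamma)$ is generated by the primitive vectors $x^{\underline i}\otimes 1_\gamma$ of rank $m$. (2) The radical and the socle series of $Z(\gamma)$ coincide, i.e. $R^m(\gamma)=\Sigma_{\ell(\gamma)-m}(\gamma)$ for all $0\le m\le \ell(\gamma)$. (3) The Loewy layers $\mathbb L^m(\gamma):=R^m(\gamma)/R^{m+1}(\gamma)$ are given by $$\mathbb L^m(\gamma)\simeq\bigoplus\{L(\eta)\mid \eta\ \text{is weight of primitive basis vector of rank}\ m\}.$$ (4) $\ell(\gamma)=|S(\gamma)|+1$.
   Context: $\Bbbk$ is a field of characteristic $0$ containing all roots of $1$, $G$ a finite abelian group, $\widehat G=\mathrm{Hom}(G,\Bbbk^\times)$, $\underline n=\{1,\dots,n\}$. Datum and $H$: $a_i,b_i\in G$, $\chi_i\in\widehat G$ ($i\in\underline n$) satisfy $a_ib_i\ne 1$ for all $i$; $\chi_j(a_i)=\chi_i(b_j)$ for all $i,j$; $\chi_i(a_j)\chi_j(a_i)=1$ and $\chi_i(b_j)\chi_j(b_i)=1$ for all $i\neq j$. Put $q_{ij}=\chi_j(a_i)$, $q_i=\chi_i(a_i)$, and let $m_i$ be the multiplicative order of $q_i$. $H=H(\mathcal D)$ is the Hopf algebra generated by $G$ and $x_i,y_i$ ($i\in\underline n$) with the relations of $G$ and: $gx_i=\chi_i(g)x_ig$, $gy_i=\chi_i^{-1}(g)y_ig$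 for $g\in G$; $x_ix_j=q_{ij}x_jx_i$, $y_iy_j=q_{ij}y_jy_i$ for $i\ne j$; $x_iy_j-q_{ij}^{-1}y_jx_i=\delta_{ij}(a_ib_i-1)$ for all $i,j$; $x_i^{m_i}=0=y_i^{m_i}$. Elements of $G$ are grouplike, $\Delta x_i=a_i\otimes x_i+x_i\otimes 1$, $\Delta y_i=b_i\otimes y_i+y_i\otimes 1$. Modules: $Y$ is the subalgebra of $H$ generated by $G$ and all $y_i$. For $\gamma\in\widehat G$, $\Bbbk_\gamma=\Bbbk 1_\gamma$ is the $Y$-module with $g1_\gamma=\gamma(g)1_\gamma$, $y_i1_\gamma=0$, and $Z(\gamma)=H\otimes_Y\Bbbk_\gamma$. With $x^{\underline i}=x_1^{i_1}\cdots x_n^{i_n}$, the elements $x^{\underline i}\otimes 1_\gamma$, $0\le i_k\le m_k-1$, form a basis of $Z(\gamma)$; "basis vector" refers to these elements. $Z(\gamma)$ has a unique maximal submodule $R(\gamma)$, and $L(\gamma)=Z(\gamma)/R(\gamma)$. A nonzero element $v$ of an $H$-module is a weight element of weight $\eta\in\widehat G$ if $gv=\eta(g)v$ for all $g\in G$; a weight element $v$ is primitive if $y_iv=0$ for all $i$. $S(\gamma)$ is the set of $j\in\underline n$ such that $\gamma(a_jb_j)=q_j^{-e_j}$ for some (necessarily unique) integer $0\le e_j\le m_j-2$. The rank of $x^{\underline i}\otimes 1_\gamma$ is the number of $j\in S(\gamma)$ with $i_j\ge e_j+1$. Series: for a finite-dimensional module $M$, the radical $R(M)$ is the smallest submodule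 with semisimple quotient and the socle $\Sigma(M)$ is the largest semisimple submodule. $R^0(M)=M$, $R^m(M)=R(R^{m-1}(M))$ for $m\ge1$; $\Sigma_0(M)=0$ and $\Sigma_m(M)$ is the preimage in $M$ of $\Sigma(M/\Sigma_{m-1}(M))$ for $m\ge1$. The Loewy length is $\min\{m: R^m(M)=0\}=\min\{m:\Sigma_m(M)=M\}$. For $M=Z(\gamma)$ these are written $R^m(\gamma)$, $\Sigma_m(\gamma)$, $\ell(\gamma)$. *)

theory Defs
  imports
    "HOL-Computational_Algebra.Polynomial"
    "HOL-Library.Poly_Mapping"
    "HOL-Algebra.Module"
    "HOL-Algebra.QuotRing"
    "HOL-Algebra.Generated_Rings"
begin

text \<open>
  Conventions: \<open>G\<close> and all algebras and modules are carrier-based structures of HOL-Algebra, the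
  ground field is a type of class \<^class>\<open>field_char_0\<close>. HOL-Algebra's locale \<open>module\<close> requires
  a commutative ring; the record \<open>module\<close> and the locale \<^locale>\<open>submodule\<close> do not, and
  they are used for left modules over noncommutative rings. The multiplicative fields of a
  \<open>module\<close> record carry no meaning for a module, so they are left undefined below.
\<close>

section \<open>Left modules over a not necessarily commutative ring\<close>

definition gen_submodule :: "('r, 'a) ring_scheme \<Rightarrow> ('r, 'm, 'b) module_scheme \<Rightarrow> 'm set \<Rightarrow> 'm set"
  where "gen_submodule R M S = \<Inter> {N. submodule N R M \<and> S \<subseteq> N}"

definition quot_module ::
    "('r, 'm, 'b) module_scheme \<Rightarrow> 'm set \<Rightarrow> ('r, 'm set) module"  (infixl \<open>Modulo\<close> 65)
  where "M Modulo N =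
    \<lparr>carrier = a_rcosets\<^bsub>M\<^esub> N, mult = undefined, one = undefined,
     zero = N, add = (\<lambda>A B. A <+>\<^bsub>M\<^esub> B),
     smult = (\<lambda>r A. \<Union>v\<in>A. N +>\<^bsub>M\<^esub> (r \<odot>\<^bsub>M\<^esub> v))\<rparr>"

definition direct_sum ::
    "'i set \<Rightarrow> ('i \<Rightarrow> ('r, 'm, 'b) module_scheme) \<Rightarrow> ('r, 'i \<Rightarrow> 'm) module"
  where "direct_sum I M =
    \<lparr>carrier = {f \<in> (\<Pi>\<^sub>E i\<in>I. carrier (M i)). finite {i\<in>I. f i \<noteq> \<zero>\<^bsub>M i\<^esub>}},
     mult = undefined, one = undefined,
     zero = (\<lambda>i\<in>I. \<zero>\<^bsub>M i\<^esub>),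
     add = (\<lambda>f g. \<lambda>i\<in>I. f i \<oplus>\<^bsub>M i\<^esub> g i),
     smult = (\<lambda>r f. \<lambda>i\<in>I. r \<odot>\<^bsub>M i\<^esub> f i)\<rparr>"

definition module_iso ::
    "('r, 'a) ring_scheme \<Rightarrow> ('r, 'm, 'b) module_scheme \<Rightarrow> ('r, 'n, 'c) module_scheme \<Rightarrow> bool"
  where "module_iso R M N \<longleftrightarrow>
    (\<exists>f. bij_betw f (carrier M) (carrier N)
       \<and> (\<forall>v\<in>carrier M. \<forall>w\<in>carrier M. f (v \<oplus>\<^bsub>M\<^esub> w) = f v \<oplus>\<^bsub>N\<^esub> f w)
       \<and> (\<forall>r\<in>carrier R. \<forall>v\<in>carrier M. f (r \<odot>\<^bsub>M\<^esub> v) = r \<odot>\<^bsub>N\<^esub> f v))"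

definition simple_module :: "('r, 'a) ring_scheme \<Rightarrow> ('r, 'm, 'b) module_scheme \<Rightarrow> bool"
  where "simple_module R M \<longleftrightarrow>
    carrier M \<noteq> {\<zero>\<^bsub>M\<^esub>} \<and> (\<forall>N. submodule N R M \<longrightarrow> N = {\<zero>\<^bsub>M\<^esub>} \<or> N = carrier M)"

text \<open>A module is semisimple if it is the sum of its simple submodules; the zero module is.\<close>

definition semisimple_module :: "('r, 'a) ring_scheme \<Rightarrow> ('r, 'm, 'b) module_scheme \<Rightarrow> bool"
  where "semisimple_module R M \<longleftrightarrow>
    carrier M =
      gen_submodule R M (\<Union> {N. submodule N R M \<and> simple_module R (M\<lparr>carrier := N\<rparr>)})"

definition maximal_submodule ::
    "'m set \<Rightarrow> ('r, 'a) ring_scheme \<Rightarrow> ('r, 'm, 'b) module_scheme \<Rightarrow> bool"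
  where "maximal_submodule N R M \<longleftrightarrow>
    submodule N R M \<and> N \<noteq> carrier M
      \<and> (\<forall>N'. submodule N' R M \<longrightarrow> N \<subseteq> N' \<longrightarrow> N' = N \<or> N' = carrier M)"

text \<open>\<open>LEAST\<close> and \<open>GREATEST\<close> refer to the inclusion order on sets.\<close>

definition radical :: "('r, 'a) ring_scheme \<Rightarrow> ('r, 'm, 'b) module_scheme \<Rightarrow> 'm set"
  where "radical R M = (LEAST N. submodule N R M \<and> semisimple_module R (M Modulo N))"

definition socle :: "('r, 'a) ring_scheme \<Rightarrow> ('r, 'm, 'b) module_scheme \<Rightarrow> 'm set"
  where "socle R M = (GREATEST N. submodule N R M \<and> semisimple_module R (M\<lparr>carrier := N\<rparr>))"

primrec radical_series ::
    "('r, 'a) ring_scheme \<Rightarrow> ('r, 'm, 'b) module_scheme \<Rightarrow> nat \<Rightarrow> 'm set" where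
  "radical_series R M 0 = carrier M"
| "radical_series R M (Suc m) = radical R (M\<lparr>carrier := radical_series R M m\<rparr>)"

primrec socle_series ::
    "('r, 'a) ring_scheme \<Rightarrow> ('r, 'm, 'b) module_scheme \<Rightarrow> nat \<Rightarrow> 'm set" where
  "socle_series R M 0 = {\<zero>\<^bsub>M\<^esub>}"
| "socle_series R M (Suc m) =
     {v \<in> carrier M. socle_series R M m +>\<^bsub>M\<^esub> v \<in> socle R (M Modulo socle_series R M m)}"

definition loewy_length :: "('r, 'a) ring_scheme \<Rightarrow> ('r, 'm, 'b) module_scheme \<Rightarrow> nat"
  where "loewy_length R M = (LEAST m. radical_series R M m = {\<zero>\<^bsub>M\<^esub>})"

definition loewy_layer ::
    "('r, 'a) ring_scheme \<Rightarrow> ('r, 'm, 'b) module_scheme \<Rightarrow> nat \<Rightarrow> ('r, 'm set) module"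
  where "loewy_layer R M m =
    M\<lparr>carrier := radical_series R M m\<rparr> Modulo radical_series R M (Suc m)"

section \<open>Induced modules\<close>

text \<open>
  The tensor product of \<open>R\<close>, as a right module over its subring \<open>Y\<close>, with a left \<open>Y\<close>-module \<open>V\<close>:
  the free abelian group on pairs, modulo the usual relations, with \<open>R\<close> acting on the left factor.
\<close>

definition free_pairs ::
    "('r, 'a) ring_scheme \<Rightarrow> ('r, 'v, 'b) module_scheme \<Rightarrow> ('r, ('r \<times> 'v) \<Rightarrow>\<^sub>0 int) module"
  where "free_pairs R V =
    \<lparr>carrier = {c. Poly_Mapping.keys c \<subseteq> carrier R \<times> carrier V},
     mult = undefined, one = undefined, zero = 0, add = (+),
     smult = (\<lambda>r. frag_extend (\<lambda>(s, v). frag_of (r \<otimes>\<^bsub>R\<^esub> s, v)))\<rparr>"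

definition tensor_relations ::
    "('r, 'a) ring_scheme \<Rightarrow> 'r set \<Rightarrow> ('r, 'v, 'b) module_scheme \<Rightarrow> (('r \<times> 'v) \<Rightarrow>\<^sub>0 int) set"
  where "tensor_relations R Y V =
    {frag_of (r \<oplus>\<^bsub>R\<^esub> s, v) - frag_of (r, v) - frag_of (s, v) | r s v.
       r \<in> carrier R \<and> s \<in> carrier R \<and> v \<in> carrier V}
    \<union> {frag_of (r, v \<oplus>\<^bsub>V\<^esub> w) - frag_of (r, v) - frag_of (r, w) | r v w.
       r \<in> carrier R \<and> v \<in> carrier V \<and> w \<in> carrier V}
    \<union> {frag_of (r \<otimes>\<^bsub>R\<^esub> y, v) - frag_of (r, y \<odot>\<^bsub>V\<^esub> v) | r y v.
       r \<in> carrier R \<and> y \<in> Y \<and> v \<in> carrier V}"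

definition tensor_kernel ::
    "('r, 'a) ring_scheme \<Rightarrow> 'r set \<Rightarrow> ('r, 'v, 'b) module_scheme \<Rightarrow> (('r \<times> 'v) \<Rightarrow>\<^sub>0 int) set"
  where "tensor_kernel R Y V = generate (add_monoid (free_pairs R V)) (tensor_relations R Y V)"

definition induced_module ::
    "('r, 'a) ring_scheme \<Rightarrow> 'r set \<Rightarrow> ('r, 'v, 'b) module_scheme
      \<Rightarrow> ('r, (('r \<times> 'v) \<Rightarrow>\<^sub>0 int) set) module"
  where "induced_module R Y V = free_pairs R V Modulo tensor_kernel R Y V"

definition pure_tensor ::
    "('r, 'a) ring_scheme \<Rightarrow> 'r set \<Rightarrow> ('r, 'v, 'b) module_scheme \<Rightarrow> 'r \<Rightarrow> 'v
      \<Rightarrow> (('r \<times> 'v) \<Rightarrow>\<^sub>0 int) set"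
  where "pure_tensor R Y V r v = tensor_kernel R Y V +>\<^bsub>free_pairs R V\<^esub> frag_of (r, v)"

section \<open>Simply linked data of nilpotent type\<close>

definition ground_field :: "'k::field_char_0 ring"
  where "ground_field = \<lparr>carrier = UNIV, mult = (*), one = 1, zero = 0, add = (+)\<rparr>"

record ('g, 'k) datum =
  grp :: "'g monoid"
  num :: nat
  pta :: "nat \<Rightarrow> 'g"
  ptb :: "nat \<Rightarrow> 'g"
  chi :: "nat \<Rightarrow> 'g \<Rightarrow> 'k"

definition dual_group :: "('g, 'k::field_char_0) datum \<Rightarrow> ('g \<Rightarrow> 'k) set"
  where "dual_group D = hom (grp D) (units_of ground_field)"

definition simply_linked_datum :: "('g, 'k::field_char_0) datum \<Rightarrow> bool"
  where "simply_linked_datum D \<longleftrightarrow>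
    comm_group (grp D) \<and> finite (carrier (grp D))
    \<and> (\<forall>i\<in>{1..num D}. pta D i \<in> carrier (grp D) \<and> ptb D i \<in> carrier (grp D)
         \<and> chi D i \<in> dual_group D \<and> pta D i \<otimes>\<^bsub>grp D\<^esub> ptb D i \<noteq> \<one>\<^bsub>grp D\<^esub>)
    \<and> (\<forall>i\<in>{1..num D}. \<forall>j\<in>{1..num D}. chi D j (pta D i) = chi D i (ptb D j))
    \<and> (\<forall>i\<in>{1..num D}. \<forall>j\<in>{1..num D}. i \<noteq> j \<longrightarrow>
         chi D i (pta D j) * chi D j (pta D i) = 1 \<and> chi D i (ptb D j) * chi D j (ptb D i) = 1)"

definition qmat :: "('g, 'k) datum \<Rightarrow> nat \<Rightarrow> nat \<Rightarrow> 'k"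
  where "qmat D i j = chi D j (pta D i)"

definition qdiag :: "('g, 'k) datum \<Rightarrow> nat \<Rightarrow> 'k"
  where "qdiag D i = chi D i (pta D i)"

definition mord :: "('g, 'k::field_char_0) datum \<Rightarrow> nat \<Rightarrow> nat"
  where "mord D i = (LEAST m. 0 < m \<and> qdiag D i ^ m = 1)"

text \<open>
  The excluded case \<open>qdiag D i = 1\<close> is degenerate: there the relations give \<open>x\<^sub>i = y\<^sub>i = 0\<close>, hence
  \<open>a\<^sub>i b\<^sub>i = 1\<close> in the algebra, and the standard monomials need not be independent.
\<close>

definition nilpotent_type :: "('g, 'k::field_char_0) datum \<Rightarrow> bool"
  where "nilpotent_type D \<longleftrightarrow> (\<forall>i\<in>{1..num D}. qdiag D i \<noteq> 1)"

section \<open>The algebra of a datum\<close>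

datatype 'g gen = GenG 'g | GenX nat | GenY nat

text \<open>Words under concatenation, written additively so that \<open>'a word \<Rightarrow>\<^sub>0 'k\<close> is the free algebra.\<close>

datatype 'a word = Word (letters: "'a list")

instantiation word :: (type) monoid_add
begin

definition zero_word :: "'a word" where "0 = Word []"

definition plus_word :: "'a word \<Rightarrow> 'a word \<Rightarrow> 'a word"
  where "u + v = Word (letters u @ letters v)"

instance
  by standard (simp_all add: zero_word_def plus_word_def)

end

type_synonym ('g, 'k) free_elt = "'g gen word \<Rightarrow>\<^sub>0 'k"
type_synonym ('g, 'k) alg_elt = "('g, 'k) free_elt set"
type_synonym ('g, 'k) verma_elt = "((('g, 'k) alg_elt \<times> 'k) \<Rightarrow>\<^sub>0 int) set"

definition gens :: "('g, 'k) datum \<Rightarrow> 'g gen set"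
  where "gens D = GenG ` carrier (grp D) \<union> GenX ` {1..num D} \<union> GenY ` {1..num D}"

definition free_alg :: "('g, 'k::field_char_0) datum \<Rightarrow> ('g, 'k) free_elt ring"
  where "free_alg D =
    \<lparr>carrier = {p. \<forall>w\<in>Poly_Mapping.keys p. set (letters w) \<subseteq> gens D},
     mult = (*), one = 1, zero = 0, add = (+)\<rparr>"

definition fconst :: "'k::field_char_0 \<Rightarrow> ('g, 'k) free_elt"
  where "fconst c = Poly_Mapping.single 0 c"

definition fgen :: "'g gen \<Rightarrow> ('g, 'k::field_char_0) free_elt"
  where "fgen s = Poly_Mapping.single (Word [s]) 1"

abbreviation fG :: "'g \<Rightarrow> ('g, 'k::field_char_0) free_elt" where "fG g \<equiv> fgen (GenG g)"
abbreviation fX :: "nat \<Rightarrow> ('g, 'k::field_char_0) free_elt" where "fX i \<equiv> fgen (GenX i)"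
abbreviation fY :: "nat \<Rightarrow> ('g, 'k::field_char_0) free_elt" where "fY i \<equiv> fgen (GenY i)"

definition relators :: "('g, 'k::field_char_0) datum \<Rightarrow> ('g, 'k) free_elt set"
  where "relators D =
    {fG g * fG h - fG (g \<otimes>\<^bsub>grp D\<^esub> h) | g h. g \<in> carrier (grp D) \<and> h \<in> carrier (grp D)}
    \<union> {fG \<one>\<^bsub>grp D\<^esub> - 1}
    \<union> {fG g * fX i - fconst (chi D i g) * fX i * fG g | g i.
        g \<in> carrier (grp D) \<and> i \<in> {1..num D}}
    \<union> {fG g * fY i - fconst (inverse (chi D i g)) * fY i * fG g | g i.
        g \<in> carrier (grp D) \<and> i \<in> {1..num D}}
    \<union> {fX i * fX j - fconst (qmat D i j) * fX j * fX i | i j.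
        i \<in> {1..num D} \<and> j \<in> {1..num D} \<and> i \<noteq> j}
    \<union> {fY i * fY j - fconst (qmat D i j) * fY j * fY i | i j.
        i \<in> {1..num D} \<and> j \<in> {1..num D} \<and> i \<noteq> j}
    \<union> {fX i * fY j - fconst (inverse (qmat D i j)) * fY j * fX i
          - (if i = j then fG (pta D i \<otimes>\<^bsub>grp D\<^esub> ptb D i) - 1 else 0) | i j.
        i \<in> {1..num D} \<and> j \<in> {1..num D}}
    \<union> {fX i ^ mord D i | i. i \<in> {1..num D}}
    \<union> {fY i ^ mord D i | i. i \<in> {1..num D}}"

definition alg_ideal :: "('g, 'k::field_char_0) datum \<Rightarrow> ('g, 'k) free_elt set"
  where "alg_ideal D = Idl\<^bsub>free_alg D\<^esub> (relators D)"

definition alg :: "('g, 'k::field_char_0) datum \<Rightarrow> ('g, 'k) alg_elt ring"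
  where "alg D = free_alg D Quot alg_ideal D"

definition cls :: "('g, 'k::field_char_0) datum \<Rightarrow> ('g, 'k) free_elt \<Rightarrow> ('g, 'k) alg_elt"
  where "cls D p = alg_ideal D +>\<^bsub>free_alg D\<^esub> p"

abbreviation hconst :: "('g, 'k::field_char_0) datum \<Rightarrow> 'k \<Rightarrow> ('g, 'k) alg_elt"
  where "hconst D c \<equiv> cls D (fconst c)"
abbreviation hG :: "('g, 'k::field_char_0) datum \<Rightarrow> 'g \<Rightarrow> ('g, 'k) alg_elt"
  where "hG D g \<equiv> cls D (fG g)"
abbreviation hX :: "('g, 'k::field_char_0) datum \<Rightarrow> nat \<Rightarrow> ('g, 'k) alg_elt"
  where "hX D i \<equiv> cls D (fX i)"
abbreviation hY :: "('g, 'k::field_char_0) datum \<Rightarrow> nat \<Rightarrow> ('g, 'k) alg_elt"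
  where "hY D i \<equiv> cls D (fY i)"

definition Ysub :: "('g, 'k::field_char_0) datum \<Rightarrow> ('g, 'k) alg_elt set"
  where "Ysub D = generate_ring (alg D)
    (range (hconst D) \<union> hG D ` carrier (grp D) \<union> hY D ` {1..num D})"

section \<open>The modules $Z(\gamma)$ and $L(\gamma)$\<close>

text \<open>
  The algebra map from \<open>Y\<close> to the field with \<open>g \<mapsto> \<gamma> g\<close> and \<open>y\<^sub>i \<mapsto> 0\<close>; it is unique on \<open>Ysub D\<close>, as
  its values on generators are prescribed, and only its values there matter.
\<close>

definition Ychar :: "('g, 'k::field_char_0) datum \<Rightarrow> ('g \<Rightarrow> 'k) \<Rightarrow> ('g, 'k) alg_elt \<Rightarrow> 'k"
  where "Ychar D \<gamma> = (SOME f. f \<in> ring_hom ((alg D)\<lparr>carrier := Ysub D\<rparr>) ground_field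
    \<and> (\<forall>c. f (hconst D c) = c)
    \<and> (\<forall>g\<in>carrier (grp D). f (hG D g) = \<gamma> g)
    \<and> (\<forall>i\<in>{1..num D}. f (hY D i) = 0))"

definition kmod :: "('g, 'k::field_char_0) datum \<Rightarrow> ('g \<Rightarrow> 'k) \<Rightarrow> (('g, 'k) alg_elt, 'k) module"
  where "kmod D \<gamma> = \<lparr>carrier = UNIV, mult = undefined, one = undefined, zero = 0, add = (+),
    smult = (\<lambda>u c. Ychar D \<gamma> u * c)\<rparr>"

definition verma ::
    "('g, 'k::field_char_0) datum \<Rightarrow> ('g \<Rightarrow> 'k) \<Rightarrow> (('g, 'k) alg_elt, ('g, 'k) verma_elt) module"
  where "verma D \<gamma> = induced_module (alg D) (Ysub D) (kmod D \<gamma>)"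

definition simple_top ::
    "('g, 'k::field_char_0) datum \<Rightarrow> ('g \<Rightarrow> 'k) \<Rightarrow> (('g, 'k) alg_elt, ('g, 'k) verma_elt set) module"
  where "simple_top D \<gamma> = verma D \<gamma> Modulo (THE N. maximal_submodule N (alg D) (verma D \<gamma>))"

text \<open>Exponent vectors are extensional, so that distinct ones label distinct basis vectors.\<close>

definition exponents :: "('g, 'k::field_char_0) datum \<Rightarrow> (nat \<Rightarrow> nat) set"
  where "exponents D = (\<Pi>\<^sub>E k\<in>{1..num D}. {..<mord D k})"

definition xmonom :: "('g, 'k::field_char_0) datum \<Rightarrow> (nat \<Rightarrow> nat) \<Rightarrow> ('g, 'k) alg_elt"
  where "xmonom D e =
    foldr (\<lambda>k p. (hX D k [^]\<^bsub>alg D\<^esub> e k) \<otimes>\<^bsub>alg D\<^esub> p) [1..<Suc (num D)] \<one>\<^bsub>alg D\<^esub>"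

definition basis_vec ::
    "('g, 'k::field_char_0) datum \<Rightarrow> ('g \<Rightarrow> 'k) \<Rightarrow> (nat \<Rightarrow> nat) \<Rightarrow> ('g, 'k) verma_elt"
  where "basis_vec D \<gamma> e = pure_tensor (alg D) (Ysub D) (kmod D \<gamma>) (xmonom D e) 1"

definition has_weight ::
    "('g, 'k::field_char_0) datum \<Rightarrow> (('g, 'k) alg_elt, 'm, 'b) module_scheme \<Rightarrow> 'm \<Rightarrow> ('g \<Rightarrow> 'k) \<Rightarrow> bool"
  where "has_weight D M v \<eta> \<longleftrightarrow> v \<in> carrier M \<and> v \<noteq> \<zero>\<^bsub>M\<^esub> \<and> \<eta> \<in> dual_group D
    \<and> (\<forall>g\<in>carrier (grp D). hG D g \<odot>\<^bsub>M\<^esub> v = hconst D (\<eta> g) \<odot>\<^bsub>M\<^esub> v)"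

text \<open>The weight of a weight element; it is determined on \<open>carrier (grp D)\<close>.\<close>

definition weight_of ::
    "('g, 'k::field_char_0) datum \<Rightarrow> (('g, 'k) alg_elt, 'm, 'b) module_scheme \<Rightarrow> 'm \<Rightarrow> ('g \<Rightarrow> 'k)"
  where "weight_of D M v = (SOME \<eta>. has_weight D M v \<eta>)"

definition primitive ::
    "('g, 'k::field_char_0) datum \<Rightarrow> (('g, 'k) alg_elt, 'm, 'b) module_scheme \<Rightarrow> 'm \<Rightarrow> bool"
  where "primitive D M v \<longleftrightarrow>
    (\<exists>\<eta>. has_weight D M v \<eta>) \<and> (\<forall>i\<in>{1..num D}. hY D i \<odot>\<^bsub>M\<^esub> v = \<zero>\<^bsub>M\<^esub>)"

text \<open>\<open>is_edge D \<gamma> j e\<close>: the exponent \<open>e\<close>, with \<open>0 \<le> e \<le> m\<^sub>j - 2\<close>, is the one defining \<open>e\<^sub>j\<close>.\<close>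

definition is_edge :: "('g, 'k::field_char_0) datum \<Rightarrow> ('g \<Rightarrow> 'k) \<Rightarrow> nat \<Rightarrow> nat \<Rightarrow> bool"
  where "is_edge D \<gamma> j e \<longleftrightarrow>
    e + 2 \<le> mord D j \<and> \<gamma> (pta D j \<otimes>\<^bsub>grp D\<^esub> ptb D j) = qdiag D j powi (- int e)"

definition Sset :: "('g, 'k::field_char_0) datum \<Rightarrow> ('g \<Rightarrow> 'k) \<Rightarrow> nat set"
  where "Sset D \<gamma> = {j \<in> {1..num D}. \<exists>e. is_edge D \<gamma> j e}"

definition edge :: "('g, 'k::field_char_0) datum \<Rightarrow> ('g \<Rightarrow> 'k) \<Rightarrow> nat \<Rightarrow> nat"
  where "edge D \<gamma> j = (THE e. is_edge D \<gamma> j e)"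

definition rank_of :: "('g, 'k::field_char_0) datum \<Rightarrow> ('g \<Rightarrow> 'k) \<Rightarrow> (nat \<Rightarrow> nat) \<Rightarrow> nat"
  where "rank_of D \<gamma> e = card {j \<in> Sset D \<gamma>. edge D \<gamma> j + 1 \<le> e j}"

text \<open>Labels of the primitive basis vectors of rank \<open>m\<close>; distinct ones may have equal weights.\<close>

definition primitive_exponents ::
    "('g, 'k::field_char_0) datum \<Rightarrow> ('g \<Rightarrow> 'k) \<Rightarrow> nat \<Rightarrow> (nat \<Rightarrow> nat) set"
  where "primitive_exponents D \<gamma> m =
    {e \<in> exponents D. primitive D (verma D \<gamma>) (basis_vec D \<gamma> e) \<and> rank_of D \<gamma> e = m}"

end

theory Submission
  imports Defs "HOL-Algebra.Free_Abelian_Groups"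
begin

text \<open>
  In the basis \<open>x\<^sup>e \<otimes> 1\<close> of \<open>Z(\<gamma>)\<close>, where \<open>e\<close> runs through a box of exponent vectors, \<open>x\<^sub>i\<close> raises the
  \<open>i\<close>-th exponent with a nonzero coefficient, and \<open>y\<^sub>i\<close> lowers it with a coefficient that vanishes
  exactly if \<open>i \<in> S(\<gamma>)\<close> and the exponent drops from \<open>edge i + 1\<close> to \<open>edge i\<close>. So each \<open>i \<in> S(\<gamma>)\<close>
  sets up a one-way wall, and the walls cut the box into cells: the cell of a basis vector is given by
  the set \<open>\<rho>\<close> of the walls that it has passed, and no element of \<open>H\<close> can shrink that set. Thus the span \<open>F\<^sub>k\<close> of the basis
  vectors of rank at least \<open>k\<close> is a submodule, and the theorem says that the chain of the \<open>F\<^sub>k\<close> is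
  both the radical and the (reversed) socle series.

  Distinct primitive basis vectors may have equal weights, so submodules need not be spanned by basis
  vectors, and the arguments move the extreme terms of an arbitrary vector instead.

  \<^item> Modulo \<open>F\<^sub>k\<^sub>+\<^sub>1\<close>, a vector supported in one cell of rank \<open>k\<close> can be lowered until only the
  lowest vector of the cell, its corner, is left, and the corner generates the cell. So each cell
  contributes a simple submodule, and \<open>F\<^sub>k / F\<^sub>k\<^sub>+\<^sub>1\<close> is semisimple (\<open>covers_K\<close>, \<open>semisimple_layer\<close>).

  \<^item> Each basis vector of \<open>F\<^sub>k\<^sub>+\<^sub>1\<close> is up to a scalar some \<open>x\<^sub>j\<close> times a basis vector of \<open>F\<^sub>k\<close>. If
  \<open>N + F\<^sub>k\<^sub>+\<^sub>1 = F\<^sub>k\<close>, iterating this pushes \<open>F\<^sub>k\<^sub>+\<^sub>1\<close> into \<open>N\<close> up to terms of ever higher degree, hence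
  into \<open>N\<close> (\<open>F_superfluous\<close>). As semisimple modules have complements, \<open>F\<^sub>k\<^sub>+\<^sub>1\<close> lies in every submodule
  of \<open>F\<^sub>k\<close> with semisimple quotient (\<open>superfluous_le_semisimple\<close>).

  \<^item> Dually, a vector outside \<open>F\<^sub>k\<^sub>+\<^sub>1\<close> can be raised until it lies in \<open>F\<^sub>k\<close> without reaching
  \<open>F\<^sub>k\<^sub>+\<^sub>1\<close> (\<open>F_essential\<close>), so the simple submodules of \<open>Z / F\<^sub>k\<^sub>+\<^sub>1\<close> lie in \<open>F\<^sub>k / F\<^sub>k\<^sub>+\<^sub>1\<close>.

  All this needs only coordinates in which the generators act in the way described; the locale
  \<open>ladder_module\<close> collects these conditions. That \<open>Z(\<gamma>)\<close> has such coordinates is the independence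
  of the standard monomials. It is obtained from explicit operators on the functions on the box:
  they satisfy the defining relations, which also yields the character of \<open>Y\<close> used in the definition of
  \<open>Z(\<gamma>)\<close>, and the universal property of the tensor product maps \<open>Z(\<gamma>)\<close> to this function module
  (\<open>co\<close>). Commuting the generators shows that the monomials span \<open>Z(\<gamma>)\<close> (\<open>recovered_all\<close>), so the
  map is bijective.

  Finally, a primitive vector of weight \<open>\<eta>\<close> receives a homomorphism from \<open>Z(\<eta>)\<close>. The preimage
  of \<open>F\<^sub>k\<^sub>+\<^sub>1\<close> under it is a maximal submodule, hence the unique one, so that every cell of rank \<open>k\<close>
  contributes one summand \<open>L(\<eta>)\<close> to the \<open>k\<close>-th layer (\<open>layer_iso\<close>).
\<close>

section \<open>Left modules over noncommutative rings\<close>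

lemma (in abelian_subgroup) coset_diff_iff:
  "\<lbrakk>v \<in> carrier G; w \<in> carrier G\<rbrakk> \<Longrightarrow> H +> v = H +> w \<longleftrightarrow> v \<ominus> w \<in> H"
  using a_rcos_self a_repr_independence' by (metis a_rcos_module a_minus_def)

locale left_module = R?: ring R + M?: abelian_group M
  for R :: "('r, 'a) ring_scheme" and M :: "('r, 'm, 'b) module_scheme" (structure) +
  assumes smult_closed: "\<lbrakk>r \<in> carrier R; v \<in> carrier M\<rbrakk> \<Longrightarrow> r \<odot> v \<in> carrier M"
    and smult_l_distr: "\<lbrakk>r \<in> carrier R; s \<in> carrier R; v \<in> carrier M\<rbrakk> \<Longrightarrow>
      (r \<oplus>\<^bsub>R\<^esub> s) \<odot> v = r \<odot> v \<oplus> s \<odot> v"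
    and smult_r_distr: "\<lbrakk>r \<in> carrier R; v \<in> carrier M; w \<in> carrier M\<rbrakk> \<Longrightarrow>
      r \<odot> (v \<oplus> w) = r \<odot> v \<oplus> r \<odot> w"
    and smult_assoc: "\<lbrakk>r \<in> carrier R; s \<in> carrier R; v \<in> carrier M\<rbrakk> \<Longrightarrow>
      (r \<otimes>\<^bsub>R\<^esub> s) \<odot> v = r \<odot> (s \<odot> v)"
    and smult_one: "v \<in> carrier M \<Longrightarrow> \<one>\<^bsub>R\<^esub> \<odot> v = v"

lemma submodule_subset: "submodule N R M \<Longrightarrow> N \<subseteq> carrier M"
  by (simp add: submodule_def subgroup_def)

lemma submodule_zero: "submodule N R M \<Longrightarrow> \<zero>\<^bsub>M\<^esub> \<in> N"
  by (simp add: submodule_def subgroup_def)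

lemma submodule_add: "\<lbrakk>submodule N R M; v \<in> N; w \<in> N\<rbrakk> \<Longrightarrow> v \<oplus>\<^bsub>M\<^esub> w \<in> N"
  by (simp add: submodule_def subgroup_def)

lemma submodule_smult: "\<lbrakk>submodule N R M; r \<in> carrier R; v \<in> N\<rbrakk> \<Longrightarrow> r \<odot>\<^bsub>M\<^esub> v \<in> N"
  by (simp add: submodule_def submodule_axioms_def)

lemma gen_submodule_incl: "X \<subseteq> gen_submodule R M X"
  by (auto simp: gen_submodule_def)

lemma gen_submodule_least: "\<lbrakk>submodule N R M; X \<subseteq> N\<rbrakk> \<Longrightarrow> gen_submodule R M X \<subseteq> N"
  by (auto simp: gen_submodule_def)

context left_module
begin

lemma smult_zero [simp]: "r \<in> carrier R \<Longrightarrow> r \<odot> \<zero> = \<zero>"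
  by (metis M.add.r_cancel_one' M.zero_closed smult_closed smult_r_distr M.l_zero)

lemma smult_minus: "\<lbrakk>r \<in> carrier R; v \<in> carrier M\<rbrakk> \<Longrightarrow> r \<odot> (\<ominus> v) = \<ominus> (r \<odot> v)"
  by (metis M.add.inv_equality M.add.inv_closed M.l_neg smult_closed smult_r_distr smult_zero)

lemma smult_diff: "\<lbrakk>r \<in> carrier R; v \<in> carrier M; w \<in> carrier M\<rbrakk> \<Longrightarrow>
    r \<odot> (v \<ominus> w) = r \<odot> v \<ominus> r \<odot> w"
  by (simp add: a_minus_def smult_r_distr smult_minus)

lemma zero_smult [simp]: "v \<in> carrier M \<Longrightarrow> \<zero>\<^bsub>R\<^esub> \<odot> v = \<zero>"
  by (metis M.add.r_cancel_one' R.zero_closed smult_closed smult_l_distr R.l_zero)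

lemma minus_smult: "\<lbrakk>r \<in> carrier R; v \<in> carrier M\<rbrakk> \<Longrightarrow> (\<ominus>\<^bsub>R\<^esub> r) \<odot> v = \<ominus> (r \<odot> v)"
  by (metis M.add.inv_equality R.add.inv_closed R.l_neg smult_closed smult_l_distr zero_smult)

lemma submoduleI:
  assumes "N \<subseteq> carrier M" "\<zero> \<in> N" "\<And>v w. \<lbrakk>v \<in> N; w \<in> N\<rbrakk> \<Longrightarrow> v \<oplus> w \<in> N"
    and "\<And>r v. \<lbrakk>r \<in> carrier R; v \<in> N\<rbrakk> \<Longrightarrow> r \<odot> v \<in> N"
  shows "submodule N R M"
proof -
  have "\<ominus> v \<in> N" if "v \<in> N" for v
    using assms(4)[of "\<ominus>\<^bsub>R\<^esub> \<one>\<^bsub>R\<^esub>" v] minus_smult[of "\<one>\<^bsub>R\<^esub>" v] that assms(1)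
    by (auto simp: smult_one)
  then show ?thesis using assms
    by (auto simp: submodule_def submodule_axioms_def subgroup_def a_inv_def)
qed

lemma submodule_a_inv: "\<lbrakk>submodule N R M; v \<in> N\<rbrakk> \<Longrightarrow> \<ominus> v \<in> N"
  by (simp add: submodule_def subgroup_def a_inv_def)

lemma submodule_diff: "\<lbrakk>submodule N R M; v \<in> N; w \<in> N\<rbrakk> \<Longrightarrow> v \<ominus> w \<in> N"
  by (simp add: a_minus_def submodule_add submodule_a_inv)

lemma submodule_carrier: "submodule (carrier M) R M"
  by (rule submoduleI) (auto simp: smult_closed)

lemma submodule_zero_set: "submodule {\<zero>} R M"
  by (rule submoduleI) auto

lemma submodule_Int: "\<lbrakk>submodule N R M; submodule P R M\<rbrakk> \<Longrightarrow> submodule (N \<inter> P) R M"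
  by (rule submoduleI)
    (auto intro: submodule_zero submodule_add submodule_smult dest: submodule_subset)

lemma submodule_gen: "X \<subseteq> carrier M \<Longrightarrow> submodule (gen_submodule R M X) R M"
  by (rule submoduleI; unfold gen_submodule_def)
    (use submodule_carrier in \<open>auto intro: submodule_zero submodule_add submodule_smult dest: submodule_subset\<close>)

lemma submodule_set_add:
  assumes "submodule N R M" "submodule P R M"
  shows "submodule (N <+>\<^bsub>M\<^esub> P) R M"
proof (rule submoduleI)
  note sub = submodule_subset[OF assms(1)] submodule_subset[OF assms(2)]
  show "N <+>\<^bsub>M\<^esub> P \<subseteq> carrier M"
    using sub by (auto simp: set_add_def')
  show "\<zero> \<in> N <+>\<^bsub>M\<^esub> P"
    using submodule_zero[OF assms(1)] submodule_zero[OF assms(2)] by (force simp: set_add_def')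
  fix v w assume "v \<in> N <+>\<^bsub>M\<^esub> P" "w \<in> N <+>\<^bsub>M\<^esub> P"
  then obtain a b c d where *: "v = a \<oplus> b" "w = c \<oplus> d" "a \<in> N" "c \<in> N" "b \<in> P" "d \<in> P"
    by (auto simp: set_add_def')
  then have "v \<oplus> w = (a \<oplus> c) \<oplus> (b \<oplus> d)"
    using sub by (simp add: subset_iff M.a_ac)
  then show "v \<oplus> w \<in> N <+>\<^bsub>M\<^esub> P"
    using * assms by (auto simp: set_add_def' intro: submodule_add)
next
  fix r v assume "r \<in> carrier R" "v \<in> N <+>\<^bsub>M\<^esub> P"
  then obtain a b where *: "v = a \<oplus> b" "a \<in> N" "b \<in> P"
    by (auto simp: set_add_def')
  then have "r \<odot> v = r \<odot> a \<oplus> r \<odot> b"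
    using \<open>r \<in> carrier R\<close> submodule_subset[OF assms(1)] submodule_subset[OF assms(2)]
    by (auto intro!: smult_r_distr)
  then show "r \<odot> v \<in> N <+>\<^bsub>M\<^esub> P"
    using * assms \<open>r \<in> carrier R\<close> by (auto simp: set_add_def' intro: submodule_smult)
qed

lemma set_add_upper:
  assumes "submodule N R M" "submodule P R M"
  shows "N \<subseteq> N <+>\<^bsub>M\<^esub> P" "P \<subseteq> N <+>\<^bsub>M\<^esub> P"
proof
  fix v assume "v \<in> N"
  then have "v = v \<oplus> \<zero>" using submodule_subset[OF assms(1)] by (simp add: subset_iff)
  then show "v \<in> N <+>\<^bsub>M\<^esub> P" using submodule_zero[OF assms(2)] \<open>v \<in> N\<close> by (auto simp: set_add_def')
next
  show "P \<subseteq> N <+>\<^bsub>M\<^esub> P"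
  proof
    fix v assume "v \<in> P"
    then have "v = \<zero> \<oplus> v" using submodule_subset[OF assms(2)] by (simp add: subset_iff)
    then show "v \<in> N <+>\<^bsub>M\<^esub> P" using submodule_zero[OF assms(1)] \<open>v \<in> P\<close>
      by (auto simp: set_add_def')
  qed
qed

lemma set_add_least:
  "\<lbrakk>submodule L R M; N \<subseteq> L; P \<subseteq> L\<rbrakk> \<Longrightarrow> N <+>\<^bsub>M\<^esub> P \<subseteq> L"
  by (auto simp: set_add_def' intro: submodule_add)

subsection \<open>Restricting the carrier\<close>

lemma submodule_restrict:
  assumes "submodule P R M"
  shows "submodule N R (M\<lparr>carrier := P\<rparr>) \<longleftrightarrow> submodule N R M \<and> N \<subseteq> P"
proof
  assume N: "submodule N R (M\<lparr>carrier := P\<rparr>)"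
  have "N \<subseteq> P" using submodule_subset[OF N] by simp
  moreover have "submodule N R M"
    using submodule_subset[OF assms] \<open>N \<subseteq> P\<close> submodule_zero[OF N] submodule_add[OF N]
      submodule_smult[OF N]
    by (intro submoduleI) auto
  ultimately show "submodule N R M \<and> N \<subseteq> P" by simp
next
  assume N: "submodule N R M \<and> N \<subseteq> P"
  have "inv\<^bsub>add_monoid (M\<lparr>carrier := P\<rparr>)\<^esub> v \<in> N" if v: "v \<in> N" for v
  proof -
    have vP: "v \<in> P" "\<ominus> v \<in> P" and vM: "v \<in> carrier M"
      using N v submodule_a_inv submodule_subset by blast+
    have "inv\<^bsub>add_monoid (M\<lparr>carrier := P\<rparr>)\<^esub> v = \<ominus> v"
      unfolding m_inv_def
    proof (rule the_equality)
      fix w assume "w \<in> carrier (add_monoid (M\<lparr>carrier := P\<rparr>)) \<and>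
        v \<otimes>\<^bsub>add_monoid (M\<lparr>carrier := P\<rparr>)\<^esub> w = \<one>\<^bsub>add_monoid (M\<lparr>carrier := P\<rparr>)\<^esub> \<and>
        w \<otimes>\<^bsub>add_monoid (M\<lparr>carrier := P\<rparr>)\<^esub> v = \<one>\<^bsub>add_monoid (M\<lparr>carrier := P\<rparr>)\<^esub>"
      then show "w = \<ominus> v"
        using submodule_subset[OF assms] vM by (auto intro!: M.minus_equality[symmetric])
    qed (use vP vM in \<open>auto simp: M.r_neg M.l_neg\<close>)
    then show ?thesis using N v submodule_a_inv by auto
  qed
  then show "submodule N R (M\<lparr>carrier := P\<rparr>)"
    using N by (auto simp: submodule_def submodule_axioms_def subgroup_def)
qed

lemma left_module_restrict:
  assumes "submodule P R M"
  shows "left_module R (M\<lparr>carrier := P\<rparr>)"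
proof -
  note sub = subsetD[OF submodule_subset[OF assms]]
  have "abelian_group (M\<lparr>carrier := P\<rparr>)"
  proof (rule abelian_groupI)
    fix v assume "v \<in> carrier (M\<lparr>carrier := P\<rparr>)"
    then show "\<exists>w\<in>carrier (M\<lparr>carrier := P\<rparr>). w \<oplus>\<^bsub>M\<lparr>carrier := P\<rparr>\<^esub> v = \<zero>\<^bsub>M\<lparr>carrier := P\<rparr>\<^esub>"
      using sub submodule_a_inv[OF assms] by (auto intro!: bexI[of _ "\<ominus> v"] simp: M.l_neg)
  qed (use assms sub in \<open>auto simp: M.a_ac intro: submodule_add submodule_zero\<close>)
  then show ?thesis
    by (intro left_module.intro left_module_axioms.intro R.ring_axioms)
      (use assms sub in \<open>auto simp: smult_l_distr smult_r_distr smult_assoc smult_one intro: submodule_smult\<close>)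
qed

subsection \<open>Quotients\<close>

lemma abelian_subgroup_submodule: "submodule N R M \<Longrightarrow> abelian_subgroup N M"
  by (auto intro!: abelian_subgroupI3 additive_subgroupI M.abelian_group_axioms simp: submodule_def)

lemma coset_eq_iff:
  "\<lbrakk>submodule N R M; v \<in> carrier M; w \<in> carrier M\<rbrakk> \<Longrightarrow> N +> v = N +> w \<longleftrightarrow> v \<ominus> w \<in> N"
  by (rule abelian_subgroup.coset_diff_iff[OF abelian_subgroup_submodule])

lemma mem_coset_iff:
  assumes "submodule N R M" "v \<in> carrier M"
  shows "w \<in> N +> v \<longleftrightarrow> w \<in> carrier M \<and> w \<ominus> v \<in> N"
proof -
  interpret abelian_subgroup N M using assms(1) by (rule abelian_subgroup_submodule)
  show ?thesis
    by (metis a_elemrcos_carrier a_rcos_module assms(2) a_minus_def)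
qed

lemma coset_eq_self_iff:
  assumes "submodule N R M" "v \<in> carrier M"
  shows "N +> v = N \<longleftrightarrow> v \<in> N"
proof -
  have "N +> \<zero> = N"
    using submodule_subset[OF assms(1)] by simp
  moreover have "v \<ominus> \<zero> = v"
    using assms(2) M.minus_equality[of "\<zero>" "\<zero>"] by (simp add: a_minus_def)
  ultimately show ?thesis using coset_eq_iff[OF assms, of "\<zero>"] by simp
qed

lemma coset_add:
  assumes "submodule N R M" "v \<in> carrier M" "w \<in> carrier M"
  shows "(N +> v) <+>\<^bsub>M\<^esub> (N +> w) = N +> (v \<oplus> w)"
  using abelian_subgroup.a_rcos_sum[OF abelian_subgroup_submodule] assms by blast

lemma coset_smult:
  assumes "submodule N R M" "v \<in> carrier M" "r \<in> carrier R"
  shows "(\<Union>w\<in>N +> v. N +> (r \<odot> w)) = N +> (r \<odot> v)"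
proof -
  have "N +> (r \<odot> w) = N +> (r \<odot> v)" if "w \<in> N +> v" for w
  proof -
    have w: "w \<in> carrier M" "w \<ominus> v \<in> N" using that assms by (auto simp: mem_coset_iff)
    have "r \<odot> w \<ominus> r \<odot> v \<in> N"
      using submodule_smult[OF assms(1,3) w(2)] assms w(1) by (simp add: smult_diff)
    then show ?thesis using assms w by (simp add: coset_eq_iff smult_closed)
  qed
  moreover have "v \<in> N +> v"
    using assms by (simp add: mem_coset_iff a_minus_def M.r_neg submodule_zero)
  ultimately show ?thesis by blast
qed

lemma carrier_quot: "carrier (M Modulo N) = (\<lambda>v. N +> v) ` carrier M"
  by (auto simp: quot_module_def A_RCOSETS_def')

lemma zero_quot [simp]: "\<zero>\<^bsub>M Modulo N\<^esub> = N"
  by (simp add: quot_module_def)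

lemma add_quot: "submodule N R M \<Longrightarrow> v \<in> carrier M \<Longrightarrow> w \<in> carrier M \<Longrightarrow>
    (N +> v) \<oplus>\<^bsub>M Modulo N\<^esub> (N +> w) = N +> (v \<oplus> w)"
  by (simp add: quot_module_def coset_add)

lemma smult_quot: "submodule N R M \<Longrightarrow> v \<in> carrier M \<Longrightarrow> r \<in> carrier R \<Longrightarrow>
    r \<odot>\<^bsub>M Modulo N\<^esub> (N +> v) = N +> (r \<odot> v)"
  by (simp add: quot_module_def coset_smult)

lemma left_module_quot:
  assumes N: "submodule N R M"
  shows "left_module R (M Modulo N)"
proof -
  have zero: "N = N +> \<zero>" using coset_eq_self_iff[OF N, of "\<zero>"] submodule_zero[OF N] by simp
  have "abelian_group (M Modulo N)"
  proof (rule abelian_groupI)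
    fix A assume "A \<in> carrier (M Modulo N)"
    then obtain v where v: "v \<in> carrier M" "A = N +> v" by (auto simp: carrier_quot)
    have "(N +> (\<ominus> v)) \<oplus>\<^bsub>M Modulo N\<^esub> A = \<zero>\<^bsub>M Modulo N\<^esub>"
      using v N by (simp add: add_quot M.l_neg flip: zero)
    then show "\<exists>B\<in>carrier (M Modulo N). B \<oplus>\<^bsub>M Modulo N\<^esub> A = \<zero>\<^bsub>M Modulo N\<^esub>"
      using v by (auto simp: carrier_quot)
    show "\<zero>\<^bsub>M Modulo N\<^esub> \<oplus>\<^bsub>M Modulo N\<^esub> A = A"
      unfolding zero_quot by (subst zero) (use v N in \<open>simp add: add_quot\<close>)
  next
    show "\<zero>\<^bsub>M Modulo N\<^esub> \<in> carrier (M Modulo N)" using zero by (auto simp: carrier_quot)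
  qed (auto simp: carrier_quot add_quot N M.a_ac)
  then show ?thesis
    by (intro left_module.intro left_module_axioms.intro R.ring_axioms)
      (auto simp: carrier_quot add_quot smult_quot N smult_closed smult_l_distr smult_r_distr
        smult_assoc smult_one)
qed

text \<open>The correspondence theorem: \<open>preimage\<close> is inverse to taking images of submodules above \<open>N\<close>.\<close>

definition preimage :: "'m set \<Rightarrow> 'm set set \<Rightarrow> 'm set"
  where "preimage N L = {v \<in> carrier M. N +> v \<in> L}"

lemma submodule_image_quot:
  assumes N: "submodule N R M" and L: "submodule L R M"
  shows "submodule ((\<lambda>v. N +> v) ` L) R (M Modulo N)"
proof -
  interpret Q: left_module R "M Modulo N" using N by (rule left_module_quot)
  note sub = subsetD[OF submodule_subset[OF L]]
  have zero: "N = N +> \<zero>" using coset_eq_self_iff[OF N, of "\<zero>"] submodule_zero[OF N] by simp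
  show ?thesis
  proof (rule Q.submoduleI)
    show "\<zero>\<^bsub>M Modulo N\<^esub> \<in> (\<lambda>v. N +> v) ` L"
      using zero submodule_zero[OF L] by auto
  qed (use sub N L in \<open>auto simp: carrier_quot add_quot smult_quot intro!: imageI
    intro: submodule_add submodule_smult\<close>)
qed

lemma submodule_preimage:
  assumes N: "submodule N R M" and L: "submodule L R (M Modulo N)"
  shows "submodule (preimage N L) R M" "N \<subseteq> preimage N L"
    "(\<lambda>v. N +> v) ` preimage N L = L"
proof -
  have zero: "v \<in> N \<Longrightarrow> N +> v \<in> L" for v
    using coset_eq_self_iff[OF N, of v] submodule_zero[OF L] submodule_subset[OF N] by auto
  show "submodule (preimage N L) R M"
  proof (rule submoduleI)
    show "\<zero> \<in> preimage N L" using zero[OF submodule_zero[OF N]] by (simp add: preimage_def)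
  next
    fix v w assume "v \<in> preimage N L" "w \<in> preimage N L"
    then show "v \<oplus> w \<in> preimage N L"
      using submodule_add[OF L, of "N +> v" "N +> w"] add_quot[OF N] by (auto simp: preimage_def)
  next
    fix r v assume "r \<in> carrier R" "v \<in> preimage N L"
    then show "r \<odot> v \<in> preimage N L"
      using submodule_smult[OF L, of r "N +> v"] smult_quot[OF N] by (auto simp: preimage_def smult_closed)
  qed (auto simp: preimage_def)
  show "N \<subseteq> preimage N L"
    using zero submodule_subset[OF N] by (auto simp: preimage_def)
  show "(\<lambda>v. N +> v) ` preimage N L = L"
    using submodule_subset[OF L] by (force simp: preimage_def carrier_quot)
qed

lemma preimage_image:
  assumes N: "submodule N R M" and L: "submodule L R M" and NL: "N \<subseteq> L"
  shows "preimage N ((\<lambda>v. N +> v) ` L) = L"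
proof
  show "L \<subseteq> preimage N ((\<lambda>v. N +> v) ` L)"
    using submodule_subset[OF L] by (auto simp: preimage_def)
  show "preimage N ((\<lambda>v. N +> v) ` L) \<subseteq> L"
  proof
    fix v assume "v \<in> preimage N ((\<lambda>v. N +> v) ` L)"
    then obtain w where vw: "v \<in> carrier M" "w \<in> L" "N +> v = N +> w"
      by (auto simp: preimage_def)
    have w: "w \<in> carrier M" using vw(2) submodule_subset[OF L] by auto
    have "v \<ominus> w \<in> L" using vw w coset_eq_iff[OF N] NL by auto
    then have "(v \<ominus> w) \<oplus> w \<in> L" using vw(2) submodule_add[OF L] by auto
    then show "v \<in> L" using vw(1) w by (simp add: a_minus_def M.a_assoc M.l_neg)
  qed
qed

end

section \<open>Semisimple subquotients, radical and socle\<close>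

context left_module
begin

definition covers :: "'m set \<Rightarrow> 'm set \<Rightarrow> bool"
  where "covers N K \<longleftrightarrow> submodule K R M \<and> N \<subset> K
    \<and> (\<forall>L. submodule L R M \<longrightarrow> N \<subseteq> L \<longrightarrow> L \<subseteq> K \<longrightarrow> L = N \<or> L = K)"

lemma coversD: "\<lbrakk>covers N K; submodule L R M; N \<subseteq> L; L \<subseteq> K\<rbrakk> \<Longrightarrow> L = N \<or> L = K"
  by (simp add: covers_def)

lemma preimage_kernel:
  assumes "submodule N R M"
  shows "preimage N {N} = N"
  using coset_eq_self_iff[OF assms] submodule_subset[OF assms] by (auto simp: preimage_def)

lemma preimage_mono: "L \<subseteq> L' \<Longrightarrow> preimage N L \<subseteq> preimage N L'"
  by (auto simp: preimage_def)

text \<open>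
  Simple submodules of a quotient are rewritten as covering pairs upstairs, so that the later arguments
  can stay inside one module and compare its submodules by inclusion.
\<close>

lemma simple_quot_iff:
  assumes N: "submodule N R M" and K: "submodule K R (M Modulo N)"
  shows "simple_module R ((M Modulo N)\<lparr>carrier := K\<rparr>) \<longleftrightarrow> covers N (preimage N K)"
proof -
  interpret Q: left_module R "M Modulo N" using N by (rule left_module_quot)
  let ?\<pi> = "(`) (\<lambda>v. N +> v)"
  note pre = submodule_preimage[OF N]
  have kernel: "?\<pi> N = {N}"
    using pre(3)[OF Q.submodule_zero_set] preimage_kernel[OF N] by simp
  show ?thesis
  proof
    assume simple: "simple_module R ((M Modulo N)\<lparr>carrier := K\<rparr>)"
    have "N \<noteq> preimage N K"
    proof
      assume "N = preimage N K"
      then have "K = {N}" using pre(3)[OF K] kernel by metis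
      then show False using simple by (simp add: simple_module_def)
    qed
    moreover have "L = N \<or> L = preimage N K"
      if L: "submodule L R M" "N \<subseteq> L" "L \<subseteq> preimage N K" for L
    proof -
      have "?\<pi> L \<subseteq> K" using pre(3)[OF K] L(3) by blast
      then have "submodule (?\<pi> L) R ((M Modulo N)\<lparr>carrier := K\<rparr>)"
        using submodule_image_quot[OF N L(1)] Q.submodule_restrict[OF K] by blast
      then have "?\<pi> L = {N} \<or> ?\<pi> L = K" using simple by (auto simp: simple_module_def)
      then show ?thesis
        using preimage_image[OF N L(1,2)] preimage_kernel[OF N] by metis
    qed
    ultimately show "covers N (preimage N K)"
      using pre(1,2)[OF K] unfolding covers_def by blast
  next
    assume cov: "covers N (preimage N K)"
    have "K \<noteq> {N}" using cov preimage_kernel[OF N] by (metis covers_def less_irrefl)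
    moreover have "L = {N} \<or> L = K"
      if "submodule L R ((M Modulo N)\<lparr>carrier := K\<rparr>)" for L
    proof -
      have L: "submodule L R (M Modulo N)" "L \<subseteq> K"
        using that Q.submodule_restrict[OF K] by auto
      have "preimage N L = N \<or> preimage N L = preimage N K"
        using coversD[OF cov pre(1,2)[OF L(1)] preimage_mono[OF L(2)]] .
      then show ?thesis using pre(3)[OF L(1)] pre(3)[OF K] kernel by metis
    qed
    ultimately show "simple_module R ((M Modulo N)\<lparr>carrier := K\<rparr>)"
      by (auto simp: simple_module_def)
  qed
qed

lemma semisimple_quot_iff:
  assumes N: "submodule N R M"
  shows "semisimple_module R (M Modulo N) \<longleftrightarrow>
    (\<forall>L. submodule L R M \<longrightarrow> N \<subseteq> L \<longrightarrow> (\<forall>K. covers N K \<longrightarrow> K \<subseteq> L) \<longrightarrow> L = carrier M)"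
proof -
  interpret Q: left_module R "M Modulo N" using N by (rule left_module_quot)
  let ?\<pi> = "(`) (\<lambda>v. N +> v)"
  let ?U = "\<Union> {K. submodule K R (M Modulo N) \<and> simple_module R ((M Modulo N)\<lparr>carrier := K\<rparr>)}"
  note pre = submodule_preimage[OF N]
  show ?thesis
  proof (intro iffI allI impI)
    fix L assume ss: "semisimple_module R (M Modulo N)" and L: "submodule L R M" "N \<subseteq> L"
      and cov: "\<forall>K. covers N K \<longrightarrow> K \<subseteq> L"
    have "K \<subseteq> ?\<pi> L" if "submodule K R (M Modulo N)" "simple_module R ((M Modulo N)\<lparr>carrier := K\<rparr>)" for K
    proof -
      have "preimage N K \<subseteq> L" using cov that simple_quot_iff[OF N that(1)] by simp
      then have "?\<pi> (preimage N K) \<subseteq> ?\<pi> L" by (rule image_mono)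
      then show ?thesis unfolding pre(3)[OF that(1)] .
    qed
    then have "?U \<subseteq> ?\<pi> L" by blast
    then have "gen_submodule R (M Modulo N) ?U \<subseteq> ?\<pi> L"
      by (rule gen_submodule_least[OF submodule_image_quot[OF N L(1)]])
    with ss have "carrier (M Modulo N) \<subseteq> ?\<pi> L"
      unfolding semisimple_module_def by (rule ssubst)
    then have "preimage N (carrier (M Modulo N)) \<subseteq> L"
      using preimage_mono[of "carrier (M Modulo N)" "?\<pi> L" N] unfolding preimage_image[OF N L] by blast
    then have "carrier M \<subseteq> L"
      by (auto simp: preimage_def carrier_quot)
    then show "L = carrier M" using submodule_subset[OF L(1)] by auto
  next
    assume *: "\<forall>L. submodule L R M \<longrightarrow> N \<subseteq> L \<longrightarrow> (\<forall>K. covers N K \<longrightarrow> K \<subseteq> L) \<longrightarrow> L = carrier M"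
    have U: "?U \<subseteq> carrier (M Modulo N)" using submodule_subset by blast
    define G where "G = gen_submodule R (M Modulo N) ?U"
    have G: "submodule G R (M Modulo N)" unfolding G_def using U by (rule Q.submodule_gen)
    have "K \<subseteq> preimage N G" if K: "covers N K" for K
    proof -
      have K': "submodule K R M" "N \<subseteq> K" using K unfolding covers_def by blast+
      have "simple_module R ((M Modulo N)\<lparr>carrier := ?\<pi> K\<rparr>)"
        using K unfolding simple_quot_iff[OF N submodule_image_quot[OF N K'(1)]] preimage_image[OF N K'] .
      then have "?\<pi> K \<subseteq> ?U"
        using submodule_image_quot[OF N K'(1)] by (intro Union_upper CollectI conjI)
      then have "?\<pi> K \<subseteq> G" using gen_submodule_incl[of ?U R "M Modulo N"] unfolding G_def by (rule subset_trans)
      then show ?thesis using preimage_mono[of "?\<pi> K" G N] unfolding preimage_image[OF N K'] by blast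
    qed
    then have "preimage N G = carrier M" by (intro *[rule_format] pre(1,2)[OF G])
    then have "carrier (M Modulo N) = G" using pre(3)[OF G] unfolding carrier_quot by argo
    then show "semisimple_module R (M Modulo N)" unfolding semisimple_module_def G_def .
  qed
qed

text \<open>The lattice-theoretic form of semisimplicity of the subquotient \<open>P / N\<close>.\<close>

definition semisimple_over :: "'m set \<Rightarrow> 'm set \<Rightarrow> bool"
  where "semisimple_over N P \<longleftrightarrow>
    (\<forall>L. submodule L R M \<longrightarrow> N \<subseteq> L \<longrightarrow> (\<forall>K. covers N K \<longrightarrow> K \<subseteq> P \<longrightarrow> K \<subseteq> L) \<longrightarrow> P \<subseteq> L)"

lemma semisimple_subquot_iff:
  assumes N: "submodule N R M" and P: "submodule P R M" and NP: "N \<subseteq> P"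
  shows "semisimple_module R (M\<lparr>carrier := P\<rparr> Modulo N) \<longleftrightarrow> semisimple_over N P"
proof -
  interpret P: left_module R "M\<lparr>carrier := P\<rparr>" using P by (rule left_module_restrict)
  have N': "submodule N R (M\<lparr>carrier := P\<rparr>)" using N NP submodule_restrict[OF P] by simp
  have cov: "P.covers N K \<longleftrightarrow> covers N K \<and> K \<subseteq> P" for K
  proof -
    have "P.covers N K \<longleftrightarrow> covers N K" if K: "K \<subseteq> P"
    proof -
      have "(submodule L R M \<and> L \<subseteq> P \<longrightarrow> N \<subseteq> L \<longrightarrow> L \<subseteq> K \<longrightarrow> X) \<longleftrightarrow>
          (submodule L R M \<longrightarrow> N \<subseteq> L \<longrightarrow> L \<subseteq> K \<longrightarrow> X)" for L X
        using order_trans[OF _ K, of L] by argo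
      then show ?thesis unfolding P.covers_def covers_def submodule_restrict[OF P] using K by simp
    qed
    moreover have "K \<subseteq> P" if "P.covers N K"
      using that unfolding P.covers_def submodule_restrict[OF P] by blast
    ultimately show ?thesis by blast
  qed
  show ?thesis
    unfolding P.semisimple_quot_iff[OF N'] submodule_restrict[OF P] cov semisimple_over_def
  proof (intro iffI allI impI)
    fix L
    assume *: "\<forall>L. submodule L R M \<and> L \<subseteq> P \<longrightarrow> N \<subseteq> L \<longrightarrow>
        (\<forall>K. covers N K \<and> K \<subseteq> P \<longrightarrow> K \<subseteq> L) \<longrightarrow> L = carrier (M\<lparr>carrier := P\<rparr>)"
      and L: "submodule L R M" "N \<subseteq> L" "\<forall>K. covers N K \<longrightarrow> K \<subseteq> P \<longrightarrow> K \<subseteq> L"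
    have "K \<subseteq> L \<inter> P" if "covers N K \<and> K \<subseteq> P" for K
      using L(3) that by simp
    then have "L \<inter> P = carrier (M\<lparr>carrier := P\<rparr>)"
      using submodule_Int[OF L(1) P] L(2) NP by (intro *[rule_format]) simp_all
    then show "P \<subseteq> L" by auto
  next
    fix L
    assume *: "\<forall>L. submodule L R M \<longrightarrow> N \<subseteq> L \<longrightarrow> (\<forall>K. covers N K \<longrightarrow> K \<subseteq> P \<longrightarrow> K \<subseteq> L) \<longrightarrow> P \<subseteq> L"
      and L: "submodule L R M \<and> L \<subseteq> P" "N \<subseteq> L" "\<forall>K. covers N K \<and> K \<subseteq> P \<longrightarrow> K \<subseteq> L"
    have "P \<subseteq> L" by (rule *[rule_format]) (use L in simp_all)
    then show "L = carrier (M\<lparr>carrier := P\<rparr>)" using L(1) by auto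
  qed
qed

lemma radical_eqI:
  assumes P: "submodule P R M" and F: "submodule F R M" "F \<subseteq> P"
    and ss: "semisimple_over F P"
    and least: "\<And>N. \<lbrakk>submodule N R M; N \<subseteq> P; semisimple_over N P\<rbrakk> \<Longrightarrow> F \<subseteq> N"
  shows "radical R (M\<lparr>carrier := P\<rparr>) = F"
  unfolding radical_def
proof (rule Least_equality)
  show "submodule F R (M\<lparr>carrier := P\<rparr>) \<and> semisimple_module R (M\<lparr>carrier := P\<rparr> Modulo F)"
    using F ss semisimple_subquot_iff[OF F(1) P F(2)] submodule_restrict[OF P] by simp
next
  fix N assume "submodule N R (M\<lparr>carrier := P\<rparr>) \<and> semisimple_module R (M\<lparr>carrier := P\<rparr> Modulo N)"
  then show "F \<le> N"
    using least[of N] semisimple_subquot_iff[OF _ P, of N] submodule_restrict[OF P] by simp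
qed

text \<open>
  The set on the left is the one that defines the next step of the socle series. A semisimple submodule
  of \<open>M / F\<close> is generated by its simple submodules, so it suffices to bound these by \<open>P / F\<close>.
\<close>

lemma socle_quot_eqI:
  assumes P: "submodule P R M" and F: "submodule F R M" "F \<subseteq> P"
    and ss: "semisimple_over F P"
    and covers_le: "\<And>K. covers F K \<Longrightarrow> K \<subseteq> P"
  shows "{v \<in> carrier M. F +> v \<in> socle R (M Modulo F)} = P"
proof -
  let ?\<pi> = "(`) (\<lambda>v. F +> v)"
  interpret Q: left_module R "M Modulo F" using F(1) by (rule left_module_quot)
  \<comment> \<open>Restriction and quotient commute, as the operations of a quotient do not depend on the carrier.\<close>
  have restrict: "(M Modulo F)\<lparr>carrier := ?\<pi> L\<rparr> = M\<lparr>carrier := L\<rparr> Modulo F" for L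
  proof -
    have coset: "(+>\<^bsub>M\<lparr>carrier := L\<rparr>\<^esub>) = (+>\<^bsub>M\<^esub>)"
      by (intro ext) (simp add: a_r_coset_def r_coset_def)
    have add: "(<+>\<^bsub>M\<lparr>carrier := L\<rparr>\<^esub>) = (<+>\<^bsub>M\<^esub>)"
      by (intro ext) (simp add: set_add_def set_mult_def)
    have "a_rcosets\<^bsub>M\<lparr>carrier := L\<rparr>\<^esub> F = ?\<pi> L"
      unfolding A_RCOSETS_def' coset by auto
    then show ?thesis unfolding quot_module_def coset add by simp
  qed
  have "socle R (M Modulo F) = ?\<pi> P"
    unfolding socle_def
  proof (rule Greatest_equality)
    have "semisimple_module R (M\<lparr>carrier := P\<rparr> Modulo F)"
      using ss semisimple_subquot_iff[OF F(1) P F(2)] by blast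
    then show "submodule (?\<pi> P) R (M Modulo F) \<and> semisimple_module R ((M Modulo F)\<lparr>carrier := ?\<pi> P\<rparr>)"
      using submodule_image_quot[OF F(1) P] unfolding restrict by blast
  next
    fix L assume "submodule L R (M Modulo F) \<and> semisimple_module R ((M Modulo F)\<lparr>carrier := L\<rparr>)"
    then have L: "submodule L R (M Modulo F)" "semisimple_module R ((M Modulo F)\<lparr>carrier := L\<rparr>)"
      by blast+
    note pre = submodule_preimage[OF F(1) L(1)]
    have "semisimple_over F (preimage F L)"
      using L(2) semisimple_subquot_iff[OF F(1) pre(1,2)] restrict[of "preimage F L"]
      unfolding pre(3) by metis
    then have "preimage F L \<subseteq> P"
      using P F(2) covers_le unfolding semisimple_over_def by blast
    then show "L \<le> ?\<pi> P" using pre(3) by blast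
  qed
  then show ?thesis using preimage_image[OF F(1) P F(2)] unfolding preimage_def by metis
qed

text \<open>
  In the semisimple module \<open>P / N\<close> the image of \<open>F\<close> has a complement \<open>C / N\<close>, found by Zorn's lemma. Then
  \<open>C + F = P\<close>, so \<open>C = P\<close> as \<open>F\<close> is superfluous, and the image of \<open>F\<close> is zero.
\<close>

lemma superfluous_le_semisimple:
  assumes P: "submodule P R M" and F: "submodule F R M" "F \<subseteq> P" and N: "submodule N R M" "N \<subseteq> P"
    and superfluous: "\<And>C. \<lbrakk>submodule C R M; C \<subseteq> P; P \<subseteq> C <+>\<^bsub>M\<^esub> F\<rbrakk> \<Longrightarrow> P \<subseteq> C"
    and ss: "semisimple_over N P"
  shows "F \<subseteq> N"
proof -
  let ?A = "{C. submodule C R M \<and> N \<subseteq> C \<and> C \<subseteq> P \<and> C \<inter> (N <+>\<^bsub>M\<^esub> F) \<subseteq> N}"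
  have "\<exists>C\<in>?A. \<forall>X\<in>?A. C \<subseteq> X \<longrightarrow> X = C"
  proof (rule subset_Zorn_nonempty)
    have "N \<in> ?A" by (intro CollectI conjI N order_refl Int_lower1)
    then show "?A \<noteq> {}" unfolding ex_in_conv[symmetric] by (rule exI)
  next
    fix \<C> assume "\<C> \<noteq> {}" and chain: "subset.chain ?A \<C>"
    have "\<C> \<subseteq> ?A" using chain unfolding subset.chain_def by (rule conjunct1)
    note mem = subsetD[OF this]
    have "submodule (\<Union>\<C>) R M"
    proof (rule submoduleI)
      fix v w assume "v \<in> \<Union>\<C>" "w \<in> \<Union>\<C>"
      then obtain C D where "C \<in> \<C>" "D \<in> \<C>" "v \<in> C" "w \<in> D" by auto
      moreover from this have "C \<subseteq> D \<or> D \<subseteq> C"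
        using subset.chain_total[OF chain, of C D] by auto
      ultimately obtain E where E: "E \<in> \<C>" "v \<in> E" "w \<in> E" by blast
      then show "v \<oplus> w \<in> \<Union>\<C>" using submodule_add[OF _ E(2,3), of R] mem[OF E(1)] by blast
    next
      obtain C where "C \<in> \<C>" using \<open>\<C> \<noteq> {}\<close> by blast
      then show "\<zero> \<in> \<Union>\<C>" using mem[of C] submodule_zero[of C R M] by blast
    next
      show "\<Union>\<C> \<subseteq> carrier M" using mem submodule_subset[OF P] by blast
    next
      fix r v assume "r \<in> carrier R" "v \<in> \<Union>\<C>"
      then obtain C where "C \<in> \<C>" "v \<in> C" by blast
      then show "r \<odot> v \<in> \<Union>\<C>"
        using mem[of C] submodule_smult[of C R M r v] \<open>r \<in> carrier R\<close> by blast
    qed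
    moreover obtain C where "C \<in> \<C>" using \<open>\<C> \<noteq> {}\<close> by blast
    then have "N \<subseteq> \<Union>\<C>" using mem[of C] by blast
    moreover have "\<Union>\<C> \<subseteq> P" "\<Union>\<C> \<inter> (N <+>\<^bsub>M\<^esub> F) \<subseteq> N" using mem by blast+
    ultimately show "\<Union>\<C> \<in> ?A" by blast
  qed
  then obtain C where C_mem: "C \<in> ?A" and C_max: "\<forall>X\<in>?A. C \<subseteq> X \<longrightarrow> X = C"
    by (rule bexE)
  have C: "submodule C R M" "N \<subseteq> C" "C \<subseteq> P" "C \<inter> (N <+>\<^bsub>M\<^esub> F) \<subseteq> N"
    using C_mem unfolding mem_Collect_eq by blast+
  have max: "X = C"
    if "submodule X R M" "N \<subseteq> X" "X \<subseteq> P" "X \<inter> (N <+>\<^bsub>M\<^esub> F) \<subseteq> N" "C \<subseteq> X" for X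
    by (rule C_max[rule_format]) (intro CollectI conjI that)+
  note CF = submodule_set_add[OF C(1) F(1)] set_add_upper(1)[OF C(1) F(1)]
  note carr = subsetD[OF submodule_subset[OF C(1)]] subsetD[OF submodule_subset[OF F(1)]]
    subsetD[OF submodule_subset[OF N(1)]]
  \<comment> \<open>A simple submodule that misses \<open>C + F\<close> could be added to \<open>C\<close>, against its maximality.\<close>
  have "K \<subseteq> C <+>\<^bsub>M\<^esub> F" if K: "covers N K" "K \<subseteq> P" for K
  proof -
    have K': "submodule K R M" "N \<subseteq> K" using K unfolding covers_def by (simp_all add: psubset_eq)
    have "K \<inter> (C <+>\<^bsub>M\<^esub> F) = N \<or> K \<inter> (C <+>\<^bsub>M\<^esub> F) = K"
      using K'(2) C(2) CF(2) by (intro coversD[OF K(1)] submodule_Int K'(1) CF(1)) blast+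
    moreover have "K \<subseteq> C" if N_eq: "K \<inter> (C <+>\<^bsub>M\<^esub> F) = N"
    proof -
      have "(C <+>\<^bsub>M\<^esub> K) \<inter> (N <+>\<^bsub>M\<^esub> F) \<subseteq> N"
      proof
        fix v assume v: "v \<in> (C <+>\<^bsub>M\<^esub> K) \<inter> (N <+>\<^bsub>M\<^esub> F)"
        obtain c k where ck: "v = c \<oplus> k" "c \<in> C" "k \<in> K"
          using v unfolding set_add_def' by blast
        obtain n f where nf: "v = n \<oplus> f" "n \<in> N" "f \<in> F"
          using v unfolding set_add_def' by blast
        note * = ck nf
        have car: "c \<in> carrier M" "k \<in> carrier M" "n \<in> carrier M" "f \<in> carrier M"
          using * carr submodule_subset[OF K'(1)] by auto
        have "k = (\<ominus> c) \<oplus> (c \<oplus> k)" using car by (simp add: M.r_neg1)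
        also have "\<dots> = (\<ominus> c) \<oplus> (n \<oplus> f)" unfolding ck(1)[symmetric] nf(1) ..
        also have "\<dots> = ((\<ominus> c) \<oplus> n) \<oplus> f" using car by (simp add: M.a_assoc)
        finally have "k \<in> C <+>\<^bsub>M\<^esub> F"
          using * C(2) submodule_add[OF C(1) submodule_a_inv[OF C(1) *(2)], of n]
          unfolding set_add_def' by blast
        then have "k \<in> N" using N_eq *(3) by blast
        then have "v \<in> C" using submodule_add[OF C(1) ck(2)] C(2) unfolding ck(1) by blast
        then show "v \<in> N" using v C(4) by blast
      qed
      then have "C <+>\<^bsub>M\<^esub> K = C"
        using C(2) set_add_upper[OF C(1) K'(1)]
        by (intro max submodule_set_add[OF C(1) K'(1)] set_add_least[OF P C(3) K(2)]) blast+
      then show ?thesis using set_add_upper(2)[OF C(1) K'(1)] by argo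
    qed
    ultimately show ?thesis using CF by blast
  qed
  then have "P \<subseteq> C <+>\<^bsub>M\<^esub> F"
    using ss CF(1) subset_trans[OF C(2) CF(2)] unfolding semisimple_over_def by blast
  then have "P \<subseteq> C" by (rule superfluous[OF C(1,3)])
  then have "F \<subseteq> C \<inter> (N <+>\<^bsub>M\<^esub> F)" using F(2) set_add_upper(2)[OF N(1) F(1)] by blast
  then show ?thesis using C(4) by (rule subset_trans)
qed

end

section \<open>Modules with a monomial basis and edges\<close>

text \<open>
  The abstract form of \<open>Z(\<gamma>)\<close>: \<open>co v e\<close> is the coefficient of \<open>v\<close> at the basis vector labelled by
  the exponent vector \<open>e\<close>, and \<open>E\<close> is the box of exponents with side lengths \<open>h\<close>. The operators are
  described by their effect on coefficients, so \<open>co (x i v) e\<close> involves the exponent below \<open>e\<close> although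
  \<open>x i\<close> raises exponents. The coefficients \<open>cx\<close> never vanish, and \<open>cy\<close> vanishes exactly at the walls.
\<close>

locale ladder_module = left_module R Z
  for R :: "('r, 'a) ring_scheme" and Z :: "('r, 'z, 'b) module_scheme" (structure) +
  fixes I :: "nat set" and h :: "nat \<Rightarrow> nat" and S :: "nat set" and ed :: "nat \<Rightarrow> nat"
    and co :: "'z \<Rightarrow> (nat \<Rightarrow> nat) \<Rightarrow> 'k::field"
    and cst :: "'k \<Rightarrow> 'r" and Gs :: "'s set" and gr :: "'s \<Rightarrow> 'r" and x y :: "nat \<Rightarrow> 'r"
    and wt :: "'s \<Rightarrow> (nat \<Rightarrow> nat) \<Rightarrow> 'k" and cx cy :: "nat \<Rightarrow> (nat \<Rightarrow> nat) \<Rightarrow> 'k"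
    and E :: "(nat \<Rightarrow> nat) set"
  assumes E_eq: "E = (\<Pi>\<^sub>E i\<in>I. {..<h i})"
    and finite_I: "finite I" and S_subset: "S \<subseteq> I" and h_pos: "i \<in> I \<Longrightarrow> 0 < h i"
    and ed_bound: "i \<in> S \<Longrightarrow> ed i + 2 \<le> h i"
    and cst_closed: "cst c \<in> carrier R" and gr_closed: "g \<in> Gs \<Longrightarrow> gr g \<in> carrier R"
    and x_closed: "i \<in> I \<Longrightarrow> x i \<in> carrier R" and y_closed: "i \<in> I \<Longrightarrow> y i \<in> carrier R"
    and co_eqI: "\<lbrakk>v \<in> carrier Z; w \<in> carrier Z; \<And>e. e \<in> E \<Longrightarrow> co v e = co w e\<rbrakk> \<Longrightarrow> v = w"
    and co_surj: "\<exists>v\<in>carrier Z. \<forall>e\<in>E. co v e = f e"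
    and co_add: "\<lbrakk>v \<in> carrier Z; w \<in> carrier Z; e \<in> E\<rbrakk> \<Longrightarrow> co (v \<oplus> w) e = co v e + co w e"
    and co_cst: "\<lbrakk>v \<in> carrier Z; e \<in> E\<rbrakk> \<Longrightarrow> co (cst c \<odot> v) e = c * co v e"
    and co_g: "\<lbrakk>g \<in> Gs; v \<in> carrier Z; e \<in> E\<rbrakk> \<Longrightarrow> co (gr g \<odot> v) e = wt g e * co v e"
    and co_x: "\<lbrakk>i \<in> I; v \<in> carrier Z; e \<in> E\<rbrakk> \<Longrightarrow>
      co (x i \<odot> v) e = (if e i = 0 then 0 else cx i e * co v (e(i := e i - 1)))"
    and co_y: "\<lbrakk>i \<in> I; v \<in> carrier Z; e \<in> E\<rbrakk> \<Longrightarrow>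
      co (y i \<odot> v) e = (if Suc (e i) < h i then cy i e * co v (e(i := Suc (e i))) else 0)"
    and cx_nonzero: "\<lbrakk>i \<in> I; e \<in> E\<rbrakk> \<Longrightarrow> cx i e \<noteq> 0"
    and cy_eq_0_iff: "\<lbrakk>i \<in> I; e \<in> E; Suc (e i) < h i\<rbrakk> \<Longrightarrow> cy i e = 0 \<longleftrightarrow> i \<in> S \<and> e i = ed i"
    and generated: "\<lbrakk>N \<subseteq> carrier Z; \<zero> \<in> N; \<And>v w. \<lbrakk>v \<in> N; w \<in> N\<rbrakk> \<Longrightarrow> v \<oplus> w \<in> N;
      \<And>s v. \<lbrakk>s \<in> range cst \<union> gr ` Gs \<union> x ` I \<union> y ` I; v \<in> N\<rbrakk> \<Longrightarrow> s \<odot> v \<in> N\<rbrakk> \<Longrightarrow> submodule N R Z"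
begin

subsection \<open>The basis\<close>

lemma E_up: "\<lbrakk>e \<in> E; i \<in> I; Suc (e i) < h i\<rbrakk> \<Longrightarrow> e(i := Suc (e i)) \<in> E"
  by (auto simp: E_eq PiE_def extensional_def)

lemma E_down: "\<lbrakk>e \<in> E; i \<in> I\<rbrakk> \<Longrightarrow> e(i := e i - 1) \<in> E"
  unfolding E_eq PiE_iff extensional_def by (auto intro: less_imp_diff_less)

lemma E_bound: "\<lbrakk>e \<in> E; i \<in> I\<rbrakk> \<Longrightarrow> e i < h i"
  by (auto simp: E_eq)

lemma finite_E: "finite E"
  unfolding E_eq using finite_I by (intro finite_PiE) auto

lemma co_zero: "e \<in> E \<Longrightarrow> co \<zero> e = 0"
  by (metis M.l_zero M.zero_closed add_cancel_right_right co_add)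

lemma co_neg: "\<lbrakk>v \<in> carrier Z; e \<in> E\<rbrakk> \<Longrightarrow> co (\<ominus> v) e = - co v e"
  using co_add[of "\<ominus> v" v e] co_zero[of e] by (simp add: M.l_neg eq_neg_iff_add_eq_0)

lemma co_diff: "\<lbrakk>v \<in> carrier Z; w \<in> carrier Z; e \<in> E\<rbrakk> \<Longrightarrow> co (v \<ominus> w) e = co v e - co w e"
  by (simp add: a_minus_def co_add co_neg)

definition b :: "(nat \<Rightarrow> nat) \<Rightarrow> 'z"
  where "b e = (SOME v. v \<in> carrier Z \<and> (\<forall>e'\<in>E. co v e' = (if e' = e then 1 else 0)))"

lemma b_closed: "b e \<in> carrier Z" and co_b: "e' \<in> E \<Longrightarrow> co (b e) e' = (if e' = e then 1 else 0)"
proof -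
  have "\<exists>v. v \<in> carrier Z \<and> (\<forall>e'\<in>E. co v e' = (if e' = e then 1 else 0))"
    using co_surj[of "\<lambda>e'. if e' = e then 1 else 0"] by blast
  from someI_ex[OF this] show "b e \<in> carrier Z" "e' \<in> E \<Longrightarrow> co (b e) e' = (if e' = e then 1 else 0)"
    by (simp_all add: b_def)
qed

definition linear_subspace :: "'z set \<Rightarrow> bool"
  where "linear_subspace N \<longleftrightarrow> N \<subseteq> carrier Z \<and> \<zero> \<in> N \<and> (\<forall>v\<in>N. \<forall>w\<in>N. v \<oplus> w \<in> N)
    \<and> (\<forall>c. \<forall>v\<in>N. cst c \<odot> v \<in> N)"

lemma linear_subspace_submodule: "submodule N R Z \<Longrightarrow> linear_subspace N"
  by (auto simp: linear_subspace_def cst_closed intro: submodule_zero submodule_add submodule_smult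
      dest: submodule_subset)

lemma linear_subspace_set_add:
  assumes "linear_subspace N" "linear_subspace P"
  shows "linear_subspace (N <+>\<^bsub>Z\<^esub> P)"
proof -
  have NP: "N \<subseteq> carrier Z" "P \<subseteq> carrier Z" "\<zero> \<in> N" "\<zero> \<in> P"
    using assms by (auto simp: linear_subspace_def)
  have "\<zero> \<oplus> \<zero> \<in> N <+>\<^bsub>Z\<^esub> P" using NP by (auto simp: set_add_def' simp del: M.l_zero M.r_zero)
  moreover have "v \<oplus> w \<in> N <+>\<^bsub>Z\<^esub> P" if vw: "v \<in> N <+>\<^bsub>Z\<^esub> P" "w \<in> N <+>\<^bsub>Z\<^esub> P" for v w
  proof -
    obtain a p where ap: "v = a \<oplus> p" "a \<in> N" "p \<in> P"
      using vw(1) by (auto simp: set_add_def')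
    obtain c q where cq: "w = c \<oplus> q" "c \<in> N" "q \<in> P"
      using vw(2) by (auto simp: set_add_def')
    note * = ap cq
    then have "v \<oplus> w = (a \<oplus> c) \<oplus> (p \<oplus> q)"
      using NP by (simp add: subset_iff M.a_ac)
    then show ?thesis using * assms unfolding set_add_def' linear_subspace_def by blast
  qed
  moreover have "cst c \<odot> v \<in> N <+>\<^bsub>Z\<^esub> P" if v: "v \<in> N <+>\<^bsub>Z\<^esub> P" for c v
  proof -
    obtain a p where *: "v = a \<oplus> p" "a \<in> N" "p \<in> P"
      using v by (auto simp: set_add_def')
    then have "cst c \<odot> v = (cst c \<odot> a) \<oplus> (cst c \<odot> p)"
      using NP cst_closed by (auto intro!: smult_r_distr)
    then show ?thesis using * assms unfolding set_add_def' linear_subspace_def by blast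
  qed
  moreover have "N <+>\<^bsub>Z\<^esub> P \<subseteq> carrier Z" using NP by (auto simp: set_add_def')
  ultimately show ?thesis by (simp add: linear_subspace_def)
qed

lemma mem_linear_subspace:
  assumes N: "linear_subspace N" and v: "v \<in> carrier Z" and supp: "\<And>e. \<lbrakk>e \<in> E; co v e \<noteq> 0\<rbrakk> \<Longrightarrow> b e \<in> N"
  shows "v \<in> N"
proof -
  have "v \<in> N" if "finite A" "A \<subseteq> E" "v \<in> carrier Z" "\<forall>e\<in>E. co v e \<noteq> 0 \<longrightarrow> e \<in> A" "\<forall>e\<in>A. b e \<in> N" for A v
    using that
  proof (induction A arbitrary: v)
    case empty
    then have "v = \<zero>" by (intro co_eqI) (auto simp: co_zero)
    then show ?case using N by (simp add: linear_subspace_def)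
  next
    case (insert a A)
    define w where "w = v \<oplus> cst (- co v a) \<odot> b a"
    have closed: "cst c \<odot> b a \<in> carrier Z" for c by (simp add: smult_closed cst_closed b_closed)
    have co_w: "co w e = (if e = a then 0 else co v e)" if "e \<in> E" for e
      using that insert.prems(2) closed by (simp add: w_def co_add co_cst co_b b_closed)
    have "w \<in> N"
      by (rule insert.IH)
        (use insert.prems co_w closed in \<open>auto simp: w_def split: if_splits\<close>)
    moreover have "cst (co v a) \<odot> b a \<in> N" using N insert.prems by (simp add: linear_subspace_def)
    ultimately have "w \<oplus> cst (co v a) \<odot> b a \<in> N" using N by (simp add: linear_subspace_def)
    also have "w \<oplus> cst (co v a) \<odot> b a = v"
      using insert.prems(2) closed
      by (intro co_eqI) (auto simp: w_def co_add co_cst co_b b_closed)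
    finally show ?case .
  qed
  from this[of "{e \<in> E. co v e \<noteq> 0}" v] show ?thesis using v supp finite_E by simp
qed

definition span :: "((nat \<Rightarrow> nat) \<Rightarrow> bool) \<Rightarrow> 'z set"
  where "span A = {v \<in> carrier Z. \<forall>e\<in>E. co v e \<noteq> 0 \<longrightarrow> A e}"

lemma b_span: "A e \<Longrightarrow> b e \<in> span A"
  by (simp add: span_def b_closed co_b)

lemma b_span_iff: "e \<in> E \<Longrightarrow> b e \<in> span A \<longleftrightarrow> A e"
  by (auto simp: span_def b_closed co_b)

lemma linear_subspace_span: "linear_subspace (span A)"
  by (auto simp: linear_subspace_def span_def co_zero co_add co_cst smult_closed cst_closed)

lemma span_le:
  assumes "linear_subspace N" "\<And>e. \<lbrakk>e \<in> E; A e\<rbrakk> \<Longrightarrow> b e \<in> N"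
  shows "span A \<subseteq> N"
  using mem_linear_subspace[OF assms(1)] assms(2) by (auto simp: span_def)

lemma span_le_submodule:
  assumes "submodule N R Z" "\<And>e. \<lbrakk>e \<in> E; A e\<rbrakk> \<Longrightarrow> b e \<in> N"
  shows "span A \<subseteq> N"
  using span_le[OF linear_subspace_submodule] assms by blast

text \<open>
  Both closure conditions are read in the direction in which an operator moves: \<open>x\<close> up, always, and \<open>y\<close>
  down, except across a wall.
\<close>

lemma submodule_span:
  assumes up: "\<And>e i. \<lbrakk>A e; e \<in> E; i \<in> I; Suc (e i) < h i\<rbrakk> \<Longrightarrow> A (e(i := Suc (e i)))"
    and down: "\<And>e i. \<lbrakk>A (e(i := Suc (e i))); e \<in> E; i \<in> I; Suc (e i) < h i; \<not> (i \<in> S \<and> e i = ed i)\<rbrakk> \<Longrightarrow> A e"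
  shows "submodule (span A) R Z"
proof (rule generated)
  fix s v assume s: "s \<in> range cst \<union> gr ` Gs \<union> x ` I \<union> y ` I" and v: "v \<in> span A"
  have vZ: "v \<in> carrier Z" using v by (simp add: span_def)
  have "s \<in> carrier R" using s cst_closed gr_closed x_closed y_closed by auto
  moreover have "A e" if e: "e \<in> E" "co (s \<odot> v) e \<noteq> 0" for e
  proof -
    consider c where "s = cst c" | g where "g \<in> Gs" "s = gr g" | i where "i \<in> I" "s = x i" | i where "i \<in> I" "s = y i"
      using s by blast
    then show ?thesis
    proof cases
      case 1 then show ?thesis using e v by (auto simp: span_def co_cst)
    next
      case 2 then show ?thesis using e v by (auto simp: span_def co_g)
    next
      case 3
      then have *: "e i \<noteq> 0" "co v (e(i := e i - 1)) \<noteq> 0" using e vZ by (auto simp: co_x split: if_splits)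
      let ?e = "e(i := e i - 1)"
      have "A ?e" using * v E_down[OF e(1) 3(1)] by (auto simp: span_def)
      moreover have "Suc (?e i) < h i" using *(1) E_bound[OF e(1) 3(1)] by simp
      ultimately have "A (?e(i := Suc (?e i)))" using up E_down[OF e(1) 3(1)] 3(1) by blast
      then show ?thesis using *(1) by simp
    next
      case 4
      then have *: "Suc (e i) < h i" "cy i e \<noteq> 0" "co v (e(i := Suc (e i))) \<noteq> 0"
        using e vZ by (auto simp: co_y split: if_splits)
      then have "A (e(i := Suc (e i)))" using v E_up[OF e(1) 4(1)] by (auto simp: span_def)
      then show ?thesis using down e 4 * cy_eq_0_iff by blast
    qed
  qed
  ultimately show "s \<odot> v \<in> span A" using vZ by (simp add: span_def smult_closed)
qed (use linear_subspace_span[of A] in \<open>auto simp: linear_subspace_def\<close>)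

lemma b_cst_mem:
  assumes "linear_subspace N" "cst c \<odot> b e \<in> N" "c \<noteq> 0"
  shows "b e \<in> N"
proof -
  have "cst (inverse c) \<odot> (cst c \<odot> b e) = b e"
    by (rule co_eqI) (use assms(3) in \<open>simp_all add: co_cst b_closed smult_closed cst_closed\<close>)
  then show ?thesis using assms by (metis linear_subspace_def)
qed

lemma x_b:
  assumes "e \<in> E" "i \<in> I" "Suc (e i) < h i"
  shows "x i \<odot> b e = cst (cx i (e(i := Suc (e i)))) \<odot> b (e(i := Suc (e i)))"
proof (rule co_eqI)
  fix e' assume e': "e' \<in> E"
  have "e' = e(i := Suc (e i))" if "e' i \<noteq> 0" "e'(i := e' i - 1) = e"
    using that by auto
  moreover have "(e(i := Suc (e i)))(i := (e(i := Suc (e i))) i - 1) = e" by simp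
  ultimately show "co (x i \<odot> b e) e' = co (cst (cx i (e(i := Suc (e i)))) \<odot> b (e(i := Suc (e i)))) e'"
    using e' assms E_up[OF assms] E_down[OF e' assms(2)]
    by (cases "e' = e(i := Suc (e i))") (simp_all add: co_x co_cst co_b b_closed smult_closed, blast)
qed (use assms in \<open>simp_all add: smult_closed x_closed cst_closed b_closed\<close>)

lemma b_up:
  assumes "submodule N R Z" "b e \<in> N" "e \<in> E" "i \<in> I" "Suc (e i) < h i"
  shows "b (e(i := Suc (e i))) \<in> N"
  using b_cst_mem[OF linear_subspace_submodule[OF assms(1)]] x_b[OF assms(3-5)] cx_nonzero[OF assms(4) E_up[OF assms(3-5)]]
    submodule_smult[OF assms(1) x_closed[OF assms(4)] assms(2)] by metis

subsection \<open>The filtration by rank\<close>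

text \<open>
  The walls that \<open>e\<close> has passed; their number is the rank of \<open>e\<close>.
\<close>

definition rho :: "(nat \<Rightarrow> nat) \<Rightarrow> nat set"
  where "rho e = {j \<in> S. ed j < e j}"

definition F :: "nat \<Rightarrow> 'z set"
  where "F k = span (\<lambda>e. k \<le> card (rho e))"

definition deg :: "(nat \<Rightarrow> nat) \<Rightarrow> nat"
  where "deg e = (\<Sum>i\<in>I. e i)"

text \<open>
  The lowest exponent vector of the cell \<open>rho e = T\<close>; it belongs to a primitive vector.
\<close>

definition corner :: "nat set \<Rightarrow> nat \<Rightarrow> nat"
  where "corner T = (\<lambda>i\<in>I. if i \<in> T then Suc (ed i) else 0)"

lemma finite_S: "finite S" using S_subset finite_I by (rule finite_subset)

lemma rho_subset: "rho e \<subseteq> S" by (auto simp: rho_def)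

lemma finite_rho: "finite (rho e)" using rho_subset finite_S by (rule finite_subset)

lemma rho_up: "rho e \<subseteq> rho (e(i := Suc (e i)))"
  by (auto simp: rho_def)

lemma rho_up_eq: "\<not> (i \<in> S \<and> e i = ed i) \<Longrightarrow> rho (e(i := Suc (e i))) = rho e"
  by (auto simp: rho_def)

lemma rho_up_insert: "rho (e(i := Suc (e i))) \<subseteq> insert i (rho e)"
  by (auto simp: rho_def)

lemma card_rho_up: "card (rho e) \<le> card (rho (e(i := Suc (e i))))"
    "card (rho (e(i := Suc (e i)))) \<le> Suc (card (rho e))"
  using card_mono[OF finite_rho rho_up] card_mono[OF _ rho_up_insert, of i e] finite_rho[of e]
  by (auto simp: card_insert_if split: if_splits)

lemma deg_up: "i \<in> I \<Longrightarrow> deg (e(i := Suc (e i))) = Suc (deg e)"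
  using finite_I by (simp add: deg_def sum.remove[of I i] )

lemma down_up: "e i \<noteq> 0 \<Longrightarrow> (e(i := e i - 1))(i := Suc ((e(i := e i - 1)) i)) = (e :: nat \<Rightarrow> nat)"
  by auto

lemma submodule_F: "submodule (F k) R Z"
  unfolding F_def by (rule submodule_span) (use card_rho_up order_trans in blast, simp add: rho_up_eq)

lemma F_mono: "k \<le> l \<Longrightarrow> F l \<subseteq> F k"
  by (auto simp: F_def span_def)

lemma F_0: "F 0 = carrier Z"
  by (auto simp: F_def span_def)

lemma F_eq_zero: "card S < k \<Longrightarrow> F k = {\<zero>}"
proof -
  assume k: "card S < k"
  have "card (rho e) < k" for e using card_mono[OF finite_S rho_subset, of e] k by linarith
  then have "v = \<zero>" if "v \<in> F k" for v
    using that by (intro co_eqI) (auto simp: F_def span_def co_zero simp flip: not_less)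
  then show ?thesis using submodule_zero[OF submodule_F] by blast
qed

lemma corner_E: "T \<subseteq> S \<Longrightarrow> corner T \<in> E"
  using h_pos ed_bound S_subset by (fastforce simp: E_eq corner_def)

lemma rho_corner: "T \<subseteq> S \<Longrightarrow> rho (corner T) = T"
  using S_subset by (auto simp: rho_def corner_def)

text \<open>
  From the corner of a cell the \<open>x i\<close> reach every exponent vector above it, and these include all cells
  \<open>T' \<supseteq> T\<close>.
\<close>

lemma corner_generates:
  assumes N: "submodule N R Z" "b (corner T) \<in> N" and e: "e \<in> E" "T \<subseteq> rho e"
  shows "b e \<in> N"
  using e
proof (induction "deg e" arbitrary: e rule: less_induct)
  case less
  have le: "corner T i \<le> e i" if "i \<in> I" for i
    using less.prems(2) that by (auto simp: corner_def rho_def Suc_le_eq)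
  show ?case
  proof (cases "\<exists>i\<in>I. corner T i < e i")
    case True
    then obtain i where i: "i \<in> I" "corner T i < e i" by auto
    let ?e = "e(i := e i - 1)"
    have e: "?e(i := Suc (?e i)) = e" using i(2) by auto
    have "T \<subseteq> rho ?e"
      using less.prems(2) i by (auto simp: rho_def corner_def)
    then have "b ?e \<in> N"
      using less.hyps[of ?e] deg_up[OF i(1), of ?e] e E_down[OF less.prems(1) i(1)] by simp
    then show ?thesis
      using b_up[OF N(1) _ E_down[OF less.prems(1) i(1)] i(1)] e E_bound[OF less.prems(1) i(1)] i(2) by fastforce
  next
    case False
    have "e = corner T"
    proof
      fix i show "e i = corner T i"
        using False le[of i] less.prems(1) by (cases "i \<in> I") (force simp: E_eq corner_def)+
    qed
    then show ?thesis using N(2) by simp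
  qed
qed

lemma F_generated:
  assumes "submodule N R Z" "\<And>T. \<lbrakk>T \<subseteq> S; card T = k\<rbrakk> \<Longrightarrow> b (corner T) \<in> N"
  shows "F k \<subseteq> N"
  unfolding F_def
proof (rule span_le_submodule[OF assms(1)])
  fix e assume e: "e \<in> E" "k \<le> card (rho e)"
  obtain T where "T \<subseteq> rho e" "card T = k" using obtain_subset_with_card_n[OF e(2)] by metis
  then show "b e \<in> N"
    using corner_generates[OF assms(1)] assms(2) e(1) rho_subset by blast
qed

subsection \<open>The layers are semisimple\<close>

text \<open>
  The preimage of the simple summand of \<open>F (card T) / F (Suc (card T))\<close> that belongs to the cell \<open>T\<close>.
\<close>

definition K :: "nat set \<Rightarrow> 'z set"
  where "K T = span (\<lambda>e. rho e = T \<or> card T < card (rho e))"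

lemma submodule_K: "submodule (K T) R Z"
  unfolding K_def
proof (rule submodule_span)
  fix e i
  assume "rho e = T \<or> card T < card (rho e)"
  then show "rho (e(i := Suc (e i))) = T \<or> card T < card (rho (e(i := Suc (e i))))"
    using rho_up[of e i] card_rho_up[of e i] psubset_card_mono[OF finite_rho, of "rho e" "e(i := Suc (e i))"]
    by (metis less_le_trans psubsetI)
qed (auto simp: rho_up_eq)

lemma F_le_K: "F (Suc (card T)) \<subseteq> K T" and K_le_F: "K T \<subseteq> F (card T)"
  by (auto simp: F_def K_def span_def)

lemma corner_mem_F: "T \<subseteq> S \<Longrightarrow> b (corner T) \<in> F (card T)"
  by (simp add: F_def b_span rho_corner)

lemma corner_not_mem_F: "T \<subseteq> S \<Longrightarrow> b (corner T) \<notin> F (Suc (card T))"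
  by (simp add: F_def b_span_iff corner_E rho_corner)

text \<open>
  Applying some \<open>y i\<close> to \<open>u\<close> lowers the top degree of its part in the cell \<open>T\<close>, and \<open>y i\<close> maps distinct
  basis vectors to multiples of distinct ones, so nothing cancels. As long as that part contains an
  exponent other than the corner, one can choose \<open>i\<close> such that the result is still outside
  \<open>F (Suc (card T))\<close>; at the end only a multiple of the corner is left.
\<close>

lemma corner_lowest:
  assumes L: "submodule L R Z" "F (Suc (card T)) \<subseteq> L" "L \<subseteq> K T"
    and u: "u \<in> L" "u \<notin> F (Suc (card T))"
    and bound: "\<And>e. \<lbrakk>e \<in> E; co u e \<noteq> 0; rho e = T\<rbrakk> \<Longrightarrow> deg e \<le> d"
  shows "b (corner T) \<in> L"
  using u bound
proof (induction d arbitrary: u rule: less_induct)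
  case (less d)
  have uZ: "u \<in> carrier Z" using less.prems(1) submodule_subset[OF L(1)] by blast
  have supp: "rho e = T \<or> card T < card (rho e)" if "e \<in> E" "co u e \<noteq> 0" for e
    using that less.prems(1) L(3) by (auto simp: K_def span_def)
  obtain e where e: "e \<in> E" "co u e \<noteq> 0" "rho e = T"
    using less.prems(2) uZ supp by (fastforce simp: F_def span_def)
  have corner_le: "corner T i \<le> e' i" if "i \<in> I" "rho e' = T" for e' i
    using that by (auto simp: corner_def rho_def Suc_le_eq)
  show ?case
  proof (cases "\<exists>e\<in>E. co u e \<noteq> 0 \<and> rho e = T \<and> e \<noteq> corner T")
    case True
    then obtain e where e: "e \<in> E" "co u e \<noteq> 0" "rho e = T" "e \<noteq> corner T" by auto
    obtain i where i: "i \<in> I" "corner T i < e i"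
    proof -
      have "\<exists>i\<in>I. e i \<noteq> corner T i"
      proof (rule ccontr)
        assume "\<not> ?thesis"
        then have "e i = corner T i" for i
          using e(1) by (cases "i \<in> I") (force simp: E_eq corner_def)+
        then show False using e(4) by auto
      qed
      then show ?thesis using that corner_le[OF _ e(3)] by (metis le_neq_implies_less)
    qed
    let ?e = "e(i := e i - 1)"
    have eq: "?e(i := Suc (?e i)) = e" using i(2) by auto
    have not_edge: "\<not> (i \<in> S \<and> ?e i = ed i)"
    proof
      assume *: "i \<in> S \<and> ?e i = ed i"
      then have "i \<in> T" using e(3) i(2) by (auto simp: rho_def)
      then show False using * i by (auto simp: corner_def)
    qed
    have Suc_lt: "Suc (?e i) < h i" using E_bound[OF e(1) i(1)] i(2) by simp
    have rho_e: "rho ?e = T" using rho_up_eq[of i ?e, OF not_edge] eq e(3) by simp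
    have "co (y i \<odot> u) ?e \<noteq> 0"
      using E_down[OF e(1) i(1)] Suc_lt not_edge cy_eq_0_iff[OF i(1) E_down[OF e(1) i(1)] Suc_lt] e(2) eq
      by (simp add: co_y i(1) uZ del: fun_upd_apply)
    then have "y i \<odot> u \<notin> F (Suc (card T))"
      using E_down[OF e(1) i(1)] rho_e by (auto simp: F_def span_def)
    moreover have "y i \<odot> u \<in> L"
      using submodule_smult[OF L(1) y_closed[OF i(1)] less.prems(1)] .
    moreover have "deg e \<le> d" "0 < deg e"
      using less.prems(3)[OF e(1-3)] deg_up[OF i(1), of ?e] unfolding eq by linarith+
    moreover have "deg e' \<le> d - 1" if e': "e' \<in> E" "co (y i \<odot> u) e' \<noteq> 0" "rho e' = T" for e'
    proof -
      have *: "Suc (e' i) < h i" "cy i e' \<noteq> 0" "co u (e'(i := Suc (e' i))) \<noteq> 0"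
        using e' i(1) uZ by (auto simp: co_y split: if_splits)
      then have "rho (e'(i := Suc (e' i))) = T"
        using rho_up_eq[of i e'] cy_eq_0_iff[OF i(1) e'(1)] e'(3) by auto
      then have "deg (e'(i := Suc (e' i))) \<le> d"
        using less.prems(3) * E_up[OF e'(1) i(1)] by blast
      then show ?thesis using deg_up[OF i(1), of e'] by simp
    qed
    ultimately show ?thesis
      using less.IH[of "d - 1" "y i \<odot> u"] by simp
  next
    case False
    let ?c = "co u (corner T)"
    have c: "?c \<noteq> 0" using False e by auto
    have closed: "cst ?c \<odot> b (corner T) \<in> carrier Z" by (simp add: smult_closed cst_closed b_closed)
    have "u \<ominus> cst ?c \<odot> b (corner T) \<in> F (Suc (card T))"
      using False supp uZ closed by (fastforce simp: F_def span_def co_diff co_cst co_b b_closed split: if_splits)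
    then have "u \<ominus> (u \<ominus> cst ?c \<odot> b (corner T)) \<in> L"
      using L(2) less.prems(1) submodule_diff[OF L(1)] by blast
    moreover have "u \<ominus> (u \<ominus> cst ?c \<odot> b (corner T)) = cst ?c \<odot> b (corner T)"
      using uZ closed by (intro co_eqI) (simp_all add: co_diff)
    ultimately show ?thesis using b_cst_mem[OF linear_subspace_submodule[OF L(1)] _ c] by simp
  qed
qed

lemma covers_K:
  assumes T: "T \<subseteq> S"
  shows "covers (F (Suc (card T))) (K T)"
  unfolding covers_def
proof (intro conjI allI impI submodule_K)
  have "b (corner T) \<in> K T" using T by (simp add: K_def b_span rho_corner)
  then show "F (Suc (card T)) \<subset> K T" using corner_not_mem_F[OF T] F_le_K by blast
  fix L assume L: "submodule L R Z" "F (Suc (card T)) \<subseteq> L" "L \<subseteq> K T"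
  show "L = F (Suc (card T)) \<or> L = K T"
  proof (cases "L = F (Suc (card T))")
    case False
    then obtain u where u: "u \<in> L" "u \<notin> F (Suc (card T))" using L(2) by blast
    have "deg e \<le> Max (deg ` E)" if "e \<in> E" for e using that finite_E by simp
    then have "b (corner T) \<in> L" using corner_lowest[OF L u] by blast
    then have "K T \<subseteq> L"
      unfolding K_def using corner_generates[OF L(1)] L(2) b_span[of "\<lambda>e. Suc (card T) \<le> card (rho e)"]
      by (intro span_le_submodule[OF L(1)]) (auto simp: F_def)
    then show ?thesis using L(3) by blast
  qed simp
qed

lemma semisimple_layer: "semisimple_over (F (Suc k)) (F k)"
  unfolding semisimple_over_def
proof (intro allI impI)
  fix L assume L: "submodule L R Z" "\<forall>K. covers (F (Suc k)) K \<longrightarrow> K \<subseteq> F k \<longrightarrow> K \<subseteq> L"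
  show "F k \<subseteq> L"
  proof (rule F_generated[OF L(1)])
    fix T assume T: "T \<subseteq> S" "card T = k"
    have "K T \<subseteq> L" using L(2) covers_K[OF T(1)] K_le_F[of T] T(2) by blast
    moreover have "b (corner T) \<in> K T" using T by (simp add: K_def b_span rho_corner)
    ultimately show "b (corner T) \<in> L" by blast
  qed
qed

subsection \<open>The layers are as long as possible\<close>

text \<open>
  This is a Nakayama argument for the nilpotent operators \<open>x j\<close>. Let \<open>D d\<close> be the part of \<open>F (Suc k)\<close> of
  degree at least \<open>d\<close>. A basis vector of \<open>F (Suc k)\<close> has passed some wall \<open>j\<close>, so it is a multiple of
  \<open>x j\<close> times a basis vector of \<open>F k \<subseteq> C + F (Suc k)\<close>. If already \<open>F (Suc k) \<subseteq> C + D d\<close>, applying \<open>x j\<close> gives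
  \<open>F (Suc k) \<subseteq> C + D (Suc d)\<close>, and \<open>D d\<close> vanishes for large \<open>d\<close>.
\<close>

lemma F_superfluous:
  assumes C: "submodule C R Z" and le: "F k \<subseteq> C <+>\<^bsub>Z\<^esub> F (Suc k)"
  shows "F k \<subseteq> C"
proof -
  define D where "D d = span (\<lambda>e. Suc k \<le> card (rho e) \<and> d \<le> deg e)" for d
  have D_closed: "D d \<subseteq> carrier Z" for d by (auto simp: D_def span_def)
  have C_closed: "C \<subseteq> carrier Z" by (rule submodule_subset[OF C])
  have lin: "linear_subspace (C <+>\<^bsub>Z\<^esub> D d)" for d
    unfolding D_def by (intro linear_subspace_set_add linear_subspace_submodule[OF C] linear_subspace_span)
  have "F (Suc k) \<subseteq> C <+>\<^bsub>Z\<^esub> D d" for d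
  proof (induction d)
    case 0
    have "D 0 = F (Suc k)" by (simp add: D_def F_def)
    then show ?case using set_add_upper[OF C submodule_F] by simp
  next
    case (Suc d)
    show ?case
      unfolding F_def
    proof (rule span_le[OF lin])
      fix e assume e: "e \<in> E" "Suc k \<le> card (rho e)"
      then obtain j where j: "j \<in> rho e" by fastforce
      then have j': "j \<in> I" "e j \<noteq> 0" using S_subset by (auto simp: rho_def)
      let ?e = "e(j := e j - 1)"
      have eq: "?e(j := Suc (?e j)) = e" using j'(2) by (rule down_up)
      have Suc_lt: "Suc (?e j) < h j" using E_bound[OF e(1) j'(1)] j'(2) by simp
      have "k \<le> card (rho ?e)" using card_rho_up(2)[of ?e j] e(2) eq by simp
      then have "b ?e \<in> C <+>\<^bsub>Z\<^esub> F (Suc k)" using le b_span[of "\<lambda>e. k \<le> card (rho e)"] by (auto simp: F_def)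
      then obtain c f where cf: "c \<in> C" "f \<in> F (Suc k)" "b ?e = c \<oplus> f" by (auto simp: set_add_def')
      then obtain c' f' where cf': "c' \<in> C" "f' \<in> D d" "f = c' \<oplus> f'" using Suc.IH by (auto simp: set_add_def')
      have car: "c \<in> carrier Z" "c' \<in> carrier Z" "f' \<in> carrier Z" using cf(1) cf'(1,2) C_closed D_closed by auto
      then have "x j \<odot> b ?e = x j \<odot> (c \<oplus> c') \<oplus> x j \<odot> f'"
        using cf(3) cf'(3) x_closed[OF j'(1)] by (simp add: smult_r_distr smult_closed M.a_assoc)
      moreover have "x j \<odot> (c \<oplus> c') \<in> C"
        using C cf(1) cf'(1) x_closed[OF j'(1)] by (intro submodule_smult submodule_add)
      moreover have "x j \<odot> f' \<in> D (Suc d)"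
      proof -
        have "Suc k \<le> card (rho e') \<and> Suc d \<le> deg e'" if e': "e' \<in> E" "co (x j \<odot> f') e' \<noteq> 0" for e'
        proof -
          have *: "e' j \<noteq> 0" "co f' (e'(j := e' j - 1)) \<noteq> 0"
            using e' j'(1) car by (auto simp: co_x split: if_splits)
          then have "Suc k \<le> card (rho (e'(j := e' j - 1))) \<and> d \<le> deg (e'(j := e' j - 1))"
            using cf'(2) E_down[OF e'(1) j'(1)] by (auto simp: D_def span_def)
          then show ?thesis
            using card_rho_up(1)[of "e'(j := e' j - 1)" j] deg_up[OF j'(1), of "e'(j := e' j - 1)"]
            unfolding down_up[of e' j, OF *(1)] by linarith
        qed
        then show ?thesis using car x_closed[OF j'(1)] by (simp add: D_def span_def smult_closed)
      qed
      ultimately have "x j \<odot> b ?e \<in> C <+>\<^bsub>Z\<^esub> D (Suc d)" by (auto simp: set_add_def')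
      then have "cst (cx j e) \<odot> b e \<in> C <+>\<^bsub>Z\<^esub> D (Suc d)"
        using x_b[OF E_down[OF e(1) j'(1)] j'(1) Suc_lt] unfolding eq by metis
      then show "b e \<in> C <+>\<^bsub>Z\<^esub> D (Suc d)"
        using b_cst_mem[OF lin] cx_nonzero[OF j'(1) e(1)] by blast
    qed
  qed
  moreover have "D (Suc (Max (deg ` E))) \<subseteq> {\<zero>}"
  proof -
    have "deg e \<le> Max (deg ` E)" if "e \<in> E" for e using that finite_E by simp
    then have "\<not> Suc (Max (deg ` E)) \<le> deg e" if "e \<in> E" for e using that by (simp add: not_less_eq_eq)
    then have "co v e = co \<zero> e" if "v \<in> D (Suc (Max (deg ` E)))" "e \<in> E" for v e
      using that unfolding D_def span_def co_zero[OF that(2)] by blast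
    then have "v = \<zero>" if "v \<in> D (Suc (Max (deg ` E)))" for v
      using that D_closed by (intro co_eqI) auto
    then show ?thesis by blast
  qed
  ultimately have "F (Suc k) \<subseteq> C"
    using C_closed by (fastforce simp: set_add_def')
  then show ?thesis using le set_add_least[OF C, of C "F (Suc k)"] by blast
qed

lemma radical_F: "radical R (Z\<lparr>carrier := F k\<rparr>) = F (Suc k)"
proof (rule radical_eqI)
  fix N assume N: "submodule N R Z" "N \<subseteq> F k" "semisimple_over N (F k)"
  show "F (Suc k) \<subseteq> N"
    by (rule superfluous_le_semisimple[OF submodule_F submodule_F F_mono N(1,2) _ N(3)])
      (simp_all add: F_superfluous)
next
  show "F (Suc k) \<subseteq> F k" by (simp add: F_mono)
qed (rule submodule_F semisimple_layer)+

theorem radical_series_eq: "radical_series R Z k = F k"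
  by (induction k) (simp_all add: F_0 radical_F)

text \<open>
  The dual argument: while \<open>u\<close> has a term of rank below \<open>k\<close>, some \<open>x i\<close> can raise this term without
  leaving the box or reaching rank \<open>k + 1\<close>, because the only vector that admits no raising has the full
  rank \<open>card S\<close>. Each such step raises the lowest degree of \<open>u\<close> modulo \<open>F (Suc k)\<close>, so the process ends
  with a vector of \<open>F k\<close>.
\<close>

lemma F_essential:
  assumes N: "submodule N R Z" and k: "k \<le> card S"
    and u: "u \<in> N" "u \<notin> F (Suc k)"
    and bound: "\<And>e. \<lbrakk>e \<in> E; co u e \<noteq> 0; card (rho e) \<le> k\<rbrakk> \<Longrightarrow> d \<le> deg e"
  shows "\<exists>w\<in>N \<inter> F k. w \<notin> F (Suc k)"
  using u bound
proof (induction "Max (deg ` E) - d" arbitrary: d u rule: less_induct)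
  case less
  have uZ: "u \<in> carrier Z" using less.prems(1) submodule_subset[OF N] by blast
  show ?case
  proof (cases "u \<in> F k")
    case False
    then obtain e where e: "e \<in> E" "co u e \<noteq> 0" "card (rho e) < k" using uZ by (auto simp: F_def span_def)
    have "\<exists>i\<in>I. Suc (e i) < h i"
    proof (rule ccontr)
      assume "\<not> ?thesis"
      then have "rho e = S" using S_subset ed_bound by (fastforce simp: rho_def)
      then show False using e(3) k by simp
    qed
    then obtain i where i: "i \<in> I" "Suc (e i) < h i" by blast
    let ?e = "e(i := Suc (e i))"
    have "co (x i \<odot> u) ?e = cx i ?e * co u e"
      using i uZ E_up[OF e(1) i] by (simp add: co_x)
    then have "co (x i \<odot> u) ?e \<noteq> 0" using cx_nonzero[OF i(1) E_up[OF e(1) i]] e(2) by simp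
    moreover have "card (rho ?e) \<le> k" using card_rho_up(2)[of e i] e(3) by linarith
    ultimately have "x i \<odot> u \<notin> F (Suc k)" using E_up[OF e(1) i] by (fastforce simp: F_def span_def)
    moreover have "x i \<odot> u \<in> N" using submodule_smult[OF N x_closed[OF i(1)] less.prems(1)] .
    moreover have "d \<le> deg e" using less.prems(3) e by simp
    moreover have "deg ?e \<le> Max (deg ` E)" using E_up[OF e(1) i] finite_E by simp
    moreover have "Suc d \<le> deg e'" if e': "e' \<in> E" "co (x i \<odot> u) e' \<noteq> 0" "card (rho e') \<le> k" for e'
    proof -
      have *: "e' i \<noteq> 0" "co u (e'(i := e' i - 1)) \<noteq> 0"
        using e' i(1) uZ by (auto simp: co_x split: if_splits)
      have "card (rho (e'(i := e' i - 1))) \<le> k"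
        using card_rho_up(1)[of "e'(i := e' i - 1)" i] e'(3) unfolding down_up[of e' i, OF *(1)] by linarith
      then have "d \<le> deg (e'(i := e' i - 1))" using less.prems(3) E_down[OF e'(1) i(1)] * by blast
      then show ?thesis using deg_up[OF i(1), of "e'(i := e' i - 1)"] unfolding down_up[of e' i, OF *(1)] by linarith
    qed
    ultimately show ?thesis
      using less.hyps[of "Suc d" "x i \<odot> u"] deg_up[OF i(1), of e] by simp
  qed (use less.prems in blast)
qed

lemma covers_F_le:
  assumes k: "k \<le> card S" and cov: "covers (F (Suc k)) N"
  shows "N \<subseteq> F k"
proof -
  have N: "submodule N R Z" "F (Suc k) \<subset> N" using cov by (auto simp: covers_def)
  then obtain u where "u \<in> N" "u \<notin> F (Suc k)" by blast
  then obtain w where "w \<in> N \<inter> F k" "w \<notin> F (Suc k)" using F_essential[OF N(1) k, of u 0] by blast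
  moreover have "N \<inter> F k = F (Suc k) \<or> N \<inter> F k = N"
    using N F_mono[of k "Suc k"] by (intro coversD[OF cov] submodule_Int submodule_F) auto
  ultimately show ?thesis by blast
qed

theorem socle_series_eq:
  assumes "k \<le> card S + 1"
  shows "socle_series R Z k = F (card S + 1 - k)"
  using assms
proof (induction k)
  case 0 then show ?case by (simp add: F_eq_zero)
next
  case (Suc k)
  then have k: "card S + 1 - k = Suc (card S - k)" by simp
  have "{v \<in> carrier Z. F (Suc (card S - k)) +> v \<in> socle R (Z Modulo F (Suc (card S - k)))} = F (card S - k)"
    by (rule socle_quot_eqI[OF submodule_F submodule_F F_mono semisimple_layer covers_F_le]) simp_all
  moreover have "socle_series R Z k = F (Suc (card S - k))" using Suc k by simp
  ultimately show ?case by simp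
qed

theorem loewy_length_eq: "loewy_length R Z = card S + 1"
  unfolding loewy_length_def radical_series_eq
proof (rule Least_equality)
  fix k assume "F k = {\<zero>}"
  then have "b (corner S) \<notin> F k"
    using corner_not_mem_F[of S] submodule_zero[OF submodule_F] by auto
  then show "card S + 1 \<le> k"
    using corner_mem_F[of S] F_mono[of k "card S"] by (cases "k \<le> card S") auto
qed (simp add: F_eq_zero)

text \<open>
  The case \<open>k = 0\<close> of the two results on layers: the cell \<open>{}\<close> gives that \<open>F 1\<close> is maximal, and since
  \<open>F 1\<close> is superfluous, every maximal submodule contains it.
\<close>

theorem maximal_submodule_iff: "maximal_submodule N R Z \<longleftrightarrow> N = F 1"
proof -
  have "K {} = carrier Z" by (auto simp: K_def span_def finite_rho card_gt_0_iff)
  then have cov: "covers (F 1) (carrier Z)" using covers_K[of "{}"] by simp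
  then have max: "maximal_submodule (F 1) R Z"
    using submodule_F submodule_subset unfolding covers_def maximal_submodule_def by (metis psubset_eq)
  moreover have "N = F 1" if N: "maximal_submodule N R Z"
  proof -
    have N': "submodule N R Z" "N \<noteq> carrier Z" using N by (auto simp: maximal_submodule_def)
    have "submodule (N <+>\<^bsub>Z\<^esub> F 1) R Z" "N \<subseteq> N <+>\<^bsub>Z\<^esub> F 1" "F 1 \<subseteq> N <+>\<^bsub>Z\<^esub> F 1"
      by (rule submodule_set_add set_add_upper N'(1) submodule_F)+
    moreover have "N <+>\<^bsub>Z\<^esub> F 1 \<noteq> carrier Z"
      using F_superfluous[OF N'(1), of 0] F_0 N' submodule_subset[OF N'(1)] by auto
    ultimately have "N <+>\<^bsub>Z\<^esub> F 1 = N" using N by (auto simp: maximal_submodule_def)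
    then have "F 1 \<subseteq> N" using \<open>F 1 \<subseteq> N <+>\<^bsub>Z\<^esub> F 1\<close> by simp
    then show ?thesis using max N' by (auto simp: maximal_submodule_def)
  qed
  ultimately show ?thesis by blast
qed

end

section \<open>The algebra of a datum and its modules\<close>

lemma letters_plus [simp]: "letters (u + v) = letters u @ letters v"
  by (simp add: plus_word_def)

lemma letters_0 [simp]: "letters 0 = []"
  by (simp add: zero_word_def)

lemma poly_mapping_add_induct [case_names zero single add]:
  fixes p :: "'w \<Rightarrow>\<^sub>0 'k::field"
  assumes "P 0" "\<And>w c. w \<in> Poly_Mapping.keys p \<Longrightarrow> P (Poly_Mapping.single w c)"
    and "\<And>q r. \<lbrakk>P q; P r\<rbrakk> \<Longrightarrow> P (q + r)"
  shows "P p"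
proof -
  have "P (\<Sum>w\<in>A. Poly_Mapping.single w (Poly_Mapping.lookup p w))" if "A \<subseteq> Poly_Mapping.keys p" for A
    using finite_subset[OF that finite_keys] that by (induction A rule: finite_induct) (auto simp: assms)
  moreover have "(\<Sum>w\<in>Poly_Mapping.keys p. Poly_Mapping.single w (Poly_Mapping.lookup p w)) = p"
    by (rule poly_mapping_eqI) (auto simp: lookup_sum lookup_single when_def in_keys_iff)
  ultimately show ?thesis by (metis order_refl)
qed

lemma free_alg_mult_closed:
  assumes "p \<in> carrier (free_alg D)" "q \<in> carrier (free_alg D)"
  shows "p * q \<in> carrier (free_alg D)"
proof -
  have "set (letters w) \<subseteq> gens D" if w: "w \<in> Poly_Mapping.keys (p * q)" for w
  proof -
    obtain a b where "w = a + b" "a \<in> Poly_Mapping.keys p" "b \<in> Poly_Mapping.keys q"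
      using w keys_mult[of p q] by blast
    then show ?thesis using assms by (simp add: free_alg_def)
  qed
  then show ?thesis by (simp add: free_alg_def)
qed

lemma ring_free_alg: "ring (free_alg D)"
proof (rule ringI)
  show "abelian_group (free_alg D)"
  proof (rule abelian_groupI)
    fix p assume "p \<in> carrier (free_alg D)"
    then show "\<exists>q\<in>carrier (free_alg D). q \<oplus>\<^bsub>free_alg D\<^esub> p = \<zero>\<^bsub>free_alg D\<^esub>"
      by (intro bexI[of _ "- p"]) (auto simp: free_alg_def)
  qed (auto simp: free_alg_def add.assoc add.commute dest: subsetD[OF keys_add])
  show "monoid (free_alg D)"
  proof (rule monoidI)
    fix p q assume "p \<in> carrier (free_alg D)" "q \<in> carrier (free_alg D)"
    then show "p \<otimes>\<^bsub>free_alg D\<^esub> q \<in> carrier (free_alg D)"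
      using free_alg_mult_closed[of p D q] by (simp add: free_alg_def)
  qed (simp_all add: free_alg_def mult.assoc)
qed (auto simp: free_alg_def distrib_left distrib_right)

lemma fconst_closed [simp]: "fconst c \<in> carrier (free_alg D)"
  by (simp add: fconst_def free_alg_def)

lemma fgen_closed [simp]: "fgen s \<in> carrier (free_alg D) \<longleftrightarrow> s \<in> gens D"
  by (simp add: fgen_def free_alg_def)

lemma free_alg_simps [simp]:
  "\<one>\<^bsub>free_alg D\<^esub> = 1" "\<zero>\<^bsub>free_alg D\<^esub> = 0" "p \<oplus>\<^bsub>free_alg D\<^esub> q = p + q" "p \<otimes>\<^bsub>free_alg D\<^esub> q = p * q"
  by (simp_all add: free_alg_def)

lemma free_alg_closed:
  assumes "p \<in> carrier (free_alg D)" "q \<in> carrier (free_alg D)"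
  shows "p + q \<in> carrier (free_alg D)" "p * q \<in> carrier (free_alg D)" "p - q \<in> carrier (free_alg D)"
    "- p \<in> carrier (free_alg D)"
  using assms
  by (auto intro: free_alg_mult_closed)
    (auto simp: free_alg_def dest!: subsetD[OF keys_add] subsetD[OF keys_diff])

lemma one_free_alg [simp]: "1 \<in> carrier (free_alg D)"
  using monoid.one_closed[OF ring.is_monoid[OF ring_free_alg[of D]]] by simp

lemma free_alg_power: "p \<in> carrier (free_alg D) \<Longrightarrow> p ^ k \<in> carrier (free_alg D)"
  by (induction k) (auto intro: free_alg_closed)

lemma free_alg_uminus: "p \<in> carrier (free_alg D) \<Longrightarrow> \<ominus>\<^bsub>free_alg D\<^esub> p = - p"
proof -
  interpret ring "free_alg D" by (rule ring_free_alg)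
  assume "p \<in> carrier (free_alg D)"
  then show ?thesis using minus_equality[of "- p" p] free_alg_closed(4)[of p D p] by simp
qed

text \<open>
  A property of all elements of the free algebra that is stable under sums and products needs to be
  checked on constants and single letters only, as every word is a product of letters.
\<close>

lemma free_alg_gen_induct [consumes 1, case_names const gen add mult]:
  fixes D :: "('g, 'k::field_char_0) datum"
  assumes "p \<in> carrier (free_alg D)"
    and const: "\<And>c. P (fconst c)" and gen: "\<And>s. s \<in> gens D \<Longrightarrow> P (fgen s)"
    and add: "\<And>p q. \<lbrakk>p \<in> carrier (free_alg D); q \<in> carrier (free_alg D); P p; P q\<rbrakk> \<Longrightarrow> P (p + q)"
    and mult: "\<And>p q. \<lbrakk>p \<in> carrier (free_alg D); q \<in> carrier (free_alg D); P p; P q\<rbrakk> \<Longrightarrow> P (p * q)"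
  shows "P p"
proof -
  have word: "Poly_Mapping.single (Word ws) 1 \<in> carrier (free_alg D) \<and> P (Poly_Mapping.single (Word ws) 1)"
    if "set ws \<subseteq> gens D" for ws
    using that
  proof (induction ws)
    case Nil
    have "Poly_Mapping.single (Word []) 1 = (fconst 1 :: ('g, 'k) free_elt)"
      by (simp add: fconst_def zero_word_def)
    then show ?case using const[of 1] by simp
  next
    case (Cons s ws)
    have eq: "Poly_Mapping.single (Word (s # ws)) 1 = (fgen s * Poly_Mapping.single (Word ws) 1 :: ('g, 'k) free_elt)"
      by (simp add: fgen_def mult_single plus_word_def)
    show ?case unfolding eq using Cons by (auto intro!: mult gen free_alg_closed)
  qed
  have "p \<in> carrier (free_alg D) \<and> P p"
  proof (induction p rule: poly_mapping_add_induct)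
    case zero
    then show ?case using const[of 0] fconst_closed[of 0 D] by (simp add: fconst_def)
  next
    case (single w c)
    have eq: "Poly_Mapping.single w c = fconst c * Poly_Mapping.single (Word (letters w)) 1"
      by (simp add: fconst_def mult_single)
    have "set (letters w) \<subseteq> gens D" using assms(1) single by (simp add: free_alg_def)
    from word[OF this] show ?case unfolding eq by (auto intro!: mult const free_alg_closed simp del: word.collapse)
  qed (auto intro: add free_alg_closed)
  then show ?thesis by simp
qed

lemma gens_simps [simp]:
  "GenG g \<in> gens D \<longleftrightarrow> g \<in> carrier (grp D)"
  "GenX i \<in> gens D \<longleftrightarrow> i \<in> {1..num D}" "GenY i \<in> gens D \<longleftrightarrow> i \<in> {1..num D}"
  by (auto simp: gens_def)

lemma relators_closed:
  assumes "simply_linked_datum D"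
  shows "relators D \<subseteq> carrier (free_alg D)"
proof -
  interpret comm_group "grp D" using assms by (simp add: simply_linked_datum_def)
  have ab: "pta D i \<otimes>\<^bsub>grp D\<^esub> ptb D i \<in> carrier (grp D)" if "i \<in> {1..num D}" for i
    using assms that by (auto simp: simply_linked_datum_def)
  show ?thesis
    unfolding relators_def using ab
    by (auto intro!: free_alg_closed free_alg_power simp del: atLeastAtMost_iff split: if_splits)
qed

lemma ideal_alg_ideal: "simply_linked_datum D \<Longrightarrow> ideal (alg_ideal D) (free_alg D)"
  unfolding alg_ideal_def by (rule ring.genideal_ideal[OF ring_free_alg relators_closed])

lemma ring_alg: "simply_linked_datum D \<Longrightarrow> ring (alg D)"
  unfolding alg_def by (rule ideal.quotient_is_ring[OF ideal_alg_ideal])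

lemma cls_hom: "simply_linked_datum D \<Longrightarrow> cls D \<in> ring_hom (free_alg D) (alg D)"
  using ideal.rcos_ring_hom[OF ideal_alg_ideal, of D] unfolding cls_def[abs_def] alg_def .

lemma cls_simps:
  assumes "simply_linked_datum D" "p \<in> carrier (free_alg D)" "q \<in> carrier (free_alg D)"
  shows "cls D p \<in> carrier (alg D)" "cls D (p + q) = cls D p \<oplus>\<^bsub>alg D\<^esub> cls D q"
    "cls D (p * q) = cls D p \<otimes>\<^bsub>alg D\<^esub> cls D q" "cls D 1 = \<one>\<^bsub>alg D\<^esub>"
    "cls D (p - q) = cls D p \<ominus>\<^bsub>alg D\<^esub> cls D q"
proof -
  note hom = cls_hom[OF assms(1)]
  interpret h: ring_hom_ring "free_alg D" "alg D" "cls D"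
    by (rule ring_hom_ringI2[OF ring_free_alg ring_alg[OF assms(1)] hom])
  show "cls D p \<in> carrier (alg D)" "cls D (p + q) = cls D p \<oplus>\<^bsub>alg D\<^esub> cls D q"
    "cls D (p * q) = cls D p \<otimes>\<^bsub>alg D\<^esub> cls D q" "cls D 1 = \<one>\<^bsub>alg D\<^esub>"
    using h.hom_add[of p q] h.hom_mult[of p q] h.hom_one h.hom_closed[of p] assms(2,3) by simp_all
  have eq: "p - q = p \<oplus>\<^bsub>free_alg D\<^esub> (\<ominus>\<^bsub>free_alg D\<^esub> q)" using assms(3) by (simp add: free_alg_uminus)
  show "cls D (p - q) = cls D p \<ominus>\<^bsub>alg D\<^esub> cls D q"
    unfolding eq using h.hom_add[of p "\<ominus>\<^bsub>free_alg D\<^esub> q"] h.hom_a_inv[of q] assms(2,3) by (simp add: a_minus_def)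
qed

lemma carrier_alg: "carrier (alg D) = cls D ` carrier (free_alg D)"
  by (auto simp: alg_def FactRing_def A_RCOSETS_def' cls_def)

lemma cls_relator:
  assumes "simply_linked_datum D" "r \<in> relators D"
  shows "cls D r = \<zero>\<^bsub>alg D\<^esub>"
proof -
  interpret ring "free_alg D" by (rule ring_free_alg)
  have "r \<in> alg_ideal D"
    unfolding alg_ideal_def using genideal_self[OF relators_closed[OF assms(1)]] assms(2) by auto
  then have "cls D r = alg_ideal D"
    unfolding cls_def using a_rcos_zero[OF ideal_alg_ideal[OF assms(1)]] by simp
  then show ?thesis by (simp add: alg_def FactRing_def)
qed

lemma alg_induct [consumes 2, case_names const gen add mult]:
  assumes D: "simply_linked_datum D" and r: "r \<in> carrier (alg D)"
    and const: "\<And>c. P (hconst D c)" and gen: "\<And>s. s \<in> gens D \<Longrightarrow> P (cls D (fgen s))"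
    and add: "\<And>r s. \<lbrakk>r \<in> carrier (alg D); s \<in> carrier (alg D); P r; P s\<rbrakk> \<Longrightarrow> P (r \<oplus>\<^bsub>alg D\<^esub> s)"
    and mult: "\<And>r s. \<lbrakk>r \<in> carrier (alg D); s \<in> carrier (alg D); P r; P s\<rbrakk> \<Longrightarrow> P (r \<otimes>\<^bsub>alg D\<^esub> s)"
  shows "P r"
proof -
  obtain p where p: "p \<in> carrier (free_alg D)" "r = cls D p" using r by (auto simp: carrier_alg)
  have "P (cls D p)"
    using p(1) by (induction p rule: free_alg_gen_induct) (auto simp: const gen cls_simps[OF D] intro!: add mult)
  then show ?thesis using p(2) by simp
qed

lemma fconst_mult: "fconst c * fconst d = fconst (c * d)"
  by (simp add: fconst_def mult_single)

lemma fconst_add: "fconst c + fconst d = fconst (c + d)"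
  by (simp add: fconst_def single_add)

lemma (in abelian_group) diff_eq_zero_iff: "\<lbrakk>v \<in> carrier G; w \<in> carrier G\<rbrakk> \<Longrightarrow> v \<ominus> w = \<zero> \<longleftrightarrow> v = w"
  using minus_equality[of v "\<ominus> w"] by (auto simp: a_minus_def r_neg)

locale alg_module = left_module "alg D" Z
  for D :: "('g, 'k::field_char_0) datum" and Z :: "(('g, 'k) alg_elt, 'z, 'b) module_scheme" (structure) +
  assumes D: "simply_linked_datum D"
begin

abbreviation "I \<equiv> {1..num D}"

lemma const_closed [simp]: "hconst D c \<in> carrier (alg D)"
  by (rule cls_simps[OF D fconst_closed fconst_closed])

lemma gen_closed [simp]: "s \<in> gens D \<Longrightarrow> cls D (fgen s) \<in> carrier (alg D)"
  by (rule cls_simps[OF D _ fconst_closed]) simp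

lemma gens_closed [simp]:
  "g \<in> carrier (grp D) \<Longrightarrow> hG D g \<in> carrier (alg D)" "i \<in> I \<Longrightarrow> hX D i \<in> carrier (alg D)"
  "i \<in> I \<Longrightarrow> hY D i \<in> carrier (alg D)"
  by (auto intro: gen_closed simp del: atLeastAtMost_iff)

lemma cls_mult_smult:
  "\<lbrakk>p \<in> carrier (free_alg D); q \<in> carrier (free_alg D); v \<in> carrier Z\<rbrakk> \<Longrightarrow>
    cls D (p * q) \<odot> v = cls D p \<odot> (cls D q \<odot> v)"
  by (simp add: cls_simps[OF D] smult_assoc)

lemma cls_diff_smult:
  "\<lbrakk>p \<in> carrier (free_alg D); q \<in> carrier (free_alg D); v \<in> carrier Z\<rbrakk> \<Longrightarrow>
    cls D (p - q) \<odot> v = cls D p \<odot> v \<ominus> cls D q \<odot> v"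
  by (simp add: cls_simps[OF D] smult_l_distr minus_smult a_minus_def)

lemma cls_one_smult: "v \<in> carrier Z \<Longrightarrow> cls D 1 \<odot> v = v"
  using cls_simps(4)[OF D fconst_closed fconst_closed] by (simp add: smult_one)

lemma relation:
  assumes "p - q \<in> relators D" "p \<in> carrier (free_alg D)" "q \<in> carrier (free_alg D)" "v \<in> carrier Z"
  shows "cls D p \<odot> v = cls D q \<odot> v"
proof -
  have "cls D p \<odot> v \<ominus> cls D q \<odot> v = \<zero>"
    using cls_relator[OF D assms(1)] assms(2-4) by (simp flip: cls_diff_smult)
  then show ?thesis using assms(2-4) by (simp add: smult_closed cls_simps[OF D] M.diff_eq_zero_iff)
qed

lemma const_const: "v \<in> carrier Z \<Longrightarrow> hconst D c \<odot> (hconst D d \<odot> v) = hconst D (c * d) \<odot> v"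
  using cls_mult_smult[of "fconst c" "fconst d" v] by (simp add: fconst_mult)

lemma const_add: "v \<in> carrier Z \<Longrightarrow> hconst D (c + d) \<odot> v = hconst D c \<odot> v \<oplus> hconst D d \<odot> v"
  by (simp add: cls_simps[OF D] smult_l_distr flip: fconst_add)

lemma const_one: "v \<in> carrier Z \<Longrightarrow> hconst D 1 \<odot> v = v"
  using cls_one_smult by (simp add: fconst_def)

lemma const_commute:
  assumes "r \<in> carrier (alg D)" "v \<in> carrier Z"
  shows "hconst D c \<odot> (r \<odot> v) = r \<odot> (hconst D c \<odot> v)"
proof -
  have "hconst D c \<odot> (r \<odot> v) = r \<odot> (hconst D c \<odot> v)" if "v \<in> carrier Z" for v
    using D assms(1) that
  proof (induction r arbitrary: v rule: alg_induct)
    case (const d) then show ?case by (simp add: const_const mult.commute)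
  next
    case (gen s)
    have "fconst c * fgen s = (fgen s * fconst c :: ('g, 'k) free_elt)"
      by (simp add: fconst_def fgen_def mult_single)
    then show ?case using gen by (simp flip: cls_mult_smult)
  qed (simp_all add: smult_l_distr smult_r_distr smult_closed smult_assoc)
  then show ?thesis using assms(2) .
qed

lemma rel_G_X:
  assumes "g \<in> carrier (grp D)" "i \<in> I" "v \<in> carrier Z"
  shows "hG D g \<odot> (hX D i \<odot> v) = hconst D (chi D i g) \<odot> (hX D i \<odot> (hG D g \<odot> v))"
proof -
  have "fG g * fX i - fconst (chi D i g) * fX i * fG g \<in> relators D"
    using assms(1,2) unfolding relators_def by blast
  from relation[OF this _ _ assms(3)] show ?thesis
    using assms by (simp add: cls_mult_smult free_alg_closed smult_closed del: atLeastAtMost_iff)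
qed

lemma rel_X_X:
  assumes "i \<in> I" "j \<in> I" "i \<noteq> j" "v \<in> carrier Z"
  shows "hX D i \<odot> (hX D j \<odot> v) = hconst D (qmat D i j) \<odot> (hX D j \<odot> (hX D i \<odot> v))"
proof -
  have "fX i * fX j - fconst (qmat D i j) * fX j * fX i \<in> relators D"
    using assms(1-3) unfolding relators_def by blast
  from relation[OF this _ _ assms(4)] show ?thesis
    using assms by (simp add: cls_mult_smult free_alg_closed smult_closed del: atLeastAtMost_iff)
qed

lemma rel_X_Y:
  assumes "i \<in> I" "j \<in> I" "pta D i \<otimes>\<^bsub>grp D\<^esub> ptb D i \<in> carrier (grp D)" "v \<in> carrier Z"
  shows "hX D i \<odot> (hY D j \<odot> v) \<ominus>
      hconst D (inverse (qmat D i j)) \<odot> (hY D j \<odot> (hX D i \<odot> v))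
    = (if i = j then hG D (pta D i \<otimes>\<^bsub>grp D\<^esub> ptb D i) \<odot> v \<ominus> v else \<zero>\<^bsub>Z\<^esub>)"
proof -
  let ?r = "if i = j then fG (pta D i \<otimes>\<^bsub>grp D\<^esub> ptb D i) - 1 else (0 :: ('g, 'k) free_elt)"
  have "fX i * fY j - fconst (inverse (qmat D i j)) * fY j * fX i - ?r \<in> relators D"
    using assms(1,2) unfolding relators_def by blast
  moreover have "0 \<in> carrier (free_alg D)" by (simp add: free_alg_def)
  ultimately have "cls D (fX i * fY j - fconst (inverse (qmat D i j)) * fY j * fX i) \<odot> v = cls D ?r \<odot> v"
    using assms by (intro relation) (auto simp del: atLeastAtMost_iff intro!: free_alg_closed)
  moreover have "cls D 0 = \<zero>\<^bsub>alg D\<^esub>"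
    using cls_simps(5)[OF D fconst_closed fconst_closed, of 0 0] by (simp add: R.diff_eq_zero_iff)
  ultimately show ?thesis
    using assms by (simp add: cls_mult_smult cls_diff_smult free_alg_closed smult_closed cls_one_smult
      del: atLeastAtMost_iff split: if_splits)
qed

lemma rel_X_power:
  assumes "i \<in> I" "v \<in> carrier Z"
  shows "((\<lambda>v. hX D i \<odot> v) ^^ mord D i) v = \<zero>"
proof -
  have "cls D (fX i ^ k) \<odot> w = ((\<lambda>v. hX D i \<odot> v) ^^ k) w" if "w \<in> carrier Z" for k w
    using that assms(1)
    by (induction k) (simp_all add: cls_one_smult cls_mult_smult free_alg_power del: atLeastAtMost_iff)
  moreover have "fX i ^ mord D i \<in> relators D"
    using assms(1) unfolding relators_def by blast
  ultimately show ?thesis using cls_relator[OF D] assms(2) by (metis zero_smult)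
qed

lemma alg_submoduleI:
  assumes "N \<subseteq> carrier Z" "\<zero> \<in> N" "\<And>v w. \<lbrakk>v \<in> N; w \<in> N\<rbrakk> \<Longrightarrow> v \<oplus> w \<in> N"
    and "\<And>c v. v \<in> N \<Longrightarrow> hconst D c \<odot> v \<in> N"
    and "\<And>s v. \<lbrakk>s \<in> gens D; v \<in> N\<rbrakk> \<Longrightarrow> cls D (fgen s) \<odot> v \<in> N"
  shows "submodule N (alg D) Z"
proof (rule submoduleI)
  fix r v assume "r \<in> carrier (alg D)" "v \<in> N"
  have "\<forall>v\<in>N. r \<odot> v \<in> N"
    using D \<open>r \<in> carrier (alg D)\<close>
    by (induction r rule: alg_induct)
      (use assms in \<open>auto simp: smult_l_distr smult_assoc subset_iff\<close>)
  then show "r \<odot> v \<in> N" using \<open>v \<in> N\<close> by blast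
qed (use assms in auto)

end

section \<open>A module realised on functions of exponents\<close>

lemma dual_groupD:
  assumes "\<eta> \<in> dual_group D"
  shows "g \<in> carrier (grp D) \<Longrightarrow> \<eta> g \<noteq> 0"
    "\<lbrakk>g \<in> carrier (grp D); h \<in> carrier (grp D)\<rbrakk> \<Longrightarrow> \<eta> (g \<otimes>\<^bsub>grp D\<^esub> h) = \<eta> g * \<eta> h"
  using assms by (force simp: dual_group_def hom_def units_of_def ground_field_def Units_def Pi_iff)+

lemma prod_power_up:
  fixes f :: "nat \<Rightarrow> 'k::comm_monoid_mult" and e :: "nat \<Rightarrow> nat"
  assumes "finite A"
  shows "(\<Prod>k\<in>A. f k ^ (e(j := Suc (e j))) k) = (if j \<in> A then f j else 1) * (\<Prod>k\<in>A. f k ^ e k)"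
proof -
  have "(\<Prod>k\<in>A. f k ^ (e(j := Suc (e j))) k) = (\<Prod>k\<in>A. (if k = j then f j else 1) * f k ^ e k)"
    by (intro prod.cong) auto
  then show ?thesis using assms by (simp add: prod.distrib)
qed

locale weighted_datum =
  fixes D :: "('g, 'k::field_char_0) datum" and \<gamma> :: "'g \<Rightarrow> 'k"
  assumes D: "simply_linked_datum D" and nilpotent: "nilpotent_type D" and weight: "\<gamma> \<in> dual_group D"
begin

abbreviation "I \<equiv> {1..num D}"
abbreviation "E \<equiv> exponents D"
abbreviation "a \<equiv> pta D"
abbreviation "b \<equiv> ptb D"
abbreviation "q \<equiv> qdiag D"

sublocale grp: comm_group "grp D" using D by (simp add: simply_linked_datum_def)

lemma a_closed [simp]: "i \<in> I \<Longrightarrow> a i \<in> carrier (grp D)"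
  and b_closed [simp]: "i \<in> I \<Longrightarrow> b i \<in> carrier (grp D)"
  and chi_dual: "i \<in> I \<Longrightarrow> chi D i \<in> dual_group D"
  and linked: "\<lbrakk>i \<in> I; j \<in> I\<rbrakk> \<Longrightarrow> chi D j (a i) = chi D i (b j)"
  and braided: "\<lbrakk>i \<in> I; j \<in> I; i \<noteq> j\<rbrakk> \<Longrightarrow> chi D i (a j) * chi D j (a i) = 1"
  using D unfolding simply_linked_datum_def by blast+

lemma chi_nonzero: "\<lbrakk>i \<in> I; g \<in> carrier (grp D)\<rbrakk> \<Longrightarrow> chi D i g \<noteq> 0"
  using dual_groupD(1)[OF chi_dual] .

lemma chi_mult: "\<lbrakk>i \<in> I; g \<in> carrier (grp D); h \<in> carrier (grp D)\<rbrakk> \<Longrightarrow>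
    chi D i (g \<otimes>\<^bsub>grp D\<^esub> h) = chi D i g * chi D i h"
  using dual_groupD(2)[OF chi_dual] .

lemma dual_one:
  assumes "\<eta> \<in> dual_group D"
  shows "\<eta> \<one>\<^bsub>grp D\<^esub> = 1"
  using dual_groupD(2)[OF assms, of "\<one>\<^bsub>grp D\<^esub>" "\<one>\<^bsub>grp D\<^esub>"] dual_groupD(1)[OF assms, of "\<one>\<^bsub>grp D\<^esub>"] by simp

lemma dual_pow: "\<lbrakk>\<eta> \<in> dual_group D; g \<in> carrier (grp D)\<rbrakk> \<Longrightarrow> \<eta> (g [^]\<^bsub>grp D\<^esub> (k::nat)) = \<eta> g ^ k"
  by (induction k) (simp_all add: dual_one dual_groupD)

lemma qmat_nonzero: "\<lbrakk>i \<in> I; j \<in> I\<rbrakk> \<Longrightarrow> qmat D i j \<noteq> 0"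
  unfolding qmat_def by (rule chi_nonzero) simp_all

lemma qmat_inverse: "\<lbrakk>i \<in> I; j \<in> I; i \<noteq> j\<rbrakk> \<Longrightarrow> qmat D i j * qmat D j i = 1"
  unfolding qmat_def using braided[of j i] by simp

lemma qmat_diag: "qmat D i i = q i"
  by (simp add: qmat_def qdiag_def)

text \<open>
  The linking condition and the braiding condition cancel for \<open>i \<noteq> j\<close>. This is why \<open>a\<^sub>i b\<^sub>i\<close> sees only
  the \<open>i\<close>-th exponent of a monomial, so that the coefficient of \<open>y\<^sub>i\<close> depends on that exponent alone.
\<close>

lemma chi_ab: "\<lbrakk>i \<in> I; j \<in> I\<rbrakk> \<Longrightarrow> chi D j (a i \<otimes>\<^bsub>grp D\<^esub> b i) = (if i = j then q i ^ 2 else 1)"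
  using linked[of j i] braided[of i j]
  by (cases "i = j") (simp_all add: chi_mult qdiag_def power2_eq_square mult.commute del: atLeastAtMost_iff)

lemma q_nonzero: "i \<in> I \<Longrightarrow> q i \<noteq> 0"
  using qmat_nonzero[of i i] by (simp add: qmat_diag)

lemma mord:
  assumes "i \<in> I"
  shows "0 < mord D i" "q i ^ mord D i = 1" "\<lbrakk>0 < k; k < mord D i\<rbrakk> \<Longrightarrow> q i ^ k \<noteq> 1" "1 < mord D i"
proof -
  have fin: "finite (carrier (grp D))" using D by (simp add: simply_linked_datum_def)
  have "q i ^ order (grp D) = 1"
    using grp.pow_order_eq_1[OF a_closed[OF assms]] dual_pow[OF chi_dual[OF assms] a_closed[OF assms], of "order (grp D)"]
      dual_one[OF chi_dual[OF assms]] by (simp add: qdiag_def)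
  moreover have "0 < order (grp D)"
    using grp.order_gt_0_iff_finite fin by blast
  ultimately have ex: "\<exists>m. 0 < m \<and> q i ^ m = 1" by blast
  show *: "0 < mord D i" "q i ^ mord D i = 1"
    using LeastI_ex[OF ex] by (auto simp: mord_def)
  show "\<lbrakk>0 < k; k < mord D i\<rbrakk> \<Longrightarrow> q i ^ k \<noteq> 1"
    using not_less_Least[of k "\<lambda>m. 0 < m \<and> q i ^ m = 1"] by (auto simp: mord_def)
  have "q i \<noteq> 1" using nilpotent assms by (simp add: nilpotent_type_def)
  then show "1 < mord D i" using * by (metis One_nat_def Suc_lessI power_one_right)
qed

lemma q_power_inj:
  assumes "i \<in> I" "k \<le> l" "l < mord D i" "q i ^ k = q i ^ l"
  shows "k = l"
proof (rule ccontr)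
  assume "k \<noteq> l"
  have "q i ^ l = q i ^ k * q i ^ (l - k)" using assms(2) by (simp flip: power_add)
  then have "q i ^ (l - k) = 1" using assms(4) q_nonzero[OF assms(1)] by simp
  then show False using mord(3)[OF assms(1), of "l - k"] \<open>k \<noteq> l\<close> assms(2,3) by simp
qed

definition gab :: "nat \<Rightarrow> 'k"
  where "gab i = \<gamma> (a i \<otimes>\<^bsub>grp D\<^esub> b i)"

lemma is_edge_iff: "i \<in> I \<Longrightarrow> is_edge D \<gamma> i k \<longleftrightarrow> k + 2 \<le> mord D i \<and> gab i * q i ^ k = 1"
  using q_nonzero[of i] by (auto simp: is_edge_def gab_def power_int_minus field_simps)

lemma is_edge_unique:
  assumes "i \<in> I" "is_edge D \<gamma> i k" "is_edge D \<gamma> i l"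
  shows "k = l"
proof -
  have *: "gab i * q i ^ k = 1" "gab i * q i ^ l = 1" "k < mord D i" "l < mord D i"
    using assms by (auto simp: is_edge_iff simp del: atLeastAtMost_iff)
  then have "gab i \<noteq> 0" by auto
  then have "q i ^ k = q i ^ l" using * by (metis mult_left_cancel)
  then show ?thesis using q_power_inj[OF assms(1)] * by (metis linear)
qed

lemma edge_eq: "\<lbrakk>i \<in> I; is_edge D \<gamma> i k\<rbrakk> \<Longrightarrow> edge D \<gamma> i = k"
  unfolding edge_def using is_edge_unique by blast

lemma is_edge_edge: "i \<in> Sset D \<gamma> \<Longrightarrow> is_edge D \<gamma> i (edge D \<gamma> i)"
  using edge_eq by (auto simp: Sset_def simp del: atLeastAtMost_iff)

subsection \<open>The structure constants\<close>

text \<open>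
  The coefficient in \<open>y\<^sub>i x\<^sub>i\<^sup>k \<otimes> 1 = lower i k \<cdot> x\<^sub>i\<^sup>k\<^sup>-\<^sup>1 \<otimes> 1\<close>. The recursion moves one \<open>x\<^sub>i\<close> past \<open>y\<^sub>i\<close> with the
  relation \<open>x\<^sub>i y\<^sub>i - q\<^sub>i\<^sup>-\<^sup>1 y\<^sub>i x\<^sub>i = a\<^sub>i b\<^sub>i - 1\<close>, where \<open>a\<^sub>i b\<^sub>i\<close> acts on \<open>x\<^sub>i\<^sup>k \<otimes> 1\<close> by \<open>gab i * q i ^ (2 * k)\<close>.
\<close>

primrec lower :: "nat \<Rightarrow> nat \<Rightarrow> 'k" where
  "lower i 0 = 0"
| "lower i (Suc k) = q i * (lower i k + 1 - gab i * q i ^ (2 * k))"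

lemma lower_closed_form: "(1 - q i) * lower i (Suc k) = q i * (1 - q i ^ Suc k) * (1 - gab i * q i ^ k)"
proof (induction k)
  case (Suc k)
  have "(1 - q i) * lower i (Suc (Suc k)) =
      q i * ((1 - q i) * lower i (Suc k) + (1 - q i) * (1 - gab i * q i ^ (2 * Suc k)))"
    by (simp add: algebra_simps)
  also have "\<dots> = q i * (1 - q i ^ Suc (Suc k)) * (1 - gab i * q i ^ Suc k)"
    unfolding Suc.IH by (simp add: algebra_simps power_add mult_2 mult_2_right)
  finally show ?case .
qed (simp add: algebra_simps)

text \<open>
  In the closed form the factor \<open>1 - q i ^ Suc k\<close> is nonzero below the order of \<open>q i\<close>, so the coefficient
  vanishes exactly at the edge. At \<open>k = mord D i\<close> it vanishes as well, which makes the operators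
  compatible with the truncation \<open>x\<^sub>i\<^sup>m = 0\<close>.
\<close>

lemma lower_eq_0_iff:
  assumes "i \<in> I" "Suc k < mord D i"
  shows "lower i (Suc k) = 0 \<longleftrightarrow> i \<in> Sset D \<gamma> \<and> k = edge D \<gamma> i"
proof -
  have "1 - q i \<noteq> 0" using nilpotent assms(1) by (simp add: nilpotent_type_def)
  moreover have "1 - q i ^ Suc k \<noteq> 0" using mord(3)[OF assms(1), of "Suc k"] assms(2) by (metis eq_iff_diff_eq_0 zero_less_Suc)
  ultimately have "lower i (Suc k) = 0 \<longleftrightarrow> gab i * q i ^ k = 1"
    using lower_closed_form[of i k] q_nonzero[OF assms(1)] by (metis eq_iff_diff_eq_0 mult_eq_0_iff)
  also have "\<dots> \<longleftrightarrow> is_edge D \<gamma> i k"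
    using assms by (simp add: is_edge_iff del: atLeastAtMost_iff)
  also have "\<dots> \<longleftrightarrow> i \<in> Sset D \<gamma> \<and> k = edge D \<gamma> i"
    using edge_eq[OF assms(1)] is_edge_edge assms(1) by (auto simp: Sset_def simp del: atLeastAtMost_iff)
  finally show ?thesis .
qed

text \<open>
  The scalars picked up when \<open>g\<close>, \<open>x\<^sub>i\<close> and \<open>y\<^sub>i\<close> are moved into the ordered monomial \<open>x\<^sup>e\<close>: \<open>g\<close>
  passes all factors, and \<open>x\<^sub>i\<close> and \<open>y\<^sub>i\<close> pass those with index below \<open>i\<close>.
\<close>

definition wchi :: "'g \<Rightarrow> (nat \<Rightarrow> nat) \<Rightarrow> 'k"
  where "wchi g e = (\<Prod>k\<in>I. chi D k g ^ e k)"

definition xcoef :: "nat \<Rightarrow> (nat \<Rightarrow> nat) \<Rightarrow> 'k"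
  where "xcoef i e = (\<Prod>k\<in>{1..<i}. qmat D i k ^ e k)"

definition ycoef :: "nat \<Rightarrow> (nat \<Rightarrow> nat) \<Rightarrow> 'k"
  where "ycoef i e = (\<Prod>k\<in>{1..<i}. qmat D k i ^ e k)"

lemma wchi_up: "i \<in> I \<Longrightarrow> wchi g (e(i := Suc (e i))) = chi D i g * wchi g e"
  unfolding wchi_def by (subst prod_power_up) simp_all

lemma xcoef_up: "i \<in> I \<Longrightarrow> xcoef j (e(i := Suc (e i))) = (if i < j then qmat D j i else 1) * xcoef j e"
  unfolding xcoef_def by (subst prod_power_up) simp_all

lemma ycoef_up: "i \<in> I \<Longrightarrow> ycoef j (e(i := Suc (e i))) = (if i < j then qmat D i j else 1) * ycoef j e"
  unfolding ycoef_def by (subst prod_power_up) simp_all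

lemma xcoef_nonzero: "i \<in> I \<Longrightarrow> xcoef i e \<noteq> 0" and ycoef_nonzero: "i \<in> I \<Longrightarrow> ycoef i e \<noteq> 0"
  using qmat_nonzero by (auto simp: xcoef_def ycoef_def)

lemma xcoef_ycoef: "i \<in> I \<Longrightarrow> xcoef i e * ycoef i e = 1"
  unfolding xcoef_def ycoef_def prod.distrib[symmetric] power_mult_distrib[symmetric]
  using qmat_inverse by (intro prod.neutral) auto

lemma wchi_ab:
  assumes "i \<in> I"
  shows "wchi (a i \<otimes>\<^bsub>grp D\<^esub> b i) e = q i ^ (2 * e i)"
proof -
  have "wchi (a i \<otimes>\<^bsub>grp D\<^esub> b i) e = (\<Prod>k\<in>I. if k = i then q i ^ (2 * e i) else 1)"
    unfolding wchi_def
    by (intro prod.cong refl) (use assms in \<open>simp add: chi_ab power_mult del: atLeastAtMost_iff\<close>)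
  then show ?thesis using assms by simp
qed

lemma wchi_mult: "\<lbrakk>g \<in> carrier (grp D); h \<in> carrier (grp D)\<rbrakk> \<Longrightarrow> wchi (g \<otimes>\<^bsub>grp D\<^esub> h) e = wchi g e * wchi h e"
  unfolding wchi_def prod.distrib[symmetric] by (intro prod.cong refl) (simp only: chi_mult power_mult_distrib)

lemma wchi_one: "wchi \<one>\<^bsub>grp D\<^esub> e = 1"
  unfolding wchi_def by (intro prod.neutral ballI) (simp only: dual_one[OF chi_dual] power_one)

subsection \<open>The operators\<close>

text \<open>
  The action of the generators on coefficient functions. A coefficient of \<open>x\<^sub>i f\<close> comes from the exponent
  below, a coefficient of \<open>y\<^sub>i f\<close> from the exponent above.
\<close>

primrec gop :: "'g gen \<Rightarrow> ((nat \<Rightarrow> nat) \<Rightarrow> 'k) \<Rightarrow> (nat \<Rightarrow> nat) \<Rightarrow> 'k" where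
  "gop (GenG g) f = (\<lambda>e. \<gamma> g * wchi g e * f e)"
| "gop (GenX i) f = (\<lambda>e. if e \<in> E \<and> e i \<noteq> 0 then xcoef i e * f (e(i := e i - 1)) else 0)"
| "gop (GenY i) f = (\<lambda>e. if e \<in> E then ycoef i e * lower i (Suc (e i)) * f (e(i := Suc (e i))) else 0)"

definition pop :: "('g, 'k) free_elt \<Rightarrow> ((nat \<Rightarrow> nat) \<Rightarrow> 'k) \<Rightarrow> (nat \<Rightarrow> nat) \<Rightarrow> 'k"
  where "pop p f e = (\<Sum>w\<in>Poly_Mapping.keys p. Poly_Mapping.lookup p w * foldr gop (letters w) f e)"

text \<open>
  Functions supported in the box. The relations between the operators hold only there, since outside the
  box \<open>x\<^sub>i\<close> and \<open>y\<^sub>i\<close> act by zero but \<open>a\<^sub>i b\<^sub>i - 1\<close> does not.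
\<close>

definition V :: "((nat \<Rightarrow> nat) \<Rightarrow> 'k) set"
  where "V = {f. \<forall>e. e \<notin> E \<longrightarrow> f e = 0}"

lemma gop_add: "gop s (\<lambda>e. f e + g e) = (\<lambda>e. gop s f e + gop s g e)"
  and gop_scale: "gop s (\<lambda>e. c * f e) = (\<lambda>e. c * gop s f e)"
  by (cases s; auto simp: fun_eq_iff algebra_simps)+

lemma word_add: "foldr gop ws (\<lambda>e. f e + g e) = (\<lambda>e. foldr gop ws f e + foldr gop ws g e)"
  by (induction ws) (simp_all add: gop_add)

lemma word_scale: "foldr gop ws (\<lambda>e. c * f e) = (\<lambda>e. c * foldr gop ws f e)"
  by (induction ws) (simp_all add: gop_scale)

lemma pop_superset:
  assumes "finite A" "Poly_Mapping.keys p \<subseteq> A"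
  shows "pop p f e = (\<Sum>w\<in>A. Poly_Mapping.lookup p w * foldr gop (letters w) f e)"
  unfolding pop_def using assms by (intro sum.mono_neutral_left) (auto simp: in_keys_iff)

lemma pop_plus: "pop (p + p') f = (\<lambda>e. pop p f e + pop p' f e)"
proof
  fix e
  let ?A = "Poly_Mapping.keys p \<union> Poly_Mapping.keys p'"
  have "Poly_Mapping.keys (p + p') \<subseteq> ?A" by (rule keys_add)
  then show "pop (p + p') f e = pop p f e + pop p' f e"
    using pop_superset[of ?A "p + p'" f e] pop_superset[of ?A p f e] pop_superset[of ?A p' f e]
    by (simp add: lookup_add algebra_simps sum.distrib)
qed

lemma pop_uminus: "pop (- p) f = (\<lambda>e. - pop p f e)"
  by (simp add: pop_def sum_negf fun_eq_iff)

lemma pop_minus: "pop (p - p') f = (\<lambda>e. pop p f e - pop p' f e)"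
  using pop_plus[of p "- p'" f] by (simp add: pop_uminus)

lemma pop_single: "pop (Poly_Mapping.single w c) f = (\<lambda>e. c * foldr gop (letters w) f e)"
  by (auto simp: pop_def fun_eq_iff)

lemma pop_zero [simp]: "pop 0 f = (\<lambda>e. 0)"
  by (simp add: pop_def fun_eq_iff)

lemma pop_one [simp]: "pop 1 f = f"
  using pop_single[of 0 1 f] by simp

lemma pop_fconst: "pop (fconst c) f = (\<lambda>e. c * f e)"
  by (simp add: fconst_def pop_single)

lemma pop_fgen: "pop (fgen s) f = gop s f"
  by (simp add: fgen_def pop_single)

lemma pop_add_arg: "pop p (\<lambda>e. f e + g e) = (\<lambda>e. pop p f e + pop p g e)"
  by (simp add: pop_def fun_eq_iff word_add algebra_simps sum.distrib)

lemma pop_scale_arg: "pop p (\<lambda>e. c * f e) = (\<lambda>e. c * pop p f e)"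
  by (simp add: pop_def fun_eq_iff word_scale sum_distrib_left algebra_simps)

lemma pop_zero_arg: "pop p (\<lambda>e. 0) = (\<lambda>e. 0)"
  using pop_scale_arg[of p 0 "\<lambda>e. 0"] by simp

lemma pop_mult: "pop (p * p') f = pop p (pop p' f)"
proof (induction p rule: poly_mapping_add_induct)
  case (single w c)
  show ?case
  proof (induction p' rule: poly_mapping_add_induct)
    case (single w' c')
    show ?case by (simp add: mult_single pop_single word_scale fun_eq_iff algebra_simps)
  qed (simp_all add: distrib_left pop_plus pop_add_arg pop_zero_arg)
qed (simp_all add: distrib_right pop_plus)

lemma pop_power: "pop (p ^ k) f = (pop p ^^ k) f"
  by (induction k) (simp_all add: pop_mult)

subsection \<open>The relations hold\<close>

lemma E_up: "\<lbrakk>e \<in> E; i \<in> I; Suc (e i) < mord D i\<rbrakk> \<Longrightarrow> e(i := Suc (e i)) \<in> E"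
  by (auto simp: exponents_def PiE_def extensional_def)

lemma E_down: "\<lbrakk>e \<in> E; i \<in> I\<rbrakk> \<Longrightarrow> e(i := e i - 1) \<in> E"
  unfolding exponents_def PiE_iff extensional_def by (auto intro: less_imp_diff_less)

lemma E_bound: "\<lbrakk>e \<in> E; i \<in> I\<rbrakk> \<Longrightarrow> e i < mord D i"
  by (auto simp: exponents_def)

lemma up_not_E: "\<lbrakk>i \<in> I; e i \<ge> mord D i\<rbrakk> \<Longrightarrow> e \<notin> E"
  using E_bound by fastforce

lemma gop_V: "f \<in> V \<Longrightarrow> gop s f \<in> V"
  by (cases s) (auto simp: V_def)

lemma pop_V: "f \<in> V \<Longrightarrow> pop p f \<in> V"
proof (induction p rule: poly_mapping_add_induct)
  case (single w c)
  have "foldr gop ws f \<in> V" for ws by (induction ws) (use single in \<open>simp_all add: gop_V\<close>)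
  then show ?case by (simp add: pop_single V_def)
qed (simp_all add: V_def pop_plus)

lemma lower_mord: "i \<in> I \<Longrightarrow> lower i (mord D i) = 0"
proof -
  assume i: "i \<in> I"
  obtain k where k: "mord D i = Suc k" using mord(1)[OF i] gr0_implies_Suc by blast
  have "(1 - q i) * lower i (Suc k) = 0"
    using lower_closed_form[of i k] mord(2)[OF i] unfolding k by (simp del: lower.simps power_Suc)
  moreover have "1 - q i \<noteq> 0" using nilpotent i by (simp add: nilpotent_type_def)
  ultimately show ?thesis unfolding k by (metis mult_eq_0_iff)
qed

lemma xcoef_down: "\<lbrakk>i \<in> I; e i \<noteq> 0\<rbrakk> \<Longrightarrow> xcoef j e = (if i < j then qmat D j i else 1) * xcoef j (e(i := e i - 1))"
  using xcoef_up[of i j "e(i := e i - 1)"] by simp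

lemma ycoef_down: "\<lbrakk>i \<in> I; e i \<noteq> 0\<rbrakk> \<Longrightarrow> ycoef j e = (if i < j then qmat D i j else 1) * ycoef j (e(i := e i - 1))"
  using ycoef_up[of i j "e(i := e i - 1)"] by simp

lemma wchi_down: "\<lbrakk>i \<in> I; e i \<noteq> 0\<rbrakk> \<Longrightarrow> wchi g e = chi D i g * wchi g (e(i := e i - 1))"
  using wchi_up[of i g "e(i := e i - 1)"] by simp

lemma relation_G_X:
  "i \<in> I \<Longrightarrow> gop (GenG g) (gop (GenX i) f) = (\<lambda>e. chi D i g * gop (GenX i) (gop (GenG g) f) e)"
  using wchi_down[of i _ g] by (auto simp: fun_eq_iff simp del: atLeastAtMost_iff)

lemma relation_G_Y:
  assumes "i \<in> I" "g \<in> carrier (grp D)"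
  shows "gop (GenG g) (gop (GenY i) f) = (\<lambda>e. inverse (chi D i g) * gop (GenY i) (gop (GenG g) f) e)"
  using wchi_up[of i g] chi_nonzero[OF assms] assms(1)
  by (auto simp: fun_eq_iff field_simps simp del: atLeastAtMost_iff fun_upd_apply)

lemma relation_X_X:
  assumes "i \<in> I" "j \<in> I" "i \<noteq> j"
  shows "gop (GenX i) (gop (GenX j) f) = (\<lambda>e. qmat D i j * gop (GenX j) (gop (GenX i) f) e)"
proof
  fix e
  show "gop (GenX i) (gop (GenX j) f) e = qmat D i j * gop (GenX j) (gop (GenX i) f) e"
  proof (cases "e \<in> E \<and> e i \<noteq> 0 \<and> e j \<noteq> 0")
    case True
    then have "gop (GenX i) (gop (GenX j) f) e = xcoef i e * xcoef j (e(i := e i - 1)) * f (e(i := e i - 1, j := e j - 1))"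
      using E_down[of e i] assms by (simp del: atLeastAtMost_iff)
    moreover have "gop (GenX j) (gop (GenX i) f) e = xcoef j e * xcoef i (e(j := e j - 1)) * f (e(j := e j - 1, i := e i - 1))"
      using True E_down[of e j] assms by (simp del: atLeastAtMost_iff)
    moreover have "xcoef i e * xcoef j (e(i := e i - 1)) = qmat D i j * (xcoef j e * xcoef i (e(j := e j - 1)))"
      using xcoef_down[of i e j] xcoef_down[of j e i] True assms qmat_inverse[of i j]
      by (cases "i < j") (simp_all add: algebra_simps del: atLeastAtMost_iff)
    ultimately show ?thesis using assms(3) by (simp add: fun_upd_twist mult.assoc)
  qed (use assms in auto)
qed

text \<open>
  The test whether the intermediate exponent lies in the box can be omitted: if it does not, then the final
  exponent does not either, and \<open>f\<close> vanishes there.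
\<close>

lemma Y_Y_eval:
  assumes "i \<in> I" "j \<in> I" "i \<noteq> j" "f \<in> V" "e \<in> E"
  shows "gop (GenY i) (gop (GenY j) f) e = ycoef i e * ycoef j (e(i := Suc (e i))) *
    (lower i (Suc (e i)) * lower j (Suc (e j)) * f (e(i := Suc (e i), j := Suc (e j))))"
proof (cases "e(i := Suc (e i)) \<in> E")
  case False
  then have "\<not> Suc (e i) < mord D i" using E_up assms by blast
  then have "e(i := Suc (e i), j := Suc (e j)) \<notin> E"
    using assms(3) by (intro up_not_E[OF assms(1)]) simp
  then show ?thesis using False assms by (simp add: V_def)
qed (use assms in simp)

lemma relation_Y_Y:
  assumes "i \<in> I" "j \<in> I" "i \<noteq> j" "f \<in> V"
  shows "gop (GenY i) (gop (GenY j) f) = (\<lambda>e. qmat D i j * gop (GenY j) (gop (GenY i) f) e)"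
proof
  fix e
  show "gop (GenY i) (gop (GenY j) f) e = qmat D i j * gop (GenY j) (gop (GenY i) f) e"
  proof (cases "e \<in> E")
    case True
    have "ycoef i e * ycoef j (e(i := Suc (e i))) = qmat D i j * (ycoef j e * ycoef i (e(j := Suc (e j))))"
      using ycoef_up[of i j e] ycoef_up[of j i e] assms qmat_inverse[of i j]
      by (cases "i < j") (simp_all add: algebra_simps del: atLeastAtMost_iff)
    moreover have "e(i := Suc (e i), j := Suc (e j)) = e(j := Suc (e j), i := Suc (e i))"
      using assms(3) by (rule fun_upd_twist)
    ultimately show ?thesis
      unfolding Y_Y_eval[OF assms(1-4) True] Y_Y_eval[OF assms(2,1) assms(3)[symmetric] assms(4) True]
      by (simp add: ac_simps)
  qed simp
qed

text \<open>
  Both products act diagonally. At the boundary of the box the truncated product agrees with the general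
  formula because \<open>lower i 0 = 0\<close> and \<open>lower i (mord D i) = 0\<close>, and the relation is then the recursion
  for \<open>lower\<close>.
\<close>

lemma relation_X_Y_same:
  assumes i: "i \<in> I" and f: "f \<in> V"
  shows "gop (GenX i) (gop (GenY i) f) e - inverse (q i) * gop (GenY i) (gop (GenX i) f) e
    = gop (GenG (a i \<otimes>\<^bsub>grp D\<^esub> b i)) f e - f e"
proof (cases "e \<in> E")
  case True
  have 1: "gop (GenX i) (gop (GenY i) f) e = lower i (e i) * f e"
  proof (cases "e i = 0")
    case False
    have "xcoef i e * ycoef i (e(i := e i - 1)) = 1"
      using ycoef_down[of i e i, OF i False] xcoef_ycoef[OF i, of e] by simp
    then show ?thesis using True False E_down[OF True i]
      by (simp add: mult.assoc[symmetric] del: lower.simps)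
  qed simp
  have 2: "gop (GenY i) (gop (GenX i) f) e = lower i (Suc (e i)) * f e"
  proof (cases "Suc (e i) < mord D i")
    case lt: True
    have "ycoef i e * xcoef i (e(i := Suc (e i))) = 1"
      using xcoef_up[OF i, of i e] xcoef_ycoef[OF i, of e] by (simp add: mult.commute)
    then have "ycoef i e * (xcoef i (e(i := Suc (e i))) * (f e * lower i (Suc (e i)))) = f e * lower i (Suc (e i))"
      by (metis mult.assoc mult_1)
    then show ?thesis using True E_up[OF True i lt]
      by (simp add: ac_simps del: lower.simps)
  next
    case False
    then have "Suc (e i) = mord D i" using E_bound[OF True i] by simp
    then have "lower i (Suc (e i)) = 0" using lower_mord[OF i] by simp
    then show ?thesis by (simp del: lower.simps)
  qed
  show ?thesis
    unfolding 1 2 using q_nonzero[OF i] by (simp add: wchi_ab[OF i] gab_def field_simps)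
qed (use f in \<open>simp add: V_def\<close>)

lemma relation_X_Y_diff:
  assumes i: "i \<in> I" and j: "j \<in> I" and ij: "i \<noteq> j"
  shows "gop (GenX i) (gop (GenY j) f) e = inverse (qmat D i j) * gop (GenY j) (gop (GenX i) f) e"
proof (cases "e \<in> E \<and> e i \<noteq> 0")
  case True
  let ?d = "e(i := e i - 1)" and ?u = "e(j := Suc (e j))"
  have X_Y: "gop (GenX i) (gop (GenY j) f) e = xcoef i e * ycoef j ?d * lower j (Suc (e j)) * f (?d(j := Suc (e j)))"
    using True E_down[of e i] i ij by simp
  show ?thesis
  proof (cases "Suc (e j) < mord D j")
    case lt: True
    have Y_X: "gop (GenY j) (gop (GenX i) f) e = ycoef j e * xcoef i ?u * lower j (Suc (e j)) * f (?u(i := e i - 1))"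
      using True E_up[of e j] j ij lt by (simp del: lower.simps)
    have "xcoef i e * ycoef j ?d = inverse (qmat D i j) * (ycoef j e * xcoef i ?u)"
      using xcoef_up[OF j, of i e] ycoef_down[OF i, of e j] True qmat_nonzero[OF i j] ij
      by (cases "i < j") (simp_all add: field_simps del: atLeastAtMost_iff)
    then show ?thesis unfolding X_Y Y_X using fun_upd_twist[OF ij, of e] by (simp add: mult.assoc)
  next
    case False
    then have "Suc (e j) = mord D j" using E_bound[of e j] True j by simp
    then have "lower j (Suc (e j)) = 0" using lower_mord[OF j] by simp
    then show ?thesis unfolding X_Y by (simp del: lower.simps)
  qed
qed (use i j ij in auto)

lemma gop_X_nonzero: "gop (GenX i) f e \<noteq> 0 \<Longrightarrow> e i \<noteq> 0 \<and> f (e(i := e i - 1)) \<noteq> 0"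
  and gop_Y_nonzero: "gop (GenY i) f e \<noteq> 0 \<Longrightarrow> f (e(i := Suc (e i))) \<noteq> 0"
  by (auto split: if_splits)

lemma relation_X_power:
  assumes i: "i \<in> I" and f: "f \<in> V"
  shows "(gop (GenX i) ^^ mord D i) f = (\<lambda>e. 0)"
proof
  fix e
  have "k \<le> e i" if "(gop (GenX i) ^^ k) f e \<noteq> 0" for k e
    using that
  proof (induction k arbitrary: e)
    case (Suc k)
    then have "gop (GenX i) ((gop (GenX i) ^^ k) f) e \<noteq> 0" by (simp only: funpow.simps o_apply not_False_eq_True)
    then have "e i \<noteq> 0" "(gop (GenX i) ^^ k) f (e(i := e i - 1)) \<noteq> 0" using gop_X_nonzero by blast+
    from this(1) Suc.IH[OF this(2)] show ?case by simp
  qed simp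
  moreover have "(gop (GenX i) ^^ k) f \<in> V" for k
    by (induction k) (simp_all only: funpow.simps o_apply id_apply gop_V f)
  ultimately show "(gop (GenX i) ^^ mord D i) f e = 0"
    using up_not_E[OF i, of e] unfolding V_def by blast
qed

lemma relation_Y_power:
  assumes i: "i \<in> I" and f: "f \<in> V"
  shows "(gop (GenY i) ^^ mord D i) f = (\<lambda>e. 0)"
proof
  fix e
  have "e i + k < mord D i" if "(gop (GenY i) ^^ k) f e \<noteq> 0" for k e
    using that
  proof (induction k arbitrary: e)
    case 0 then show ?case using f E_bound[OF _ i, of e] by (auto simp: V_def)
  next
    case (Suc k)
    then have "gop (GenY i) ((gop (GenY i) ^^ k) f) e \<noteq> 0" by (simp only: funpow.simps o_apply not_False_eq_True)
    from Suc.IH[OF gop_Y_nonzero[OF this]] show ?case by simp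
  qed
  from this[of "mord D i" e] show "(gop (GenY i) ^^ mord D i) f e = 0" by fastforce
qed

lemma pop_relator:
  assumes "r \<in> relators D" "f \<in> V"
  shows "pop r f = (\<lambda>e. 0)"
proof -
  note pop_simps = pop_minus pop_mult pop_fgen pop_fconst pop_power
  have X_Y: "pop (fX i * fY j - fconst (inverse (qmat D i j)) * fY j * fX i
      - (if i = j then fG (a i \<otimes>\<^bsub>grp D\<^esub> b i) - 1 else 0)) f = (\<lambda>e. 0)"
    if "i \<in> I" "j \<in> I" for i j
  proof (cases "i = j")
    case True
    then show ?thesis
      using relation_X_Y_same[OF that(1) assms(2)]
      by (simp add: pop_simps qmat_diag fun_eq_iff del: gop.simps lower.simps)
  next
    case False
    then show ?thesis
      using relation_X_Y_diff[OF that False]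
      by (simp add: pop_simps fun_eq_iff del: gop.simps lower.simps)
  qed
  consider g h where "g \<in> carrier (grp D)" "h \<in> carrier (grp D)" "r = fG g * fG h - fG (g \<otimes>\<^bsub>grp D\<^esub> h)"
    | "r = fG \<one>\<^bsub>grp D\<^esub> - 1"
    | g i where "g \<in> carrier (grp D)" "i \<in> I" "r = fG g * fX i - fconst (chi D i g) * fX i * fG g"
    | g i where "g \<in> carrier (grp D)" "i \<in> I" "r = fG g * fY i - fconst (inverse (chi D i g)) * fY i * fG g"
    | i j where "i \<in> I" "j \<in> I" "i \<noteq> j" "r = fX i * fX j - fconst (qmat D i j) * fX j * fX i"
    | i j where "i \<in> I" "j \<in> I" "i \<noteq> j" "r = fY i * fY j - fconst (qmat D i j) * fY j * fY i"
    | i j where "i \<in> I" "j \<in> I" "r = fX i * fY j - fconst (inverse (qmat D i j)) * fY j * fX i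
          - (if i = j then fG (a i \<otimes>\<^bsub>grp D\<^esub> b i) - 1 else 0)"
    | i where "i \<in> I" "r = fX i ^ mord D i" | i where "i \<in> I" "r = fY i ^ mord D i"
    using assms(1) unfolding relators_def
    by (elim UnE CollectE exE conjE singletonE) (rule that; assumption)+
  then show ?thesis
  proof cases
    case 1
    then show ?thesis unfolding 1(3) using dual_groupD(2)[OF weight 1(1,2)]
      by (simp add: pop_simps wchi_mult fun_eq_iff algebra_simps)
  next
    case 2
    then show ?thesis unfolding 2 by (simp add: pop_simps wchi_one dual_one[OF weight])
  next
    case 3
    show ?thesis unfolding 3(3) using relation_G_X[OF 3(2)] by (simp add: pop_simps del: gop.simps)
  next
    case 4
    show ?thesis unfolding 4(3) using relation_G_Y[OF 4(2,1)] by (simp add: pop_simps del: gop.simps)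
  next
    case 5
    show ?thesis unfolding 5(4) using relation_X_X[OF 5(1-3)] by (simp add: pop_simps del: gop.simps)
  next
    case 6
    show ?thesis unfolding 6(4) using relation_Y_Y[OF 6(1-3) assms(2)] by (simp add: pop_simps del: gop.simps)
  next
    case 7
    show ?thesis unfolding 7(3) using X_Y[OF 7(1,2)] .
  next
    case 8
    show ?thesis unfolding 8(2) pop_power pop_fgen[abs_def] using relation_X_power[OF 8(1) assms(2)] .
  next
    case 9
    show ?thesis unfolding 9(2) pop_power pop_fgen[abs_def] using relation_Y_power[OF 9(1) assms(2)] .
  qed
qed

lemma pop_ideal:
  assumes "p \<in> alg_ideal D" "f \<in> V"
  shows "pop p f = (\<lambda>e. 0)"
proof -
  interpret F: ring "free_alg D" by (rule ring_free_alg)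
  let ?K = "{p \<in> carrier (free_alg D). \<forall>f\<in>V. pop p f = (\<lambda>e. 0)}"
  have "ideal ?K (free_alg D)"
  proof (rule idealI[OF ring_free_alg])
    show "subgroup ?K (add_monoid (free_alg D))"
    proof (rule group.subgroupI[OF F.add.is_group])
      fix p assume "p \<in> ?K"
      then show "inv\<^bsub>add_monoid (free_alg D)\<^esub> p \<in> ?K"
        unfolding a_inv_def[symmetric] using free_alg_uminus[of p D] free_alg_closed(4)[of p D p] by (simp add: pop_uminus)
    next
      show "?K \<noteq> {}" using F.zero_closed by force
    qed (auto simp: free_alg_closed pop_plus)
  qed (auto simp: free_alg_closed pop_mult pop_zero_arg pop_V)
  moreover have "relators D \<subseteq> ?K" using relators_closed[OF D] pop_relator by blast
  ultimately have "alg_ideal D \<subseteq> ?K" unfolding alg_ideal_def by (rule F.genideal_minimal)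
  then show ?thesis using assms by blast
qed

text \<open>
  The action of a class is that of any representative, as the ideal acts by zero.
\<close>

definition vact :: "('g, 'k) alg_elt \<Rightarrow> ((nat \<Rightarrow> nat) \<Rightarrow> 'k) \<Rightarrow> (nat \<Rightarrow> nat) \<Rightarrow> 'k"
  where "vact r f = pop (SOME p. p \<in> carrier (free_alg D) \<and> cls D p = r) f"

lemma vact_cls:
  assumes p: "p \<in> carrier (free_alg D)" and f: "f \<in> V"
  shows "vact (cls D p) f = pop p f"
proof -
  let ?p = "SOME p'. p' \<in> carrier (free_alg D) \<and> cls D p' = cls D p"
  have "?p \<in> carrier (free_alg D) \<and> cls D ?p = cls D p"
    by (rule someI[of _ p]) (simp add: p)
  then have *: "?p \<in> carrier (free_alg D)" "cls D ?p = cls D p" by auto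
  then have "?p \<ominus>\<^bsub>free_alg D\<^esub> p \<in> alg_ideal D"
    using ring.quotient_eq_iff_same_a_r_cos[OF ring_free_alg ideal_alg_ideal[OF D], of ?p p] p
    by (simp add: cls_def)
  then have "?p - p \<in> alg_ideal D" using p by (simp add: a_minus_def free_alg_uminus)
  then have "pop (?p - p) f = (\<lambda>e. 0)" using f by (rule pop_ideal)
  then show ?thesis by (simp add: vact_def pop_minus fun_eq_iff)
qed

definition Vmod :: "(('g, 'k) alg_elt, (nat \<Rightarrow> nat) \<Rightarrow> 'k) module"
  where "Vmod = \<lparr>carrier = V, mult = undefined, one = undefined, ring.zero = (\<lambda>e. 0),
    add = (\<lambda>f g e. f e + g e), smult = vact\<rparr>"

lemma Vmod_simps [simp]:
  "carrier Vmod = V" "\<zero>\<^bsub>Vmod\<^esub> = (\<lambda>e. 0)" "f \<oplus>\<^bsub>Vmod\<^esub> g = (\<lambda>e. f e + g e)" "r \<odot>\<^bsub>Vmod\<^esub> f = vact r f"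
  by (simp_all add: Vmod_def)

sublocale Vmod: alg_module D Vmod
proof (intro alg_module.intro left_module.intro left_module_axioms.intro alg_module_axioms.intro D ring_alg)
  show "abelian_group Vmod"
  proof (rule abelian_groupI)
    fix f assume "f \<in> carrier Vmod"
    then show "\<exists>g\<in>carrier Vmod. g \<oplus>\<^bsub>Vmod\<^esub> f = \<zero>\<^bsub>Vmod\<^esub>"
      by (intro bexI[of _ "\<lambda>e. - f e"]) (auto simp: V_def)
  qed (auto simp: V_def add.assoc add.commute)
next
  have rep: "\<exists>p\<in>carrier (free_alg D). r = cls D p" if "r \<in> carrier (alg D)" for r
    using that by (auto simp: carrier_alg)
  show "r \<odot>\<^bsub>Vmod\<^esub> f \<in> carrier Vmod" if "r \<in> carrier (alg D)" "f \<in> carrier Vmod" for r f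
    using rep[OF that(1)] that(2) by (auto simp: vact_cls pop_V)
  show "(r \<oplus>\<^bsub>alg D\<^esub> s) \<odot>\<^bsub>Vmod\<^esub> f = r \<odot>\<^bsub>Vmod\<^esub> f \<oplus>\<^bsub>Vmod\<^esub> s \<odot>\<^bsub>Vmod\<^esub> f"
    if "r \<in> carrier (alg D)" "s \<in> carrier (alg D)" "f \<in> carrier Vmod" for r s f
    using rep[OF that(1)] rep[OF that(2)] that(3)
    by (auto simp: vact_cls free_alg_closed pop_plus simp flip: cls_simps(2)[OF D])
  show "(r \<otimes>\<^bsub>alg D\<^esub> s) \<odot>\<^bsub>Vmod\<^esub> f = r \<odot>\<^bsub>Vmod\<^esub> (s \<odot>\<^bsub>Vmod\<^esub> f)"
    if "r \<in> carrier (alg D)" "s \<in> carrier (alg D)" "f \<in> carrier Vmod" for r s f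
    using rep[OF that(1)] rep[OF that(2)] that(3)
    by (auto simp: vact_cls free_alg_closed pop_mult pop_V simp flip: cls_simps(3)[OF D])
  show "r \<odot>\<^bsub>Vmod\<^esub> (f \<oplus>\<^bsub>Vmod\<^esub> g) = r \<odot>\<^bsub>Vmod\<^esub> f \<oplus>\<^bsub>Vmod\<^esub> r \<odot>\<^bsub>Vmod\<^esub> g"
    if "r \<in> carrier (alg D)" "f \<in> carrier Vmod" "g \<in> carrier Vmod" for r f g
  proof -
    have "(\<lambda>e. f e + g e) \<in> V" using that(2,3) by (simp add: V_def)
    then show ?thesis using rep[OF that(1)] that(2,3) by (auto simp: vact_cls pop_add_arg)
  qed
  show "\<one>\<^bsub>alg D\<^esub> \<odot>\<^bsub>Vmod\<^esub> f = f" if "f \<in> carrier Vmod" for f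
    using that vact_cls[of 1 f] cls_simps(4)[OF D fconst_closed fconst_closed] by simp
qed

lemma vact_const: "f \<in> V \<Longrightarrow> vact (hconst D c) f = (\<lambda>e. c * f e)"
  by (simp add: vact_cls pop_fconst)

lemma vact_gen: "\<lbrakk>s \<in> gens D; f \<in> V\<rbrakk> \<Longrightarrow> vact (cls D (fgen s)) f = gop s f"
  by (simp add: vact_cls pop_fgen)

subsection \<open>The character of the subalgebra generated by the group and the \<open>y\<^sub>i\<close>\<close>

definition origin :: "nat \<Rightarrow> nat"
  where "origin = (\<lambda>k\<in>I. 0)"

definition delta :: "(nat \<Rightarrow> nat) \<Rightarrow> (nat \<Rightarrow> nat) \<Rightarrow> 'k"
  where "delta e = (\<lambda>e'. if e' = e then 1 else 0)"

lemma delta_V: "e \<in> E \<Longrightarrow> delta e \<in> V"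
  by (auto simp: delta_def V_def)

lemma delta_self: "delta e e = 1"
  by (simp add: delta_def)

lemma origin_E: "origin \<in> E"
  using mord(1) by (auto simp: origin_def exponents_def)

lemma gop_Y_origin: "i \<in> I \<Longrightarrow> gop (GenY i) (delta origin) = (\<lambda>e. 0)"
proof -
  assume i: "i \<in> I"
  have "e(i := Suc (e i)) \<noteq> origin" for e
    using i by (metis fun_upd_same nat.distinct(1) origin_def restrict_apply')
  then have "delta origin (e(i := Suc (e i))) = 0" for e by (simp add: delta_def)
  then show ?thesis by (simp add: fun_eq_iff del: lower.simps)
qed

lemma gop_G_origin: "gop (GenG g) (delta origin) = (\<lambda>e. \<gamma> g * delta origin e)"
  by (auto simp: delta_def wchi_def origin_def fun_eq_iff intro!: prod.neutral)

lemma Ysub_gens_closed: "range (hconst D) \<union> hG D ` carrier (grp D) \<union> hY D ` I \<subseteq> carrier (alg D)"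
  by (auto simp del: atLeastAtMost_iff)

lemma Ysub_closed: "u \<in> Ysub D \<Longrightarrow> u \<in> carrier (alg D)"
  unfolding Ysub_def using Vmod.R.generate_ring_incl[OF Ysub_gens_closed] by blast

lemma Ysub_origin: "u \<in> Ysub D \<Longrightarrow> vact u (delta origin) = (\<lambda>e. vact u (delta origin) origin * delta origin e)"
  unfolding Ysub_def
proof (induction rule: generate_ring.induct)
  case one
  then show ?case using Vmod.smult_one[of "delta origin"] delta_V[OF origin_E] by (simp add: delta_def)
next
  case (incl u)
  then consider c where "u = hconst D c" | g where "g \<in> carrier (grp D)" "u = hG D g"
    | i where "i \<in> I" "u = hY D i" by blast
  then show ?case
  proof cases
    case 1 then show ?thesis using delta_V[OF origin_E] by (simp add: vact_const) (simp add: delta_def)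
  next
    case 2 then show ?thesis using delta_V[OF origin_E]
      by (simp add: vact_gen gop_G_origin del: gop.simps) (simp add: delta_def)
  next
    case 3 then show ?thesis using delta_V[OF origin_E]
      by (simp add: vact_gen gop_Y_origin del: gop.simps atLeastAtMost_iff)
  qed
next
  case (a_inv u)
  then have u: "u \<in> carrier (alg D)" using Ysub_closed by (simp add: Ysub_def)
  have "vact (\<ominus>\<^bsub>alg D\<^esub> u) (delta origin) = \<ominus>\<^bsub>Vmod\<^esub> (vact u (delta origin))"
    using Vmod.minus_smult[OF u, of "delta origin"] delta_V[OF origin_E] by simp
  also have "\<dots> = (\<lambda>e. - vact u (delta origin) e)"
    using Vmod.smult_closed[OF u, of "delta origin"] delta_V[OF origin_E]
    by (intro Vmod.M.minus_equality) (auto simp: V_def)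
  finally have eq: "vact (\<ominus>\<^bsub>alg D\<^esub> u) (delta origin) = (\<lambda>e. - vact u (delta origin) e)" .
  show ?case unfolding eq by (subst a_inv.IH) (simp add: delta_self)
next
  case (eng_add u w)
  then have "u \<in> carrier (alg D)" "w \<in> carrier (alg D)" using Ysub_closed by (simp_all add: Ysub_def)
  then have "vact (u \<oplus>\<^bsub>alg D\<^esub> w) (delta origin) = (\<lambda>e. vact u (delta origin) e + vact w (delta origin) e)"
    using Vmod.smult_l_distr[of u w "delta origin"] delta_V[OF origin_E] by simp
  then have eq: "vact (u \<oplus>\<^bsub>alg D\<^esub> w) (delta origin) = (\<lambda>e. vact u (delta origin) e + vact w (delta origin) e)" .
  show ?case unfolding eq by (subst eng_add.IH(1), subst eng_add.IH(2)) (simp add: distrib_right delta_self)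
next
  case (eng_mult u w)
  let ?c = "\<lambda>u. vact u (delta origin) origin"
  have uw: "u \<in> carrier (alg D)" "w \<in> carrier (alg D)" using eng_mult Ysub_closed by (simp_all add: Ysub_def)
  then have "vact (u \<otimes>\<^bsub>alg D\<^esub> w) (delta origin) = vact u (vact w (delta origin))"
    using Vmod.smult_assoc[of u w "delta origin"] delta_V[OF origin_E] by simp
  also have "vact w (delta origin) = vact (hconst D (?c w)) (delta origin)"
    unfolding vact_const[OF delta_V[OF origin_E]] by (rule eng_mult.IH(2))
  also have "vact u \<dots> = vact (hconst D (?c w)) (vact u (delta origin))"
    using Vmod.const_commute[OF uw(1), of "delta origin"] delta_V[OF origin_E] by simp
  also have "\<dots> = (\<lambda>e. ?c w * vact u (delta origin) e)"
    using Vmod.smult_closed[OF uw(1), of "delta origin"] delta_V[OF origin_E] by (simp add: vact_const)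
  finally have eq: "vact (u \<otimes>\<^bsub>alg D\<^esub> w) (delta origin) = (\<lambda>e. ?c w * vact u (delta origin) e)" .
  show ?case unfolding eq by (subst eng_mult.IH(1)) (simp add: mult.assoc delta_self)
qed

text \<open>
  \<open>Ychar\<close> is a choice of a homomorphism with prescribed values, so its existence has to be proved: the
  subalgebra acts on the coefficient function of \<open>x\<^sup>0\<close> by scalars, and these scalars are such a
  homomorphism.
\<close>

lemma Ychar_spec:
  shows "Ychar D \<gamma> \<in> ring_hom ((alg D)\<lparr>carrier := Ysub D\<rparr>) ground_field"
    and "Ychar D \<gamma> (hconst D c) = c"
    and "g \<in> carrier (grp D) \<Longrightarrow> Ychar D \<gamma> (hG D g) = \<gamma> g"
    and "i \<in> I \<Longrightarrow> Ychar D \<gamma> (hY D i) = 0"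
proof -
  define f where "f u = vact u (delta origin) origin" for u
  have dV: "delta origin \<in> V" by (rule delta_V[OF origin_E])
  have do: "delta origin origin = 1" by (simp add: delta_def)
  have "f \<in> ring_hom ((alg D)\<lparr>carrier := Ysub D\<rparr>) ground_field"
  proof (rule ring_hom_memI)
    fix u w assume "u \<in> carrier ((alg D)\<lparr>carrier := Ysub D\<rparr>)" "w \<in> carrier ((alg D)\<lparr>carrier := Ysub D\<rparr>)"
    then have Y: "u \<in> Ysub D" "w \<in> Ysub D" by auto
    then have uw: "u \<in> carrier (alg D)" "w \<in> carrier (alg D)" using Ysub_closed by auto
    show "f (u \<oplus>\<^bsub>(alg D)\<lparr>carrier := Ysub D\<rparr>\<^esub> w) = f u \<oplus>\<^bsub>ground_field\<^esub> f w"
      using Vmod.smult_l_distr[OF uw, of "delta origin"] dV by (simp add: f_def ground_field_def)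
    have "vact w (delta origin) = vact (hconst D (f w)) (delta origin)"
      unfolding vact_const[OF dV] f_def by (rule Ysub_origin[OF Y(2)])
    then have "vact (u \<otimes>\<^bsub>alg D\<^esub> w) (delta origin) = vact (hconst D (f w)) (vact u (delta origin))"
      using Vmod.smult_assoc[OF uw, of "delta origin"] Vmod.const_commute[OF uw(1), of "delta origin"] dV
      by simp
    then show "f (u \<otimes>\<^bsub>(alg D)\<lparr>carrier := Ysub D\<rparr>\<^esub> w) = f u \<otimes>\<^bsub>ground_field\<^esub> f w"
      using Vmod.smult_closed[OF uw(1), of "delta origin"] dV
      by (simp add: f_def ground_field_def vact_const)
  qed (use Vmod.smult_one[of "delta origin"] dV do in \<open>simp_all add: f_def ground_field_def\<close>)
  moreover have "f (hconst D c) = c" for c by (simp add: f_def vact_const dV do)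
  moreover have "f (hG D g) = \<gamma> g" if "g \<in> carrier (grp D)" for g
    using that by (simp add: f_def vact_gen dV gop_G_origin do del: gop.simps)
  moreover have "f (hY D i) = 0" if "i \<in> I" for i
    using that by (simp add: f_def vact_gen dV gop_Y_origin del: gop.simps atLeastAtMost_iff)
  ultimately have "\<exists>f. f \<in> ring_hom ((alg D)\<lparr>carrier := Ysub D\<rparr>) ground_field
    \<and> (\<forall>c. f (hconst D c) = c) \<and> (\<forall>g\<in>carrier (grp D). f (hG D g) = \<gamma> g) \<and> (\<forall>i\<in>I. f (hY D i) = 0)"
    by blast
  from someI_ex[OF this]
  show "Ychar D \<gamma> \<in> ring_hom ((alg D)\<lparr>carrier := Ysub D\<rparr>) ground_field"
    "Ychar D \<gamma> (hconst D c) = c" "g \<in> carrier (grp D) \<Longrightarrow> Ychar D \<gamma> (hG D g) = \<gamma> g"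
    "i \<in> I \<Longrightarrow> Ychar D \<gamma> (hY D i) = 0"
    unfolding Ychar_def[symmetric] by blast+
qed

end

section \<open>Direct sum decompositions of subquotients\<close>

locale left_module_hom = A: left_module R A + B: left_module R B
  for R :: "('r, 'x) ring_scheme" (structure) and A :: "('r, 'm, 'b) module_scheme"
    and B :: "('r, 'n, 'c) module_scheme" +
  fixes f :: "'m \<Rightarrow> 'n"
  assumes hom_closed: "v \<in> carrier A \<Longrightarrow> f v \<in> carrier B"
    and hom_add: "\<lbrakk>v \<in> carrier A; w \<in> carrier A\<rbrakk> \<Longrightarrow> f (v \<oplus>\<^bsub>A\<^esub> w) = f v \<oplus>\<^bsub>B\<^esub> f w"
    and hom_smult: "\<lbrakk>r \<in> carrier R; v \<in> carrier A\<rbrakk> \<Longrightarrow> f (r \<odot>\<^bsub>A\<^esub> v) = r \<odot>\<^bsub>B\<^esub> f v"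
begin

lemma hom_zero: "f \<zero>\<^bsub>A\<^esub> = \<zero>\<^bsub>B\<^esub>"
  using hom_smult[of "\<zero>\<^bsub>R\<^esub>" "\<zero>\<^bsub>A\<^esub>"] hom_closed[of "\<zero>\<^bsub>A\<^esub>"] by simp

lemma hom_neg: "v \<in> carrier A \<Longrightarrow> f (\<ominus>\<^bsub>A\<^esub> v) = \<ominus>\<^bsub>B\<^esub> f v"
  using hom_add[of "\<ominus>\<^bsub>A\<^esub> v" v] hom_zero hom_closed by (intro B.M.minus_equality[symmetric]) (simp_all add: A.M.l_neg)

lemma hom_diff: "\<lbrakk>v \<in> carrier A; w \<in> carrier A\<rbrakk> \<Longrightarrow> f (v \<ominus>\<^bsub>A\<^esub> w) = f v \<ominus>\<^bsub>B\<^esub> f w"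
  by (simp add: a_minus_def hom_add hom_neg)

lemma submodule_vimage:
  assumes "submodule N R B"
  shows "submodule {v \<in> carrier A. f v \<in> N} R A"
  by (rule A.submoduleI)
    (use submodule_zero[OF assms] submodule_add[OF assms] submodule_smult[OF assms] in
      \<open>auto simp: hom_zero hom_add hom_smult A.smult_closed\<close>)

lemma submodule_image:
  assumes "submodule N R A"
  shows "submodule (f ` N) R B"
proof (rule B.submoduleI)
  note sub = subsetD[OF submodule_subset[OF assms]]
  show "f ` N \<subseteq> carrier B" using sub hom_closed by blast
  show "\<zero>\<^bsub>B\<^esub> \<in> f ` N" using hom_zero submodule_zero[OF assms] by (metis imageI)
  fix v w assume "v \<in> f ` N" "w \<in> f ` N"
  then obtain v' w' where "v' \<in> N" "w' \<in> N" "v = f v'" "w = f w'" by blast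
  then show "v \<oplus>\<^bsub>B\<^esub> w \<in> f ` N" using submodule_add[OF assms, of v' w'] hom_add sub by (metis imageI)
next
  note sub = subsetD[OF submodule_subset[OF assms]]
  fix r v assume "r \<in> carrier R" "v \<in> f ` N"
  then obtain v' where "v' \<in> N" "v = f v'" by blast
  then show "r \<odot>\<^bsub>B\<^esub> v \<in> f ` N"
    using submodule_smult[OF assms \<open>r \<in> carrier R\<close>, of v'] hom_smult \<open>r \<in> carrier R\<close> sub by (metis imageI)
qed

text \<open>
  The image of a submodule strictly above the preimage of \<open>F\<close> generates, together with \<open>F\<close>, something
  strictly above \<open>F\<close>, that is, all of \<open>K\<close>; so the submodule contains everything up to the kernel modulo \<open>F\<close>.
\<close>

lemma maximal_vimage:
  assumes cov: "B.covers F K" and F: "submodule F R B"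
    and image: "f ` carrier A \<subseteq> K" "\<not> f ` carrier A \<subseteq> F"
  shows "maximal_submodule {v \<in> carrier A. f v \<in> F} R A"
  unfolding maximal_submodule_def
proof (intro conjI allI impI submodule_vimage F)
  let ?P = "{v \<in> carrier A. f v \<in> F}"
  show "?P \<noteq> carrier A" using image(2) by blast
  fix L assume L: "submodule L R A" "?P \<subseteq> L"
  have fL: "submodule (f ` L) R B" by (rule submodule_image[OF L(1)])
  note sum = B.submodule_set_add[OF fL F] B.set_add_upper[OF fL F]
  have K: "submodule K R B" "F \<subseteq> K" using cov by (auto simp: B.covers_def)
  have "f ` L \<subseteq> K" using image(1) submodule_subset[OF L(1)] by blast
  then have "f ` L <+>\<^bsub>B\<^esub> F = F \<or> f ` L <+>\<^bsub>B\<^esub> F = K"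
    by (intro B.coversD[OF cov sum(1) sum(3)] B.set_add_least[OF K(1) _ K(2)])
  then show "L = ?P \<or> L = carrier A"
  proof
    assume "f ` L <+>\<^bsub>B\<^esub> F = F"
    then have "L \<subseteq> ?P" using sum(2) submodule_subset[OF L(1)] by blast
    then show ?thesis using L(2) by blast
  next
    assume eq: "f ` L <+>\<^bsub>B\<^esub> F = K"
    have "carrier A \<subseteq> L"
    proof
      fix v assume v: "v \<in> carrier A"
      then have "f v \<in> f ` L <+>\<^bsub>B\<^esub> F" using image(1) eq by blast
      then obtain l k where l: "l \<in> L" "k \<in> F" "f v = f l \<oplus>\<^bsub>B\<^esub> k" by (auto simp: set_add_def')
      have lA: "l \<in> carrier A" and kB: "k \<in> carrier B"
        using l submodule_subset[OF L(1)] submodule_subset[OF F] by auto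
      have "f (v \<ominus>\<^bsub>A\<^esub> l) = (k \<oplus>\<^bsub>B\<^esub> f l) \<ominus>\<^bsub>B\<^esub> f l"
        using v lA kB l(3) hom_closed[OF lA] by (simp add: hom_diff B.M.a_comm)
      also have "\<dots> = k" using kB hom_closed[OF lA] by (simp add: a_minus_def B.M.a_assoc B.M.r_neg)
      finally have "v \<ominus>\<^bsub>A\<^esub> l \<in> L" using L(2) l(2) v lA by auto
      then have "(v \<ominus>\<^bsub>A\<^esub> l) \<oplus>\<^bsub>A\<^esub> l \<in> L" using l(1) submodule_add[OF L(1)] by blast
      then show "v \<in> L" using v lA by (simp add: a_minus_def A.M.a_assoc A.M.l_neg)
    qed
    then show ?thesis using submodule_subset[OF L(1)] by blast
  qed
qed

end

text \<open>
  The maps \<open>f i\<close> induce \<open>\<Oplus>\<^sub>i A i / N i \<rightarrow> P / F\<close>, which is onto by \<open>spanning\<close> and injective by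
  \<open>independent\<close>. The isomorphism is its inverse: a coset is sent to the components of any family whose
  sum represents it.
\<close>

lemma (in left_module) module_iso_direct_sum:
  fixes A :: "'i \<Rightarrow> ('r, 'n, 'c) module_scheme"
  assumes fin: "finite \<Lambda>"
    and hom: "\<And>i. i \<in> \<Lambda> \<Longrightarrow> left_module_hom R (A i) M (f i)"
    and F: "submodule F R M" and P: "submodule P R M" and FP: "F \<subseteq> P"
    and image: "\<And>i. i \<in> \<Lambda> \<Longrightarrow> f i ` carrier (A i) \<subseteq> P"
    and kernel: "\<And>i. i \<in> \<Lambda> \<Longrightarrow> N i = {v \<in> carrier (A i). f i v \<in> F}"
    and spanning: "\<And>L. \<lbrakk>submodule L R M; F \<subseteq> L; \<And>i. i \<in> \<Lambda> \<Longrightarrow> f i ` carrier (A i) \<subseteq> L\<rbrakk> \<Longrightarrow> P \<subseteq> L"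
    and independent: "\<And>z i. \<lbrakk>\<And>i. i \<in> \<Lambda> \<Longrightarrow> z i \<in> carrier (A i); (\<Oplus>i\<in>\<Lambda>. f i (z i)) \<in> F; i \<in> \<Lambda>\<rbrakk> \<Longrightarrow> f i (z i) \<in> F"
  shows "module_iso R (M\<lparr>carrier := P\<rparr> Modulo F) (direct_sum \<Lambda> (\<lambda>i. A i Modulo N i))"
proof -
  let ?S = "\<lambda>z. \<Oplus>i\<in>\<Lambda>. f i (z i)"
  let ?Z = "{z. \<forall>i\<in>\<Lambda>. z i \<in> carrier (A i)}"
  have mod: "left_module R (A i)" if "i \<in> \<Lambda>" for i
    using hom[OF that] by (simp add: left_module_hom_def)
  have sub: "submodule (N i) R (A i)" if "i \<in> \<Lambda>" for i
    unfolding kernel[OF that] by (rule left_module_hom.submodule_vimage[OF hom[OF that] F])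
  interpret P: left_module R "M\<lparr>carrier := P\<rparr>" by (rule left_module_restrict[OF P])
  have FP': "submodule F R (M\<lparr>carrier := P\<rparr>)" using F FP submodule_restrict[OF P] by simp
  interpret Q: left_module R "M\<lparr>carrier := P\<rparr> Modulo F" by (rule P.left_module_quot[OF FP'])
  have A_closed: "v \<oplus>\<^bsub>A i\<^esub> w \<in> carrier (A i)" "v \<ominus>\<^bsub>A i\<^esub> w \<in> carrier (A i)"
    "r \<in> carrier R \<Longrightarrow> r \<odot>\<^bsub>A i\<^esub> v \<in> carrier (A i)"
    if "i \<in> \<Lambda>" "v \<in> carrier (A i)" "w \<in> carrier (A i)" for i v w r
  proof -
    interpret Ai: left_module R "A i" by (rule mod[OF that(1)])
    show "v \<oplus>\<^bsub>A i\<^esub> w \<in> carrier (A i)" "v \<ominus>\<^bsub>A i\<^esub> w \<in> carrier (A i)"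
      "r \<in> carrier R \<Longrightarrow> r \<odot>\<^bsub>A i\<^esub> v \<in> carrier (A i)"
      using that(2,3) by (simp_all add: Ai.smult_closed)
  qed
  have closed: "f i v \<in> P" "f i v \<in> carrier M" if "i \<in> \<Lambda>" "v \<in> carrier (A i)" for i v
    using image[OF that(1)] that(2) submodule_subset[OF P] by blast+
  have S_M: "?S z \<in> carrier M" if "z \<in> ?Z" for z
    using that closed by (intro M.finsum_closed) auto
  have S_in: "?S z \<in> L" if L: "submodule L R M" "\<And>i. i \<in> \<Lambda> \<Longrightarrow> f i (z i) \<in> L" for z L
  proof -
    have "(\<Oplus>i\<in>\<Lambda>'. f i (z i)) \<in> L" if "\<Lambda>' \<subseteq> \<Lambda>" for \<Lambda>'
      using finite_subset[OF that fin] that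
    proof (induction rule: finite_induct)
      case (insert i \<Lambda>')
      then show ?case
        using L submodule_subset[OF L(1)] by (subst M.finsum_insert) (auto intro!: submodule_add[OF L(1)])
    qed (simp add: submodule_zero[OF L(1)])
    then show ?thesis by blast
  qed
  have S_P: "?S z \<in> P" if "z \<in> ?Z" for z
    by (rule S_in[OF P]) (use that closed in blast)
  have S_add: "?S (\<lambda>i. z i \<oplus>\<^bsub>A i\<^esub> w i) = ?S z \<oplus> ?S w" if "z \<in> ?Z" "w \<in> ?Z" for z w
  proof -
    have "?S (\<lambda>i. z i \<oplus>\<^bsub>A i\<^esub> w i) = (\<Oplus>i\<in>\<Lambda>. f i (z i) \<oplus> f i (w i))"
      using that closed by (intro M.finsum_cong') (auto simp: left_module_hom.hom_add[OF hom])
    then show ?thesis using that closed by (simp add: M.finsum_addf Pi_iff)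
  qed
  have S_smult: "?S (\<lambda>i. r \<odot>\<^bsub>A i\<^esub> z i) = r \<odot> ?S z" if "r \<in> carrier R" "z \<in> ?Z" for r z
  proof -
    have "(\<Oplus>i\<in>\<Lambda>'. f i (r \<odot>\<^bsub>A i\<^esub> z i)) = r \<odot> (\<Oplus>i\<in>\<Lambda>'. f i (z i))" if "\<Lambda>' \<subseteq> \<Lambda>" for \<Lambda>'
      using finite_subset[OF that fin] that
    proof (induction rule: finite_induct)
      case (insert i \<Lambda>')
      have *: "f j (r \<odot>\<^bsub>A j\<^esub> z j) = r \<odot> f j (z j)" "f j (z j) \<in> carrier M" if "j \<in> \<Lambda>" for j
        using that \<open>r \<in> carrier R\<close> \<open>z \<in> ?Z\<close> closed by (auto simp: left_module_hom.hom_smult[OF hom])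
      have "(\<Oplus>j\<in>\<Lambda>'. f j (z j)) \<in> carrier M" using insert.prems * by (intro M.finsum_closed) auto
      then show ?case
        using insert * \<open>r \<in> carrier R\<close>
        by (simp add: M.finsum_insert Pi_iff subset_iff smult_closed smult_r_distr)
    qed (simp add: \<open>r \<in> carrier R\<close>)
    then show ?thesis by blast
  qed
  have S_diff: "?S (\<lambda>i. z i \<ominus>\<^bsub>A i\<^esub> w i) = ?S z \<ominus> ?S w" if zw: "z \<in> ?Z" "w \<in> ?Z" for z w
  proof -
    let ?d = "\<lambda>i. z i \<ominus>\<^bsub>A i\<^esub> w i"
    have A: "abelian_group (A i)" if "i \<in> \<Lambda>" for i using mod[OF that] by (simp add: left_module_def)
    have d: "?d \<in> ?Z" using zw A_closed(2) by blast
    have zi: "?d i \<oplus>\<^bsub>A i\<^esub> w i = z i" if "i \<in> \<Lambda>" for i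
    proof -
      interpret Ai: abelian_group "A i" by (rule A[OF that])
      show ?thesis using zw that by (simp add: a_minus_def Ai.a_assoc Ai.l_neg)
    qed
    have "?S z = ?S (\<lambda>i. ?d i \<oplus>\<^bsub>A i\<^esub> w i)"
      using zw zi closed by (intro M.finsum_cong') auto
    also have "\<dots> = ?S ?d \<oplus> ?S w" by (rule S_add[OF d zw(2)])
    finally show ?thesis using S_M[OF d] S_M[OF zw(2)] by (simp add: a_minus_def M.a_assoc M.r_neg)
  qed
  have coset: "F +>\<^bsub>M\<lparr>carrier := P\<rparr>\<^esub> v = F +> v" for v
    by (simp add: a_r_coset_def r_coset_def)
  have carr: "carrier (M\<lparr>carrier := P\<rparr> Modulo F) = (\<lambda>v. F +> v) ` P"
    unfolding P.carrier_quot coset by simp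
  have S_eq_iff: "F +> ?S z = F +> ?S w \<longleftrightarrow> (\<forall>i\<in>\<Lambda>. N i +>\<^bsub>A i\<^esub> z i = N i +>\<^bsub>A i\<^esub> w i)"
    if zw: "z \<in> ?Z" "w \<in> ?Z" for z w
  proof -
    let ?d = "\<lambda>i. z i \<ominus>\<^bsub>A i\<^esub> w i"
    have d: "?d i \<in> carrier (A i)" if "i \<in> \<Lambda>" for i
      using zw that A_closed(2) by blast
    have "F +> ?S z = F +> ?S w \<longleftrightarrow> ?S ?d \<in> F"
      using coset_eq_iff[OF F S_M[OF zw(1)] S_M[OF zw(2)]] S_diff[OF zw] by simp
    also have "\<dots> \<longleftrightarrow> (\<forall>i\<in>\<Lambda>. f i (?d i) \<in> F)"
      using independent[of ?d] d S_in[OF F, of ?d] by blast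
    also have "\<dots> \<longleftrightarrow> (\<forall>i\<in>\<Lambda>. ?d i \<in> N i)" using d kernel by auto
    also have "\<dots> \<longleftrightarrow> (\<forall>i\<in>\<Lambda>. N i +>\<^bsub>A i\<^esub> z i = N i +>\<^bsub>A i\<^esub> w i)"
      using left_module.coset_eq_iff[OF mod sub] zw by auto
    finally show ?thesis .
  qed
  have ex: "\<exists>z\<in>?Z. F +> v = F +> ?S z" if v: "v \<in> P" for v
  proof -
    have zeroZ: "(\<lambda>i. \<zero>\<^bsub>A i\<^esub>) \<in> ?Z"
      using mod by (auto simp: left_module_def intro: abelian_monoid.zero_closed abelian_group.axioms(1))
    let ?L = "{v \<in> carrier M. \<exists>z\<in>?Z. F +> v = F +> ?S z}"
    have L_I: "v \<in> ?L" if "v \<in> carrier M" "z \<in> ?Z" "F +> v = F +> ?S z" for v z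
      using that by blast
    have "submodule ?L R M"
    proof (rule submoduleI)
      have "?S (\<lambda>i. \<zero>\<^bsub>A i\<^esub>) = \<zero>"
        by (intro M.add.finprod_one_eqI) (simp add: left_module_hom.hom_zero[OF hom])
      then show "\<zero> \<in> ?L" using zeroZ by force
    next
      fix v w assume "v \<in> ?L" "w \<in> ?L"
      then obtain z z' where *: "v \<in> carrier M" "w \<in> carrier M" "z \<in> ?Z" "z' \<in> ?Z"
        "F +> v = F +> ?S z" "F +> w = F +> ?S z'" by blast
      have "F +> (v \<oplus> w) = F +> (?S z \<oplus> ?S z')"
        using coset_add[OF F *(1,2)] coset_add[OF F S_M[OF *(3)] S_M[OF *(4)]] *(5,6) by metis
      then have eq: "F +> (v \<oplus> w) = F +> ?S (\<lambda>i. z i \<oplus>\<^bsub>A i\<^esub> z' i)"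
        unfolding S_add[OF *(3,4)] .
      have mem: "(\<lambda>i. z i \<oplus>\<^bsub>A i\<^esub> z' i) \<in> ?Z"
        using * A_closed by blast
      show "v \<oplus> w \<in> ?L" by (rule L_I[OF _ mem eq]) (intro M.a_closed *(1,2))
    next
      fix r v assume r: "r \<in> carrier R" "v \<in> ?L"
      then obtain z where *: "v \<in> carrier M" "z \<in> ?Z" "F +> v = F +> ?S z" by blast
      have "F +> (r \<odot> v) = F +> (r \<odot> ?S z)"
        using coset_smult[OF F *(1) r(1)] coset_smult[OF F S_M[OF *(2)] r(1)] *(3) by metis
      then have eq: "F +> (r \<odot> v) = F +> ?S (\<lambda>i. r \<odot>\<^bsub>A i\<^esub> z i)"
        unfolding S_smult[OF r(1) *(2)] .
      have mem: "(\<lambda>i. r \<odot>\<^bsub>A i\<^esub> z i) \<in> ?Z"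
        using * A_closed(3) r(1) by blast
      show "r \<odot> v \<in> ?L" by (rule L_I[OF _ mem eq]) (intro smult_closed r(1) *(1))
    qed auto
    moreover have "F \<subseteq> ?L"
    proof
      fix v assume v: "v \<in> F"
      have "?S (\<lambda>i. \<zero>\<^bsub>A i\<^esub>) = \<zero>"
        by (intro M.add.finprod_one_eqI) (simp add: left_module_hom.hom_zero[OF hom])
      then have "F +> v = F +> ?S (\<lambda>i. \<zero>\<^bsub>A i\<^esub>)"
        using v coset_eq_self_iff[OF F] submodule_subset[OF F] submodule_zero[OF F] by auto
      from L_I[OF _ zeroZ this] show "v \<in> ?L" using v submodule_subset[OF F] by blast
    qed
    moreover have "f i ` carrier (A i) \<subseteq> ?L" if i: "i \<in> \<Lambda>" for i
    proof
      fix v assume "v \<in> f i ` carrier (A i)"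
      then obtain w where w: "w \<in> carrier (A i)" "v = f i w" by blast
      let ?z = "\<lambda>j. if j = i then w else \<zero>\<^bsub>A j\<^esub>"
      have "?S ?z = (\<Oplus>j\<in>\<Lambda>. if i = j then f j w else \<zero>\<^bsub>M\<^esub>)"
        using closed w i by (intro M.finsum_cong') (auto simp: left_module_hom.hom_zero[OF hom])
      also have "\<dots> = (\<Oplus>j\<in>\<Lambda>. if i = j then f i w else \<zero>\<^bsub>M\<^esub>)"
        using closed w i by (intro M.finsum_cong') auto
      also have "\<dots> = f i w" using M.finsum_singleton[OF i fin, of "\<lambda>_. f i w"] closed[OF i w(1)] by auto
      finally have eq: "F +> v = F +> ?S ?z" using w by simp
      have "?z \<in> ?Z" using zeroZ w by auto
      from L_I[OF _ this eq] show "v \<in> ?L" using closed(2)[OF i w(1)] unfolding w(2) by blast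
    qed
    ultimately have "P \<subseteq> ?L" by (rule spanning)
    then show ?thesis using v by blast
  qed
  define rep where "rep A' = (SOME z. z \<in> ?Z \<and> A' = F +> ?S z)" for A'
  define \<phi> where "\<phi> A' = (\<lambda>i\<in>\<Lambda>. N i +>\<^bsub>A i\<^esub> rep A' i)" for A'
  have rep: "rep A' \<in> ?Z" "F +> ?S (rep A') = A'" if "A' \<in> (\<lambda>v. F +> v) ` P" for A'
  proof -
    have "\<exists>z. z \<in> ?Z \<and> A' = F +> ?S z" using that ex by blast
    from someI_ex[OF this] show "rep A' \<in> ?Z" "F +> ?S (rep A') = A'" unfolding rep_def by blast+
  qed
  have \<phi>_S: "\<phi> (F +> ?S z) = (\<lambda>i\<in>\<Lambda>. N i +>\<^bsub>A i\<^esub> z i)" if "z \<in> ?Z" for z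
  proof -
    have "F +> ?S z \<in> (\<lambda>v. F +> v) ` P" using S_P[OF that] by blast
    from rep[OF this] show ?thesis using S_eq_iff[OF _ that] by (auto simp: \<phi>_def fun_eq_iff)
  qed
  have cosets: "B \<in> (\<lambda>v. F +> v) ` P \<longleftrightarrow> (\<exists>z\<in>?Z. B = F +> ?S z)" for B
    using ex S_P by blast
  have DS: "carrier (direct_sum \<Lambda> (\<lambda>i. A i Modulo N i)) = (\<Pi>\<^sub>E i\<in>\<Lambda>. (\<lambda>v. N i +>\<^bsub>A i\<^esub> v) ` carrier (A i))"
  proof -
    have "carrier (A i Modulo N i) = (\<lambda>v. N i +>\<^bsub>A i\<^esub> v) ` carrier (A i)" if "i \<in> \<Lambda>" for i
      using left_module.carrier_quot[OF mod[OF that]] .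
    then show ?thesis using fin by (simp add: direct_sum_def cong: PiE_cong)
  qed
  show ?thesis
    unfolding module_iso_def carr
  proof (intro exI[of _ \<phi>] conjI ballI)
    show "bij_betw \<phi> ((\<lambda>v. F +> v) ` P) (carrier (direct_sum \<Lambda> (\<lambda>i. A i Modulo N i)))"
      unfolding bij_betw_def
    proof
      show "inj_on \<phi> ((\<lambda>v. F +> v) ` P)"
      proof (rule inj_onI)
        fix B C assume BC: "B \<in> (\<lambda>v. F +> v) ` P" "C \<in> (\<lambda>v. F +> v) ` P" "\<phi> B = \<phi> C"
        have "N i +>\<^bsub>A i\<^esub> rep B i = N i +>\<^bsub>A i\<^esub> rep C i" if "i \<in> \<Lambda>" for i
          using fun_cong[OF BC(3), of i] that by (simp add: \<phi>_def)
        then show "B = C" using S_eq_iff[OF rep(1)[OF BC(1)] rep(1)[OF BC(2)]] rep(2)[OF BC(1)] rep(2)[OF BC(2)] by simp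
      qed
      show "\<phi> ` ((\<lambda>v. F +> v) ` P) = carrier (direct_sum \<Lambda> (\<lambda>i. A i Modulo N i))"
        unfolding DS
      proof
        show "\<phi> ` ((\<lambda>v. F +> v) ` P) \<subseteq> (\<Pi>\<^sub>E i\<in>\<Lambda>. (\<lambda>v. N i +>\<^bsub>A i\<^esub> v) ` carrier (A i))"
          using rep(1) by (auto simp: \<phi>_def simp del: image_iff intro!: imageI)
        show "(\<Pi>\<^sub>E i\<in>\<Lambda>. (\<lambda>v. N i +>\<^bsub>A i\<^esub> v) ` carrier (A i)) \<subseteq> \<phi> ` ((\<lambda>v. F +> v) ` P)"
        proof
          fix g assume g: "g \<in> (\<Pi>\<^sub>E i\<in>\<Lambda>. (\<lambda>v. N i +>\<^bsub>A i\<^esub> v) ` carrier (A i))"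
          then have "\<forall>i\<in>\<Lambda>. \<exists>v. v \<in> carrier (A i) \<and> g i = N i +>\<^bsub>A i\<^esub> v" by (auto simp: PiE_iff)
          then obtain z where z: "\<forall>i\<in>\<Lambda>. z i \<in> carrier (A i) \<and> g i = N i +>\<^bsub>A i\<^esub> z i" by (metis (no_types, lifting))
          then have zZ: "z \<in> ?Z" by blast
          have "g = (\<lambda>i\<in>\<Lambda>. N i +>\<^bsub>A i\<^esub> z i)"
            using g z by (auto simp: PiE_iff extensional_def fun_eq_iff)
          then have "g = \<phi> (F +> ?S z)" using \<phi>_S[OF zZ] by simp
          then show "g \<in> \<phi> ` ((\<lambda>v. F +> v) ` P)" using S_P[OF zZ] by blast
        qed
      qed
    qed
  next
    fix B C assume "B \<in> (\<lambda>v. F +> v) ` P" "C \<in> (\<lambda>v. F +> v) ` P"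
    then obtain z w where *: "z \<in> ?Z" "w \<in> ?Z" "B = F +> ?S z" "C = F +> ?S w"
      unfolding cosets by blast
    have zw: "(\<lambda>i. z i \<oplus>\<^bsub>A i\<^esub> w i) \<in> ?Z"
      using * A_closed by blast
    have "B \<oplus>\<^bsub>M\<lparr>carrier := P\<rparr> Modulo F\<^esub> C = F +> ?S (\<lambda>i. z i \<oplus>\<^bsub>A i\<^esub> w i)"
      using P.add_quot[OF FP', of "?S z" "?S w"] S_P[OF *(1)] S_P[OF *(2)] S_add[OF *(1,2)] *(3,4)
      unfolding coset by simp
    then have "\<phi> (B \<oplus>\<^bsub>M\<lparr>carrier := P\<rparr> Modulo F\<^esub> C) = (\<lambda>i\<in>\<Lambda>. N i +>\<^bsub>A i\<^esub> (z i \<oplus>\<^bsub>A i\<^esub> w i))"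
      using \<phi>_S[OF zw] by simp
    also have "\<dots> = \<phi> B \<oplus>\<^bsub>direct_sum \<Lambda> (\<lambda>i. A i Modulo N i)\<^esub> \<phi> C"
      unfolding *(3,4) \<phi>_S[OF *(1)] \<phi>_S[OF *(2)]
      using *(1,2) left_module.add_quot[OF mod sub]
      by (auto simp: direct_sum_def fun_eq_iff)
    finally show "\<phi> (B \<oplus>\<^bsub>M\<lparr>carrier := P\<rparr> Modulo F\<^esub> C) = \<phi> B \<oplus>\<^bsub>direct_sum \<Lambda> (\<lambda>i. A i Modulo N i)\<^esub> \<phi> C" .
  next
    fix r B assume r: "r \<in> carrier R" and "B \<in> (\<lambda>v. F +> v) ` P"
    then obtain z where *: "z \<in> ?Z" "B = F +> ?S z" unfolding cosets by blast
    have rz: "(\<lambda>i. r \<odot>\<^bsub>A i\<^esub> z i) \<in> ?Z"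
      using * A_closed(3) r by blast
    have "r \<odot>\<^bsub>M\<lparr>carrier := P\<rparr> Modulo F\<^esub> B = F +> ?S (\<lambda>i. r \<odot>\<^bsub>A i\<^esub> z i)"
      using P.smult_quot[OF FP' _ r, of "?S z"] S_P[OF *(1)] S_smult[OF r *(1)] *(2)
      unfolding coset by simp
    then have "\<phi> (r \<odot>\<^bsub>M\<lparr>carrier := P\<rparr> Modulo F\<^esub> B) = (\<lambda>i\<in>\<Lambda>. N i +>\<^bsub>A i\<^esub> (r \<odot>\<^bsub>A i\<^esub> z i))"
      using \<phi>_S[OF rz] by simp
    also have "\<dots> = r \<odot>\<^bsub>direct_sum \<Lambda> (\<lambda>i. A i Modulo N i)\<^esub> \<phi> B"
      unfolding *(2) \<phi>_S[OF *(1)] using *(1) r left_module.smult_quot[OF mod sub]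
      by (auto simp: direct_sum_def fun_eq_iff)
    finally show "\<phi> (r \<odot>\<^bsub>M\<lparr>carrier := P\<rparr> Modulo F\<^esub> B) = r \<odot>\<^bsub>direct_sum \<Lambda> (\<lambda>i. A i Modulo N i)\<^esub> \<phi> B" .
  qed
qed


section \<open>Induced modules\<close>

text \<open>
  The free abelian group on pairs is not an \<open>R\<close>-module, since its action is not additive in the scalar.
  It becomes one only after dividing by the tensor relations, so the quotient is treated here as a
  quotient of abelian groups.
\<close>

locale induced = R?: ring R + V?: abelian_group V
  for R :: "('r, 'a) ring_scheme" (structure) and Y :: "'r set"
    and V :: "('r, 'v, 'b) module_scheme" (structure) +
  assumes Y_subset: "Y \<subseteq> carrier R"
    and act_closed: "\<lbrakk>y \<in> Y; v \<in> carrier V\<rbrakk> \<Longrightarrow> y \<odot>\<^bsub>V\<^esub> v \<in> carrier V"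
begin

abbreviation "P \<equiv> free_pairs R V"
abbreviation "T \<equiv> tensor_kernel R Y V"
abbreviation "lact r \<equiv> frag_extend (\<lambda>(s, v). frag_of (r \<otimes>\<^bsub>R\<^esub> s, v))"

lemma free_pairs_simps [simp]:
  "\<zero>\<^bsub>P\<^esub> = 0" "c \<oplus>\<^bsub>P\<^esub> d = c + d" "r \<odot>\<^bsub>P\<^esub> c = lact r c"
  "c \<in> carrier P \<longleftrightarrow> Poly_Mapping.keys c \<subseteq> carrier R \<times> carrier V"
  by (simp_all add: free_pairs_def)

sublocale P: abelian_group P
proof (rule abelian_groupI)
  fix c assume "c \<in> carrier P"
  then show "\<exists>d\<in>carrier P. d \<oplus>\<^bsub>P\<^esub> c = \<zero>\<^bsub>P\<^esub>"
    by (intro bexI[of _ "- c"]) auto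
qed (auto simp: add.assoc add.commute dest: subsetD[OF keys_add])

lemma P_neg: "c \<in> carrier P \<Longrightarrow> \<ominus>\<^bsub>P\<^esub> c = - c"
  by (rule P.minus_equality) auto

lemma P_diff: "\<lbrakk>c \<in> carrier P; d \<in> carrier P\<rbrakk> \<Longrightarrow> c \<ominus>\<^bsub>P\<^esub> d = c - d"
  unfolding a_minus_def by (simp add: P_neg del: free_pairs_simps(4))

lemma lact_closed: "\<lbrakk>r \<in> carrier R; c \<in> carrier P\<rbrakk> \<Longrightarrow> lact r c \<in> carrier P"
  using keys_frag_extend[of "\<lambda>(s, v). frag_of (r \<otimes>\<^bsub>R\<^esub> s, v)" c] by fastforce

lemma relations_closed: "tensor_relations R Y V \<subseteq> carrier P"
  using act_closed unfolding tensor_relations_def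
  by (auto simp: subsetD[OF Y_subset] dest!: subsetD[OF keys_diff])

lemma T_subgroup: "subgroup T (add_monoid P)"
  unfolding tensor_kernel_def using P.add.generate_is_subgroup relations_closed by simp

sublocale T: abelian_subgroup T P
  using T_subgroup by (intro abelian_subgroupI3 additive_subgroupI P.abelian_group_axioms)

lemma T_zero: "0 \<in> T" and T_add: "\<lbrakk>c \<in> T; d \<in> T\<rbrakk> \<Longrightarrow> c + d \<in> T" and T_closed: "c \<in> T \<Longrightarrow> c \<in> carrier P"
  and T_neg: "c \<in> T \<Longrightarrow> - c \<in> T"
proof -
  show "0 \<in> T" using T.zero_closed by simp
  show "\<lbrakk>c \<in> T; d \<in> T\<rbrakk> \<Longrightarrow> c + d \<in> T" using T.a_closed[of c d] by simp
  show *: "c \<in> T \<Longrightarrow> c \<in> carrier P" for c using T.a_subset by blast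
  show "c \<in> T \<Longrightarrow> - c \<in> T" using T.a_inv_closed[of c] P_neg[OF *[of c]] by simp
qed

lemma relation_T: "c \<in> tensor_relations R Y V \<Longrightarrow> c \<in> T"
  unfolding tensor_kernel_def by (rule generate.incl)

lemma T_induct [consumes 1, case_names zero relation neg add]:
  assumes "c \<in> T" "Q 0" "\<And>c. c \<in> tensor_relations R Y V \<Longrightarrow> Q c"
    "\<And>c. c \<in> tensor_relations R Y V \<Longrightarrow> Q (- c)"
    "\<And>c d. \<lbrakk>c \<in> T; d \<in> T; Q c; Q d\<rbrakk> \<Longrightarrow> Q (c + d)"
  shows "Q c"
proof -
  have "Q c" if "c \<in> generate (add_monoid P) (tensor_relations R Y V)"
    using that
  proof induction
    case (inv c)
    then have "inv\<^bsub>add_monoid P\<^esub> c = - c" using P_neg[of c] relations_closed unfolding a_inv_def by blast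
    then show ?case using assms(4)[OF inv] by simp
  qed (use assms in \<open>auto simp: tensor_kernel_def\<close>)
  then show ?thesis using assms(1) by (simp add: tensor_kernel_def)
qed

lemma tensor_relationsE:
  assumes "c \<in> tensor_relations R Y V"
  obtains s t v where "s \<in> carrier R" "t \<in> carrier R" "v \<in> carrier V"
      "c = frag_of (s \<oplus>\<^bsub>R\<^esub> t, v) - frag_of (s, v) - frag_of (t, v)"
    | s v w where "s \<in> carrier R" "v \<in> carrier V" "w \<in> carrier V"
      "c = frag_of (s, v \<oplus>\<^bsub>V\<^esub> w) - frag_of (s, v) - frag_of (s, w)"
    | s y v where "s \<in> carrier R" "y \<in> Y" "v \<in> carrier V"
      "c = frag_of (s \<otimes>\<^bsub>R\<^esub> y, v) - frag_of (s, y \<odot>\<^bsub>V\<^esub> v)"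
  using assms unfolding tensor_relations_def
  by (elim UnE CollectE exE conjE) (rule that; assumption)+

lemma lact_relation:
  assumes "r \<in> carrier R" "c \<in> tensor_relations R Y V"
  shows "lact r c \<in> tensor_relations R Y V"
proof -
  from assms(2) show ?thesis
  proof (cases rule: tensor_relationsE)
    case (1 s t v)
    then have "lact r c = frag_of (r \<otimes>\<^bsub>R\<^esub> s \<oplus>\<^bsub>R\<^esub> r \<otimes>\<^bsub>R\<^esub> t, v) - frag_of (r \<otimes>\<^bsub>R\<^esub> s, v) - frag_of (r \<otimes>\<^bsub>R\<^esub> t, v)"
      using assms(1) by (simp add: frag_extend_diff R.r_distr)
    moreover have "r \<otimes>\<^bsub>R\<^esub> s \<in> carrier R" "r \<otimes>\<^bsub>R\<^esub> t \<in> carrier R" using assms(1) 1 by simp_all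
    ultimately show ?thesis using 1(3) unfolding tensor_relations_def by blast
  next
    case (2 s v w)
    then have "lact r c = frag_of (r \<otimes>\<^bsub>R\<^esub> s, v \<oplus>\<^bsub>V\<^esub> w) - frag_of (r \<otimes>\<^bsub>R\<^esub> s, v) - frag_of (r \<otimes>\<^bsub>R\<^esub> s, w)"
      by (simp add: frag_extend_diff)
    moreover have "r \<otimes>\<^bsub>R\<^esub> s \<in> carrier R" using assms(1) 2 by simp
    ultimately show ?thesis using 2(2,3) unfolding tensor_relations_def by blast
  next
    case (3 s y v)
    then have "lact r c = frag_of ((r \<otimes>\<^bsub>R\<^esub> s) \<otimes>\<^bsub>R\<^esub> y, v) - frag_of (r \<otimes>\<^bsub>R\<^esub> s, y \<odot>\<^bsub>V\<^esub> v)"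
      using assms(1) Y_subset by (auto simp add: frag_extend_diff R.m_assoc)
    moreover have "r \<otimes>\<^bsub>R\<^esub> s \<in> carrier R" using assms(1) 3 by simp
    ultimately show ?thesis using 3(2,3) unfolding tensor_relations_def by blast
  qed
qed

lemma lact_T: "\<lbrakk>r \<in> carrier R; c \<in> T\<rbrakk> \<Longrightarrow> lact r c \<in> T"
  by (rotate_tac, induction rule: T_induct)
    (auto simp: T_zero frag_extend_add frag_extend_minus T_add intro: T_neg relation_T lact_relation)

lemma coset_eq: "\<lbrakk>c \<in> carrier P; d \<in> carrier P\<rbrakk> \<Longrightarrow> T +>\<^bsub>P\<^esub> c = T +>\<^bsub>P\<^esub> d \<longleftrightarrow> c - d \<in> T"
  using T.coset_diff_iff P_diff by metis

abbreviation "Z \<equiv> induced_module R Y V"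

lemma carrier_induced: "carrier Z = (\<lambda>c. T +>\<^bsub>P\<^esub> c) ` carrier P"
  unfolding induced_module_def quot_module_def A_RCOSETS_def' by auto

lemma zero_induced: "\<zero>\<^bsub>Z\<^esub> = T +>\<^bsub>P\<^esub> 0"
proof -
  have "T +>\<^bsub>P\<^esub> \<zero>\<^bsub>P\<^esub> = T" by (rule P.a_coset_add_zero) (rule T.a_subset)
  then show ?thesis by (simp add: induced_module_def quot_module_def)
qed

lemma add_induced: "\<lbrakk>c \<in> carrier P; d \<in> carrier P\<rbrakk> \<Longrightarrow>
    (T +>\<^bsub>P\<^esub> c) \<oplus>\<^bsub>Z\<^esub> (T +>\<^bsub>P\<^esub> d) = T +>\<^bsub>P\<^esub> (c + d)"
  using T.a_rcos_sum[of c d] by (simp add: induced_module_def quot_module_def)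

lemma smult_induced:
  assumes "r \<in> carrier R" "c \<in> carrier P"
  shows "r \<odot>\<^bsub>Z\<^esub> (T +>\<^bsub>P\<^esub> c) = T +>\<^bsub>P\<^esub> lact r c"
proof -
  have "T +>\<^bsub>P\<^esub> lact r d = T +>\<^bsub>P\<^esub> lact r c" if "d \<in> T +>\<^bsub>P\<^esub> c" for d
  proof -
    have d: "d \<in> carrier P" using T.a_elemrcos_carrier[OF assms(2) that] .
    have "T +>\<^bsub>P\<^esub> d = T +>\<^bsub>P\<^esub> c" using T.a_repr_independence'[OF that assms(2)] by simp
    then have "d - c \<in> T" using coset_eq[OF d assms(2)] by simp
    then have "lact r d - lact r c \<in> T" using lact_T[OF assms(1)] frag_extend_diff by metis
    then show ?thesis using coset_eq lact_closed[OF assms(1)] d assms(2) by metis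
  qed
  moreover have "c \<in> T +>\<^bsub>P\<^esub> c" using T.a_rcos_self[OF assms(2)] .
  ultimately have "(\<Union>d\<in>T +>\<^bsub>P\<^esub> c. T +>\<^bsub>P\<^esub> lact r d) = T +>\<^bsub>P\<^esub> lact r c" by blast
  moreover have "r \<odot>\<^bsub>Z\<^esub> A = (\<Union>d\<in>A. T +>\<^bsub>P\<^esub> lact r d)" for A
    by (simp add: induced_module_def quot_module_def)
  ultimately show ?thesis by simp
qed

lemma P_induct [consumes 1, case_names zero pair diff]:
  assumes "c \<in> carrier P" "Q 0" "\<And>r v. \<lbrakk>r \<in> carrier R; v \<in> carrier V\<rbrakk> \<Longrightarrow> Q (frag_of (r, v))"
    "\<And>c d. \<lbrakk>Q c; Q d\<rbrakk> \<Longrightarrow> Q (c - d)"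
  shows "Q c"
  using assms(1)[simplified] by (induction rule: frag_induction) (use assms in auto)

theorem left_module_induced: "left_module R Z"
proof -
  have "abelian_group Z"
  proof (rule abelian_groupI)
    fix A assume "A \<in> carrier Z"
    then obtain c where c: "c \<in> carrier P" "A = T +>\<^bsub>P\<^esub> c" unfolding carrier_induced by blast
    have neg: "- c \<in> carrier P" using c(1) by simp
    have "(T +>\<^bsub>P\<^esub> (- c)) \<oplus>\<^bsub>Z\<^esub> A = \<zero>\<^bsub>Z\<^esub>" unfolding c(2) add_induced[OF neg c(1)] zero_induced by simp
    then show "\<exists>B\<in>carrier Z. B \<oplus>\<^bsub>Z\<^esub> A = \<zero>\<^bsub>Z\<^esub>" using neg carrier_induced by blast
    show "\<zero>\<^bsub>Z\<^esub> \<oplus>\<^bsub>Z\<^esub> A = A"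
      unfolding zero_induced c(2) using add_induced[of 0 c] c(1) by simp
  next
    show "\<zero>\<^bsub>Z\<^esub> \<in> carrier Z" unfolding zero_induced carrier_induced by (intro imageI) simp
  next
    fix A B assume "A \<in> carrier Z" "B \<in> carrier Z"
    then obtain c d where c: "c \<in> carrier P" "A = T +>\<^bsub>P\<^esub> c" "d \<in> carrier P" "B = T +>\<^bsub>P\<^esub> d"
      unfolding carrier_induced by blast
    show "A \<oplus>\<^bsub>Z\<^esub> B = B \<oplus>\<^bsub>Z\<^esub> A"
      unfolding c add_induced[OF c(1,3)] add_induced[OF c(3,1)] by (simp add: add.commute)
    show "A \<oplus>\<^bsub>Z\<^esub> B \<in> carrier Z"
      unfolding c add_induced[OF c(1,3)] carrier_induced using P.a_closed[OF c(1,3)] by simp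
    fix C assume "C \<in> carrier Z"
    then obtain e where e: "e \<in> carrier P" "C = T +>\<^bsub>P\<^esub> e" unfolding carrier_induced by blast
    have "c + d \<in> carrier P" "d + e \<in> carrier P"
      using P.a_closed[OF c(1,3)] P.a_closed[OF c(3) e(1)] by simp_all
    then show "A \<oplus>\<^bsub>Z\<^esub> B \<oplus>\<^bsub>Z\<^esub> C = A \<oplus>\<^bsub>Z\<^esub> (B \<oplus>\<^bsub>Z\<^esub> C)"
      using c(1,3) e(1) unfolding c(2,4) e(2) by (simp add: add_induced add.assoc del: free_pairs_simps(4))
  qed
  moreover have "lact (r \<oplus>\<^bsub>R\<^esub> s) c - (lact r c + lact s c) \<in> T" if "r \<in> carrier R" "s \<in> carrier R" "c \<in> carrier P" for r s c
    using that(3)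
  proof (induction c rule: P_induct)
    case (pair t v)
    have "frag_of ((r \<otimes>\<^bsub>R\<^esub> t) \<oplus>\<^bsub>R\<^esub> (s \<otimes>\<^bsub>R\<^esub> t), v) - frag_of (r \<otimes>\<^bsub>R\<^esub> t, v) - frag_of (s \<otimes>\<^bsub>R\<^esub> t, v) \<in> tensor_relations R Y V"
      unfolding tensor_relations_def using pair that(1,2) R.m_closed by blast
    from relation_T[OF this] show ?case using pair that(1,2) by (simp add: R.l_distr algebra_simps)
  next
    case (diff c d)
    have "lact (r \<oplus>\<^bsub>R\<^esub> s) (c - d) - (lact r (c - d) + lact s (c - d)) =
      (lact (r \<oplus>\<^bsub>R\<^esub> s) c - (lact r c + lact s c)) + - (lact (r \<oplus>\<^bsub>R\<^esub> s) d - (lact r d + lact s d))"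
      by (simp add: frag_extend_diff)
    then show ?case using T_add[OF diff(1) T_neg[OF diff(2)]] by simp
  qed (simp add: T_zero)
  then have distr: "T +>\<^bsub>P\<^esub> lact (r \<oplus>\<^bsub>R\<^esub> s) c = T +>\<^bsub>P\<^esub> (lact r c + lact s c)"
    if "r \<in> carrier R" "s \<in> carrier R" "c \<in> carrier P" for r s c
    using coset_eq that lact_closed P.a_closed[of "lact r c" "lact s c"] by (metis R.add.m_closed free_pairs_simps(2))
  have assoc: "lact (r \<otimes>\<^bsub>R\<^esub> s) c = lact r (lact s c)" if "r \<in> carrier R" "s \<in> carrier R" "c \<in> carrier P" for r s c
    using that(3) by (induction c rule: P_induct) (use that in \<open>simp_all add: R.m_assoc frag_extend_diff\<close>)
  have one: "lact \<one>\<^bsub>R\<^esub> c = c" if "c \<in> carrier P" for c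
    using that by (induction c rule: P_induct) (simp_all add: frag_extend_diff)
  show ?thesis
  proof (intro left_module.intro left_module_axioms.intro R.ring_axioms \<open>abelian_group Z\<close>)
    fix r A assume r: "r \<in> carrier R" and "A \<in> carrier Z"
    then obtain c where c: "c \<in> carrier P" "A = T +>\<^bsub>P\<^esub> c" unfolding carrier_induced by blast
    show "r \<odot>\<^bsub>Z\<^esub> A \<in> carrier Z"
      unfolding c(2) smult_induced[OF r c(1)] carrier_induced using lact_closed[OF r c(1)] by simp
    {
      fix B assume "B \<in> carrier Z"
      then obtain d where d: "d \<in> carrier P" "B = T +>\<^bsub>P\<^esub> d" unfolding carrier_induced by blast
      have "c + d \<in> carrier P" using P.a_closed[OF c(1) d(1)] by simp
      then show "r \<odot>\<^bsub>Z\<^esub> (A \<oplus>\<^bsub>Z\<^esub> B) = r \<odot>\<^bsub>Z\<^esub> A \<oplus>\<^bsub>Z\<^esub> r \<odot>\<^bsub>Z\<^esub> B"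
        using c(1) d(1) r lact_closed unfolding c(2) d(2)
        by (simp add: add_induced smult_induced frag_extend_add del: free_pairs_simps(4))
    }
    fix s assume s: "s \<in> carrier R"
    show "(r \<oplus>\<^bsub>R\<^esub> s) \<odot>\<^bsub>Z\<^esub> A = r \<odot>\<^bsub>Z\<^esub> A \<oplus>\<^bsub>Z\<^esub> s \<odot>\<^bsub>Z\<^esub> A"
      using c(1) r s lact_closed distr unfolding c(2)
      by (simp add: add_induced smult_induced del: free_pairs_simps(4))
    show "(r \<otimes>\<^bsub>R\<^esub> s) \<odot>\<^bsub>Z\<^esub> A = r \<odot>\<^bsub>Z\<^esub> (s \<odot>\<^bsub>Z\<^esub> A)"
      using c(1) r s lact_closed assoc unfolding c(2)
      by (simp add: smult_induced del: free_pairs_simps(4))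
  next
    fix A assume "A \<in> carrier Z"
    then obtain c where c: "c \<in> carrier P" "A = T +>\<^bsub>P\<^esub> c" unfolding carrier_induced by blast
    show "\<one>\<^bsub>R\<^esub> \<odot>\<^bsub>Z\<^esub> A = A"
      unfolding c(2) smult_induced[OF R.one_closed c(1)] one[OF c(1)] ..
  qed
qed

abbreviation "pure \<equiv> pure_tensor R Y V"

lemma frag_of_closed: "\<lbrakk>r \<in> carrier R; v \<in> carrier V\<rbrakk> \<Longrightarrow> frag_of (r, v) \<in> carrier P"
  by simp

lemma pure_closed: "\<lbrakk>r \<in> carrier R; v \<in> carrier V\<rbrakk> \<Longrightarrow> pure r v \<in> carrier Z"
  unfolding pure_tensor_def carrier_induced by (intro imageI frag_of_closed)

lemma smult_pure: "\<lbrakk>s \<in> carrier R; r \<in> carrier R; v \<in> carrier V\<rbrakk> \<Longrightarrow> s \<odot>\<^bsub>Z\<^esub> pure r v = pure (s \<otimes>\<^bsub>R\<^esub> r) v"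
  unfolding pure_tensor_def by (simp add: smult_induced frag_of_closed del: free_pairs_simps(4))

lemma pure_balanced:
  assumes "r \<in> carrier R" "y \<in> Y" "v \<in> carrier V"
  shows "pure (r \<otimes>\<^bsub>R\<^esub> y) v = pure r (y \<odot>\<^bsub>V\<^esub> v)"
proof -
  have "frag_of (r \<otimes>\<^bsub>R\<^esub> y, v) - frag_of (r, y \<odot>\<^bsub>V\<^esub> v) \<in> tensor_relations R Y V"
    unfolding tensor_relations_def using assms by blast
  moreover have "r \<otimes>\<^bsub>R\<^esub> y \<in> carrier R" using assms(1,2) Y_subset by auto
  ultimately show ?thesis
    unfolding pure_tensor_def using assms act_closed coset_eq[OF frag_of_closed frag_of_closed] relation_T by blast
qed

lemma pure_zero:
  assumes "r \<in> carrier R"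
  shows "pure r \<zero>\<^bsub>V\<^esub> = \<zero>\<^bsub>Z\<^esub>"
proof -
  have "frag_of (r, \<zero>\<^bsub>V\<^esub> \<oplus>\<^bsub>V\<^esub> \<zero>\<^bsub>V\<^esub>) - frag_of (r, \<zero>\<^bsub>V\<^esub>) - frag_of (r, \<zero>\<^bsub>V\<^esub>) \<in> tensor_relations R Y V"
    unfolding tensor_relations_def using assms V.zero_closed by blast
  from T_neg[OF relation_T[OF this]] have "frag_of (r, \<zero>\<^bsub>V\<^esub>) - 0 \<in> T" by simp
  then show ?thesis
    unfolding pure_tensor_def zero_induced using coset_eq[of "frag_of (r, \<zero>\<^bsub>V\<^esub>)" 0] assms by simp
qed

lemma induced_induct [consumes 1, case_names zero pure diff]:
  assumes "z \<in> carrier Z" "Q \<zero>\<^bsub>Z\<^esub>" "\<And>r v. \<lbrakk>r \<in> carrier R; v \<in> carrier V\<rbrakk> \<Longrightarrow> Q (pure r v)"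
    "\<And>z w. \<lbrakk>z \<in> carrier Z; w \<in> carrier Z; Q z; Q w\<rbrakk> \<Longrightarrow> Q (z \<ominus>\<^bsub>Z\<^esub> w)"
  shows "Q z"
proof -
  interpret Z: left_module R Z by (rule left_module_induced)
  have "c \<in> carrier P \<and> Q (T +>\<^bsub>P\<^esub> c)" if "c \<in> carrier P" for c
    using that
  proof (induction c rule: P_induct)
    case zero
    then show ?case using assms(2) by (simp add: zero_induced)
  next
    case (pair r v)
    then show ?case using assms(3)[OF pair] by (simp add: pure_tensor_def)
  next
    case (diff c d)
    then have cd: "T +>\<^bsub>P\<^esub> c \<in> carrier Z" "T +>\<^bsub>P\<^esub> d \<in> carrier Z" "c \<in> carrier P" "d \<in> carrier P"
      by (auto simp: carrier_induced)
    have cd': "c - d \<in> carrier P" using P.minus_closed[OF cd(3,4)] P_diff[OF cd(3,4)] by simp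
    have "(T +>\<^bsub>P\<^esub> (c - d)) \<oplus>\<^bsub>Z\<^esub> (T +>\<^bsub>P\<^esub> d) = T +>\<^bsub>P\<^esub> c"
      using add_induced[OF cd' cd(4)] by simp
    moreover have "T +>\<^bsub>P\<^esub> (c - d) \<in> carrier Z" using cd' carrier_induced by blast
    ultimately have "T +>\<^bsub>P\<^esub> (c - d) = (T +>\<^bsub>P\<^esub> c) \<ominus>\<^bsub>Z\<^esub> (T +>\<^bsub>P\<^esub> d)"
      using cd(2) by (metis Z.M.add.inv_solve_right' Z.M.add.m_closed a_minus_def)
    then show ?case using assms(4)[OF cd(1,2)] diff cd' by simp
  qed
  then show ?thesis using assms(1) unfolding carrier_induced by blast
qed

text \<open>
  The universal property of free abelian groups extends \<open>(r, v) \<mapsto> r \<phi>(v)\<close> to a group homomorphism; it kills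
  the tensor relations and therefore factors through the induced module.
\<close>

theorem induced_universal:
  fixes M :: "('r, 'n, 'c) module_scheme"
  assumes M: "left_module R M"
    and \<phi>_closed: "\<And>v. v \<in> carrier V \<Longrightarrow> \<phi> v \<in> carrier M"
    and \<phi>_add: "\<And>v w. \<lbrakk>v \<in> carrier V; w \<in> carrier V\<rbrakk> \<Longrightarrow> \<phi> (v \<oplus>\<^bsub>V\<^esub> w) = \<phi> v \<oplus>\<^bsub>M\<^esub> \<phi> w"
    and \<phi>_act: "\<And>y v. \<lbrakk>y \<in> Y; v \<in> carrier V\<rbrakk> \<Longrightarrow> \<phi> (y \<odot>\<^bsub>V\<^esub> v) = y \<odot>\<^bsub>M\<^esub> \<phi> v"
  obtains \<Phi> where "left_module_hom R Z M \<Phi>"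
    "\<And>r v. \<lbrakk>r \<in> carrier R; v \<in> carrier V\<rbrakk> \<Longrightarrow> \<Phi> (pure r v) = r \<odot>\<^bsub>M\<^esub> \<phi> v"
proof -
  interpret M: left_module R M by (rule M)
  have "(\<lambda>(r, v). r \<odot>\<^bsub>M\<^esub> \<phi> v) ` (carrier R \<times> carrier V) \<subseteq> carrier (add_monoid M)"
    by (auto simp: M.smult_closed \<phi>_closed)
  then obtain h where h: "h \<in> hom (free_Abelian_group (carrier R \<times> carrier V)) (add_monoid M)"
    and h_pair: "\<And>p. p \<in> carrier R \<times> carrier V \<Longrightarrow> h (frag_of p) = (case p of (r, v) \<Rightarrow> r \<odot>\<^bsub>M\<^esub> \<phi> v)"
    by (rule comm_group.free_Abelian_group_universal[OF M.M.a_comm_group]) blast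
  have h_closed: "h c \<in> carrier M" if "c \<in> carrier P" for c
    using h that by (auto simp: hom_def free_Abelian_group_def)
  have h_add: "h (c + d) = h c \<oplus>\<^bsub>M\<^esub> h d" if "c \<in> carrier P" "d \<in> carrier P" for c d
    using h that by (auto simp: hom_def free_Abelian_group_def)
  have h_zero: "h 0 = \<zero>\<^bsub>M\<^esub>"
    using h_add[of 0 0] h_closed[of 0] by (simp add: M.M.add.r_cancel_one)
  have h_diff: "h (c - d) = h c \<ominus>\<^bsub>M\<^esub> h d" if cd: "c \<in> carrier P" "d \<in> carrier P" for c d
  proof -
    have cd': "c - d \<in> carrier P" using P.minus_closed[OF cd] P_diff[OF cd] by simp
    have "h (c - d) \<oplus>\<^bsub>M\<^esub> h d = h c" using h_add[OF cd' cd(2)] by simp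
    then show ?thesis using h_closed[OF cd'] h_closed[OF cd(2)]
      by (metis M.M.add.inv_solve_right' M.M.add.m_closed a_minus_def)
  qed
  have diff_zero: "h (c - d) = \<zero>\<^bsub>M\<^esub>" if "h c = h d" "c \<in> carrier P" "d \<in> carrier P" for c d
    using that h_diff h_closed by (simp add: a_minus_def M.M.r_neg)
  have h_relation: "h c = \<zero>\<^bsub>M\<^esub>" if rel: "c \<in> tensor_relations R Y V" for c
  proof -
    from rel show ?thesis
    proof (cases rule: tensor_relationsE)
      case (1 s t v)
      let ?c = "frag_of (s \<oplus>\<^bsub>R\<^esub> t, v)" and ?d = "frag_of (s, v) + frag_of (t, v)"
      have d: "?d \<in> carrier P" using P.a_closed[OF frag_of_closed[OF 1(1,3)] frag_of_closed[OF 1(2,3)]] by simp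
      have "h ?c = h ?d"
        using 1 h_add[OF frag_of_closed[OF 1(1,3)] frag_of_closed[OF 1(2,3)]]
        by (simp add: h_pair M.smult_l_distr \<phi>_closed)
      then have "h (?c - ?d) = \<zero>\<^bsub>M\<^esub>" using diff_zero[OF _ frag_of_closed d] 1 by simp
      moreover have "?c - ?d = c" using 1(4) by simp
      ultimately show ?thesis by simp
    next
      case (2 s v w)
      let ?c = "frag_of (s, v \<oplus>\<^bsub>V\<^esub> w)" and ?d = "frag_of (s, v) + frag_of (s, w)"
      have d: "?d \<in> carrier P" using P.a_closed[OF frag_of_closed[OF 2(1,2)] frag_of_closed[OF 2(1,3)]] by simp
      have "h ?c = h ?d"
        using 2 h_add[OF frag_of_closed[OF 2(1,2)] frag_of_closed[OF 2(1,3)]]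
        by (simp add: h_pair M.smult_r_distr \<phi>_closed \<phi>_add)
      then have "h (?c - ?d) = \<zero>\<^bsub>M\<^esub>" using diff_zero[OF _ frag_of_closed d] 2 by simp
      moreover have "?c - ?d = c" using 2(4) by simp
      ultimately show ?thesis by simp
    next
      case (3 s y v)
      have y: "y \<in> carrier R" using 3 Y_subset by blast
      have "h (frag_of (s \<otimes>\<^bsub>R\<^esub> y, v)) = h (frag_of (s, y \<odot>\<^bsub>V\<^esub> v))"
        using 3 y act_closed by (simp add: h_pair M.smult_assoc \<phi>_closed \<phi>_act)
      then show ?thesis unfolding 3(4) using diff_zero[OF _ frag_of_closed frag_of_closed] 3 y act_closed by simp
    qed
  qed
  have h_T: "h c = \<zero>\<^bsub>M\<^esub>" if "c \<in> T" for c
    using that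
  proof (induction c rule: T_induct)
    case (neg c)
    then have "c \<in> carrier P" using relations_closed by blast
    then show ?case using h_relation[OF neg] h_zero diff_zero[of 0 c] by simp
  next
    case (add c d)
    then show ?case using h_add[of c d] T_closed by simp
  qed (simp_all add: h_zero h_relation)
  have h_lact: "h (lact r c) = r \<odot>\<^bsub>M\<^esub> h c" if r: "r \<in> carrier R" and c: "c \<in> carrier P" for r c
  proof -
    have "c \<in> carrier P \<and> h (lact r c) = r \<odot>\<^bsub>M\<^esub> h c"
      using c
    proof (induction c rule: P_induct)
      case (diff c d)
      then have cd: "c \<in> carrier P" "d \<in> carrier P" by auto
      have "c - d \<in> carrier P" using P.minus_closed[OF cd] P_diff[OF cd] by simp
      moreover have "h (lact r (c - d)) = r \<odot>\<^bsub>M\<^esub> h (c - d)"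
        using diff h_diff[OF cd] h_diff[OF lact_closed[OF r cd(1)] lact_closed[OF r cd(2)]] h_closed[OF cd(1)] h_closed[OF cd(2)] r
        by (simp add: frag_extend_diff M.smult_diff)
      ultimately show ?case by blast
    qed (use r in \<open>simp_all add: h_zero h_pair M.smult_assoc \<phi>_closed\<close>)
    then show ?thesis by blast
  qed
  define \<Phi> where "\<Phi> A = h (SOME c. c \<in> carrier P \<and> T +>\<^bsub>P\<^esub> c = A)" for A
  have \<Phi>: "\<Phi> (T +>\<^bsub>P\<^esub> c) = h c" if c: "c \<in> carrier P" for c
  proof -
    let ?d = "SOME d. d \<in> carrier P \<and> T +>\<^bsub>P\<^esub> d = T +>\<^bsub>P\<^esub> c"
    have "?d \<in> carrier P \<and> T +>\<^bsub>P\<^esub> ?d = T +>\<^bsub>P\<^esub> c" by (rule someI[of _ c]) (use c in blast)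
    then have d: "?d \<in> carrier P" "?d - c \<in> T" using coset_eq c by blast+
    have "h ?d \<ominus>\<^bsub>M\<^esub> h c = \<zero>\<^bsub>M\<^esub>" using h_T[OF d(2)] h_diff[OF d(1) c] by simp
    then show ?thesis using M.M.diff_eq_zero_iff h_closed d(1) c unfolding \<Phi>_def by blast
  qed
  show thesis
  proof
    show "left_module_hom R Z M \<Phi>"
    proof (intro left_module_hom.intro left_module_hom_axioms.intro left_module_induced M)
      fix A assume "A \<in> carrier Z"
      then obtain c where c: "c \<in> carrier P" "A = T +>\<^bsub>P\<^esub> c" unfolding carrier_induced by blast
      then show "\<Phi> A \<in> carrier M" using \<Phi> h_closed by metis
      show "\<Phi> (r \<odot>\<^bsub>Z\<^esub> A) = r \<odot>\<^bsub>M\<^esub> \<Phi> A" if r: "r \<in> carrier R" for r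
        unfolding c(2) smult_induced[OF r c(1)] \<Phi>[OF c(1)] \<Phi>[OF lact_closed[OF r c(1)]] by (rule h_lact[OF r c(1)])
      fix B assume "B \<in> carrier Z"
      then obtain d where d: "d \<in> carrier P" "B = T +>\<^bsub>P\<^esub> d" unfolding carrier_induced by blast
      have "c + d \<in> carrier P" using P.a_closed[OF c(1) d(1)] by simp
      then show "\<Phi> (A \<oplus>\<^bsub>Z\<^esub> B) = \<Phi> A \<oplus>\<^bsub>M\<^esub> \<Phi> B"
        unfolding c(2) d(2) add_induced[OF c(1) d(1)] using \<Phi> c(1) d(1) h_add by metis
    qed
    show "\<Phi> (pure r v) = r \<odot>\<^bsub>M\<^esub> \<phi> v" if "r \<in> carrier R" "v \<in> carrier V" for r v
      unfolding pure_tensor_def \<Phi>[OF frag_of_closed[OF that]] using that by (simp add: h_pair)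
  qed
qed

end

section \<open>Highest weight vectors\<close>

lemma (in abelian_group) diff_diff: "\<lbrakk>v \<in> carrier G; w \<in> carrier G\<rbrakk> \<Longrightarrow> v \<ominus> (v \<ominus> w) = w"
  by (simp add: a_minus_def minus_add r_neg2)

lemma cls_zero:
  assumes "simply_linked_datum D"
  shows "hconst D 0 = \<zero>\<^bsub>alg D\<^esub>"
proof -
  interpret ring "alg D" by (rule ring_alg[OF assms])
  have "hconst D 0 = cls D (fconst 0 - fconst 0)" by (simp add: fconst_def)
  also have "\<dots> = hconst D 0 \<ominus>\<^bsub>alg D\<^esub> hconst D 0"
    by (rule cls_simps(5)[OF assms fconst_closed fconst_closed])
  finally have "hconst D 0 \<ominus>\<^bsub>alg D\<^esub> hconst D 0 = hconst D 0" ..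
  then show ?thesis
    using cls_simps(1)[OF assms fconst_closed fconst_closed, of 0] by (simp add: a_minus_def r_neg)
qed

context alg_module
begin

lemma const_neg: "v \<in> carrier Z \<Longrightarrow> hconst D (- c) \<odot> v = \<ominus> (hconst D c \<odot> v)"
  using const_add[of v "- c" c] cls_zero[OF D] smult_closed
  by (intro M.minus_equality[symmetric]) simp_all

definition highest :: "('g \<Rightarrow> 'k) \<Rightarrow> 'z \<Rightarrow> bool"
  where "highest \<gamma> v \<longleftrightarrow> v \<in> carrier Z \<and> (\<forall>i\<in>I. hY D i \<odot> v = \<zero>\<^bsub>Z\<^esub>)
    \<and> (\<forall>g\<in>carrier (grp D). hG D g \<odot> v = hconst D (\<gamma> g) \<odot> v)"

text \<open>
  The span of all words in the \<open>x\<^sub>i\<close> applied to \<open>u\<close>, without any ordering of the factors.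
\<close>

inductive_set xspan :: "'z \<Rightarrow> 'z set" for u where
  base: "u \<in> xspan u"
| zero: "\<zero> \<in> xspan u"
| add: "\<lbrakk>v \<in> xspan u; w \<in> xspan u\<rbrakk> \<Longrightarrow> v \<oplus> w \<in> xspan u"
| const: "v \<in> xspan u \<Longrightarrow> hconst D c \<odot> v \<in> xspan u"
| x: "\<lbrakk>i \<in> I; v \<in> xspan u\<rbrakk> \<Longrightarrow> hX D i \<odot> v \<in> xspan u"

lemma xspan_closed: "\<lbrakk>v \<in> xspan u; u \<in> carrier Z\<rbrakk> \<Longrightarrow> v \<in> carrier Z"
  by (induction rule: xspan.induct) (simp_all add: smult_closed del: atLeastAtMost_iff)

text \<open>
  The relations move \<open>g\<close> and \<open>y\<^sub>j\<close> past each \<open>x\<^sub>i\<close> at the cost of further words in the \<open>x\<^sub>i\<close>, until they reach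
  \<open>u\<close> and become scalars. This is the half of the triangular decomposition that is needed.
\<close>

lemma xspan_submodule:
  assumes wd: "weighted_datum D \<gamma>" and u: "highest \<gamma> u"
  shows "submodule (xspan u) (alg D) Z"
proof -
  interpret wd: weighted_datum D \<gamma> by (rule wd)
  have uZ: "u \<in> carrier Z" using u by (simp add: highest_def)
  note closed = xspan_closed[OF _ uZ]
  have diff: "v \<ominus> w \<in> xspan u" if "v \<in> xspan u" "w \<in> xspan u" for v w
    using xspan.add[OF that(1) xspan.const[OF that(2), of "- 1"]] closed[OF that(2)]
    by (simp add: a_minus_def const_neg const_one)
  have G: "hG D g \<odot> v \<in> xspan u" if "g \<in> carrier (grp D)" "v \<in> xspan u" for g v
    using that(2)
  proof (induction rule: xspan.induct)
    case base
    then show ?case using u that(1) xspan.const[OF xspan.base] by (simp add: highest_def)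
  next
    case (add v w)
    then show ?case using that(1) closed xspan.add by (simp add: smult_r_distr)
  next
    case (const v c)
    then show ?case using that(1) closed xspan.const by (simp flip: const_commute)
  next
    case (x i v)
    then show ?case unfolding rel_G_X[OF that(1) x(1) closed[OF x(2)]] by (intro xspan.const xspan.x)
  qed (use that(1) in \<open>simp add: xspan.zero\<close>)
  have Y: "hY D j \<odot> v \<in> xspan u" if j: "j \<in> I" and "v \<in> xspan u" for j v
    using that(2)
  proof (induction rule: xspan.induct)
    case base
    then show ?case using u j xspan.zero unfolding highest_def by metis
  next
    case (add v w)
    then show ?case using gens_closed(3)[OF j] closed xspan.add by (simp add: smult_r_distr)
  next
    case (const v c)
    then show ?case using gens_closed(3)[OF j] closed xspan.const by (simp flip: const_commute)
  next
    case (x i v)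
    note v = closed[OF x(2)]
    let ?w = "hY D j \<odot> (hX D i \<odot> v)" and ?xy = "hX D i \<odot> (hY D j \<odot> v)"
    let ?r = "if i = j then hG D (pta D i \<otimes>\<^bsub>grp D\<^esub> ptb D i) \<odot> v \<ominus> v else \<zero>"
    have ab: "pta D i \<otimes>\<^bsub>grp D\<^esub> ptb D i \<in> carrier (grp D)" using wd.a_closed wd.b_closed x(1) by blast
    have w: "?w \<in> carrier Z" "?xy \<in> carrier Z"
      by (intro smult_closed gens_closed j x(1) v)+
    have r: "?r \<in> xspan u" using G[OF ab x(2)] x(2) by (auto intro: diff xspan.zero)
    have "hconst D (inverse (qmat D i j)) \<odot> ?w = ?xy \<ominus> ?r"
      unfolding rel_X_Y[OF x(1) j ab v, symmetric]
      by (rule M.diff_diff[symmetric]) (intro w smult_closed const_closed)+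
    then have "hconst D (inverse (qmat D i j)) \<odot> ?w \<in> xspan u"
      using diff[OF xspan.x[OF x(1) x.IH] r] by simp
    from xspan.const[OF this, of "qmat D i j"] show ?case
      using w wd.qmat_nonzero[OF x(1) j] by (simp add: const_const const_one)
  qed (use gens_closed(3)[OF j] in \<open>simp add: xspan.zero\<close>)
  show ?thesis
  proof (rule alg_submoduleI)
    fix s v assume "s \<in> gens D" "v \<in> xspan u"
    then show "cls D (fgen s) \<odot> v \<in> xspan u"
      using G Y xspan.x by (cases s) (simp_all only: gens_simps)
  qed (auto intro: closed xspan.zero xspan.add xspan.const)
qed

lemma Ysub_act:
  assumes wd: "weighted_datum D \<gamma>" and v: "highest \<gamma> v" and y: "y \<in> Ysub D"
  shows "y \<odot> v = hconst D (Ychar D \<gamma> y) \<odot> v"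
proof -
  interpret wd: weighted_datum D \<gamma> by (rule wd)
  let ?f = "Ychar D \<gamma>"
  have vZ: "v \<in> carrier Z" using v by (simp add: highest_def)
  have f_add: "?f (y \<oplus>\<^bsub>alg D\<^esub> z) = ?f y + ?f z" and f_mult: "?f (y \<otimes>\<^bsub>alg D\<^esub> z) = ?f y * ?f z"
    if "y \<in> Ysub D" "z \<in> Ysub D" for y z
    using ring_hom_add[OF wd.Ychar_spec(1), of y z] ring_hom_mult[OF wd.Ychar_spec(1), of y z] that
    by (simp_all add: ground_field_def)
  have f_neg: "?f (\<ominus>\<^bsub>alg D\<^esub> y) = - ?f y" if "y \<in> Ysub D" for y
  proof -
    have "\<ominus>\<^bsub>alg D\<^esub> y \<in> Ysub D" using that unfolding Ysub_def by (rule generate_ring.a_inv)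
    then have "?f (\<ominus>\<^bsub>alg D\<^esub> y) + ?f y = ?f \<zero>\<^bsub>alg D\<^esub>"
      using f_add[of "\<ominus>\<^bsub>alg D\<^esub> y" y] that wd.Ysub_closed[OF that] by (simp add: R.l_neg)
    then show ?thesis using wd.Ychar_spec(2)[of 0] cls_zero[OF D] by (simp add: eq_neg_iff_add_eq_0)
  qed
  have "y \<in> generate_ring (alg D) (range (hconst D) \<union> hG D ` carrier (grp D) \<union> hY D ` I)"
    using y by (simp add: Ysub_def)
  then show ?thesis
  proof (induction rule: generate_ring.induct)
    case one
    have "?f \<one>\<^bsub>alg D\<^esub> = 1"
      using ring_hom_one[OF wd.Ychar_spec(1)] by (simp add: ground_field_def)
    then show ?case using vZ by (simp add: smult_one const_one)
  next
    case (incl y)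
    then consider c where "y = hconst D c" | g where "g \<in> carrier (grp D)" "y = hG D g"
      | i where "i \<in> I" "y = hY D i" by blast
    then show ?case
    proof cases
      case 1 then show ?thesis by (simp add: wd.Ychar_spec(2))
    next
      case 2 then show ?thesis using v by (simp add: wd.Ychar_spec(3) highest_def)
    next
      case 3
      then have "hY D i \<odot> v = \<zero>" using v unfolding highest_def by blast
      then show ?thesis using 3 vZ by (simp add: wd.Ychar_spec(4) cls_zero[OF D] del: atLeastAtMost_iff)
    qed
  next
    case (a_inv y)
    then have y: "y \<in> Ysub D" by (simp add: Ysub_def)
    show ?case using a_inv.IH f_neg[OF y] wd.Ysub_closed[OF y] vZ by (simp add: minus_smult const_neg)
  next
    case (eng_add y z)
    then have y: "y \<in> Ysub D" "z \<in> Ysub D" by (simp_all add: Ysub_def)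
    show ?case using eng_add.IH f_add[OF y] wd.Ysub_closed[OF y(1)] wd.Ysub_closed[OF y(2)] vZ
      by (simp add: smult_l_distr const_add)
  next
    case (eng_mult y z)
    then have y: "y \<in> Ysub D" "z \<in> Ysub D" by (simp_all add: Ysub_def)
    have "(y \<otimes>\<^bsub>alg D\<^esub> z) \<odot> v = y \<odot> (hconst D (?f z) \<odot> v)"
      using eng_mult.IH(2) wd.Ysub_closed[OF y(1)] wd.Ysub_closed[OF y(2)] vZ by (simp add: smult_assoc)
    also have "\<dots> = hconst D (?f z) \<odot> (hconst D (?f y) \<odot> v)"
      using eng_mult.IH(1) const_commute[OF wd.Ysub_closed[OF y(1)] vZ] by simp
    finally show ?case using f_mult[OF y] vZ by (simp add: const_const mult.commute)
  qed
qed

definition mon :: "nat list \<Rightarrow> (nat \<Rightarrow> nat) \<Rightarrow> 'z \<Rightarrow> 'z"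
  where "mon ks e v = foldr (\<lambda>k w. ((\<lambda>w. hX D k \<odot> w) ^^ e k) w) ks v"

lemma mon_Cons: "mon (k # ks) e v = ((\<lambda>w. hX D k \<odot> w) ^^ e k) (mon ks e v)"
  by (simp add: mon_def)

lemma x_power_closed: "\<lbrakk>k \<in> I; w \<in> carrier Z\<rbrakk> \<Longrightarrow> ((\<lambda>w. hX D k \<odot> w) ^^ t) w \<in> carrier Z"
  by (induction t) (simp_all add: smult_closed del: atLeastAtMost_iff)

lemma mon_closed: "\<lbrakk>set ks \<subseteq> I; v \<in> carrier Z\<rbrakk> \<Longrightarrow> mon ks e v \<in> carrier Z"
  by (induction ks) (simp_all add: mon_Cons x_power_closed mon_def[of "[]"] del: atLeastAtMost_iff)

lemma mon_cong: "(\<And>k. k \<in> set ks \<Longrightarrow> e k = e' k) \<Longrightarrow> mon ks e v = mon ks e' v"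
  by (induction ks) (simp_all add: mon_Cons mon_def[of "[]"])

lemma x_power_smult:
  assumes "k \<in> I" "w \<in> carrier Z"
  shows "(hX D k [^]\<^bsub>alg D\<^esub> t) \<odot> w = ((\<lambda>w. hX D k \<odot> w) ^^ t) w"
  using assms(2)
proof (induction t arbitrary: w)
  case (Suc t)
  then show ?case
    using gens_closed(2)[OF assms(1)] by (simp add: smult_assoc smult_closed funpow_swap1)
qed (simp add: smult_one)

lemma xmonom_smult:
  assumes v: "v \<in> carrier Z"
  shows "xmonom D e \<in> carrier (alg D)" "xmonom D e \<odot> v = mon [1..<Suc (num D)] e v"
proof -
  let ?p = "\<lambda>ks. foldr (\<lambda>k p. (hX D k [^]\<^bsub>alg D\<^esub> e k) \<otimes>\<^bsub>alg D\<^esub> p) ks \<one>\<^bsub>alg D\<^esub>"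
  have "?p ks \<in> carrier (alg D) \<and> ?p ks \<odot> v = mon ks e v" if "set ks \<subseteq> I" for ks
    using that
  proof (induction ks)
    case (Cons k ks)
    then have k: "k \<in> I" and ks: "set ks \<subseteq> I" by auto
    show ?case
      using Cons.IH[OF ks] gens_closed(2)[OF k] mon_closed[OF ks v] v
      by (simp add: smult_assoc x_power_smult[OF k] mon_Cons)
  qed (simp add: mon_def v smult_one)
  moreover have "set [1..<Suc (num D)] \<subseteq> I" by auto
  ultimately show "xmonom D e \<in> carrier (alg D)" "xmonom D e \<odot> v = mon [1..<Suc (num D)] e v"
    unfolding xmonom_def by blast+
qed

lemma x_swap_power:
  assumes "i \<in> I" "k \<in> I" "i \<noteq> k" "w \<in> carrier Z"
  shows "\<exists>c. hX D i \<odot> (((\<lambda>w. hX D k \<odot> w) ^^ t) w) =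
    hconst D c \<odot> (((\<lambda>w. hX D k \<odot> w) ^^ t) (hX D i \<odot> w))"
proof (induction t)
  case 0
  then show ?case using const_one[OF smult_closed[OF gens_closed(2)[OF assms(1)] assms(4)]] by (metis funpow_0)
next
  case (Suc t)
  let ?f = "\<lambda>w. hX D k \<odot> w"
  obtain c where c: "hX D i \<odot> ((?f ^^ t) w) = hconst D c \<odot> ((?f ^^ t) (hX D i \<odot> w))"
    using Suc.IH by blast
  note closed = x_power_closed[OF assms(2,4), of t]
    x_power_closed[OF assms(2) smult_closed[OF gens_closed(2)[OF assms(1)] assms(4)], of t]
  have "hX D i \<odot> ((?f ^^ Suc t) w) = hconst D (qmat D i k) \<odot> (?f (hX D i \<odot> ((?f ^^ t) w)))"
    using rel_X_X[OF assms(1-3) closed(1)] by simp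
  also have "\<dots> = hconst D (qmat D i k) \<odot> (hconst D c \<odot> ?f ((?f ^^ t) (hX D i \<odot> w)))"
    unfolding c const_commute[OF gens_closed(2)[OF assms(2)] closed(2)] ..
  also have "\<dots> = hconst D (qmat D i k * c) \<odot> ((?f ^^ Suc t) (hX D i \<odot> w))"
    using const_const smult_closed[OF gens_closed(2)[OF assms(2)] closed(2)] by simp
  finally show ?case by blast
qed

lemma x_power_const:
  assumes "k \<in> I" "w \<in> carrier Z"
  shows "((\<lambda>w. hX D k \<odot> w) ^^ t) (hconst D c \<odot> w) = hconst D c \<odot> (((\<lambda>w. hX D k \<odot> w) ^^ t) w)"
proof (induction t)
  case (Suc t)
  then show ?case
    by (simp add: const_commute[OF gens_closed(2)[OF assms(1)] x_power_closed[OF assms, of t]])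
qed simp

text \<open>
  The scalar is left unspecified: its value can be read off from the action on the function module.
\<close>

lemma x_mon:
  assumes "distinct ks" "set ks \<subseteq> I" "i \<in> set ks" "v \<in> carrier Z"
  shows "\<exists>c. hX D i \<odot> mon ks e v = hconst D c \<odot> mon ks (e(i := Suc (e i))) v"
  using assms
proof (induction ks)
  case (Cons k ks)
  then have k: "k \<in> I" and ks: "set ks \<subseteq> I" by auto
  let ?e = "e(i := Suc (e i))"
  let ?f = "\<lambda>w. hX D k \<odot> w"
  note closed = mon_closed[OF ks Cons.prems(4)]
  show ?case
  proof (cases "i = k")
    case True
    then have "i \<notin> set ks" using Cons.prems(1) by simp
    then have "mon ks ?e v = mon ks e v" by (intro mon_cong) auto
    then have "hX D i \<odot> mon (k # ks) e v = mon (k # ks) ?e v" using True by (simp add: mon_Cons)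
    then show ?thesis using const_one mon_closed[OF Cons.prems(2,4)] by metis
  next
    case False
    then have i: "i \<in> set ks" "i \<in> I" using Cons.prems by auto
    obtain c where c: "hX D i \<odot> mon ks e v = hconst D c \<odot> mon ks ?e v"
      using Cons.IH[OF distinct_tl[OF Cons.prems(1), simplified] ks i(1) Cons.prems(4)] by blast
    obtain d where d: "hX D i \<odot> ((?f ^^ e k) (mon ks e v)) = hconst D d \<odot> ((?f ^^ e k) (hX D i \<odot> mon ks e v))"
      using x_swap_power[OF i(2) k False closed] by blast
    have "hX D i \<odot> mon (k # ks) e v = hconst D d \<odot> (hconst D c \<odot> ((?f ^^ e k) (mon ks ?e v)))"
      unfolding mon_Cons d c x_power_const[OF k closed] ..
    also have "\<dots> = hconst D (d * c) \<odot> mon (k # ks) ?e v"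
      using const_const[OF x_power_closed[OF k closed]] False by (simp add: mon_Cons)
    finally show ?thesis by blast
  qed
qed simp

lemma mon_vanish:
  assumes "set ks \<subseteq> I" "i \<in> set ks" "e i = mord D i" "v \<in> carrier Z"
  shows "mon ks e v = \<zero>"
  using assms(1,2)
proof (induction ks)
  case (Cons k ks)
  then have k: "k \<in> I" and ks: "set ks \<subseteq> I" by auto
  have zero: "((\<lambda>w. hX D k \<odot> w) ^^ t) \<zero> = \<zero>" for t
    by (induction t) (simp_all add: gens_closed(2)[OF k])
  show ?case
  proof (cases "i = k")
    case True
    then show ?thesis using rel_X_power[OF k mon_closed[OF ks assms(4)], of e] assms(3) by (simp add: mon_Cons)
  next
    case False
    then show ?thesis using Cons.IH[OF ks] Cons.prems(2) zero by (simp add: mon_Cons)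
  qed
qed simp

end

section \<open>The modules $Z(\gamma)$\<close>

context weighted_datum
begin

lemma kmod_simps [simp]:
  "carrier (kmod D \<gamma>) = UNIV" "\<zero>\<^bsub>kmod D \<gamma>\<^esub> = 0" "c \<oplus>\<^bsub>kmod D \<gamma>\<^esub> d = c + d" "y \<odot>\<^bsub>kmod D \<gamma>\<^esub> c = Ychar D \<gamma> y * c"
  by (simp_all add: kmod_def)

lemma induced_kmod: "induced (alg D) (Ysub D) (kmod D \<gamma>)"
proof (intro induced.intro induced_axioms.intro ring_alg D)
  show "abelian_group (kmod D \<gamma>)"
    by (rule abelian_groupI) (auto simp: add.assoc add.commute intro: exI[of _ "- _"])
qed (auto simp: Ysub_closed)

interpretation ind: induced "alg D" "Ysub D" "kmod D \<gamma>" by (rule induced_kmod)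

sublocale Z: alg_module D "verma D \<gamma>"
  unfolding verma_def by (intro alg_module.intro alg_module_axioms.intro ind.left_module_induced D)

definition top :: "('g, 'k) verma_elt"
  where "top = pure_tensor (alg D) (Ysub D) (kmod D \<gamma>) \<one>\<^bsub>alg D\<^esub> 1"

lemma top_closed: "top \<in> carrier (verma D \<gamma>)"
  unfolding top_def verma_def by (rule ind.pure_closed) simp_all

lemma pure_eq: "r \<in> carrier (alg D) \<Longrightarrow> pure_tensor (alg D) (Ysub D) (kmod D \<gamma>) r 1 = r \<odot>\<^bsub>verma D \<gamma>\<^esub> top"
  unfolding top_def verma_def by (subst ind.smult_pure) simp_all

lemma Ysub_top: "y \<in> Ysub D \<Longrightarrow> y \<odot>\<^bsub>verma D \<gamma>\<^esub> top = pure_tensor (alg D) (Ysub D) (kmod D \<gamma>) \<one>\<^bsub>alg D\<^esub> (Ychar D \<gamma> y)"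
  using pure_eq[of y] ind.pure_balanced[of "\<one>\<^bsub>alg D\<^esub>" y 1] Ysub_closed[of y] by simp

lemma const_Ysub: "hconst D c \<in> Ysub D" and G_Ysub: "g \<in> carrier (grp D) \<Longrightarrow> hG D g \<in> Ysub D"
  and Y_Ysub: "i \<in> I \<Longrightarrow> hY D i \<in> Ysub D"
  unfolding Ysub_def by (rule generate_ring.incl, blast)+

lemma highest_top: "Z.highest \<gamma> top"
  unfolding Z.highest_def
proof (intro conjI ballI top_closed)
  fix i assume "i \<in> I"
  then show "hY D i \<odot>\<^bsub>verma D \<gamma>\<^esub> top = \<zero>\<^bsub>verma D \<gamma>\<^esub>"
    unfolding Ysub_top[OF Y_Ysub[OF \<open>i \<in> I\<close>]] Ychar_spec(4)[OF \<open>i \<in> I\<close>]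
    using ind.pure_zero[of "\<one>\<^bsub>alg D\<^esub>"] by (simp add: verma_def)
next
  fix g assume g: "g \<in> carrier (grp D)"
  show "hG D g \<odot>\<^bsub>verma D \<gamma>\<^esub> top = hconst D (\<gamma> g) \<odot>\<^bsub>verma D \<gamma>\<^esub> top"
    unfolding Ysub_top[OF G_Ysub[OF g]] Ysub_top[OF const_Ysub] Ychar_spec(2) Ychar_spec(3)[OF g] ..
qed

text \<open>
  A pure tensor \<open>r \<otimes> c\<close> equals \<open>(r c) \<otimes> 1\<close>, because constants belong to the subalgebra \<open>Y\<close>.
\<close>

lemma top_generates:
  assumes N: "submodule N (alg D) (verma D \<gamma>)" and "top \<in> N"
  shows "N = carrier (verma D \<gamma>)"
proof -
  have "z \<in> N" if "z \<in> carrier (induced_module (alg D) (Ysub D) (kmod D \<gamma>))" for z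
    using that
  proof (induction z rule: ind.induced_induct)
    case (pure r c)
    have "pure_tensor (alg D) (Ysub D) (kmod D \<gamma>) r c = pure_tensor (alg D) (Ysub D) (kmod D \<gamma>) (r \<otimes>\<^bsub>alg D\<^esub> hconst D c) 1"
      using ind.pure_balanced[OF pure(1) const_Ysub, of 1 c] by (simp add: Ychar_spec(2))
    also have "\<dots> = (r \<otimes>\<^bsub>alg D\<^esub> hconst D c) \<odot>\<^bsub>verma D \<gamma>\<^esub> top"
      by (intro pure_eq Vmod.R.m_closed pure(1) Z.const_closed)
    also have "\<dots> \<in> N" by (intro submodule_smult[OF N _ assms(2)] Vmod.R.m_closed pure(1) Z.const_closed)
    finally show ?case .
  next
    case zero
    show ?case using submodule_zero[OF N] by (simp add: verma_def)
  next
    case (diff z w)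
    then show ?case using Z.submodule_diff[OF N diff(3,4)] by (simp add: verma_def)
  qed
  then show ?thesis using submodule_subset[OF N] by (auto simp: verma_def)
qed

lemma verma_universal:
  assumes M: "alg_module D M" and v: "alg_module.highest D M \<gamma> v"
  obtains \<Phi> where "left_module_hom (alg D) (verma D \<gamma>) M \<Phi>" "\<Phi> top = v"
proof -
  interpret M: alg_module D M by (rule M)
  have wd: "weighted_datum D \<gamma>" by (rule weighted_datum_axioms)
  have vM: "v \<in> carrier M" using v by (simp add: M.highest_def)
  obtain \<Phi> where \<Phi>: "left_module_hom (alg D) (induced_module (alg D) (Ysub D) (kmod D \<gamma>)) M \<Phi>"
    "\<And>r c. \<lbrakk>r \<in> carrier (alg D); c \<in> carrier (kmod D \<gamma>)\<rbrakk> \<Longrightarrow>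
      \<Phi> (pure_tensor (alg D) (Ysub D) (kmod D \<gamma>) r c) = r \<odot>\<^bsub>M\<^esub> (hconst D c \<odot>\<^bsub>M\<^esub> v)"
  proof (rule ind.induced_universal[OF M.left_module_axioms, of "\<lambda>c. hconst D c \<odot>\<^bsub>M\<^esub> v"])
    fix y c assume y: "y \<in> Ysub D"
    show "hconst D (y \<odot>\<^bsub>kmod D \<gamma>\<^esub> c) \<odot>\<^bsub>M\<^esub> v = y \<odot>\<^bsub>M\<^esub> (hconst D c \<odot>\<^bsub>M\<^esub> v)"
      using M.const_commute[OF Ysub_closed[OF y] vM] M.Ysub_act[OF wd v y] vM
      by (simp add: M.const_const mult.commute)
  qed (auto simp: M.smult_closed vM M.const_add)
  show thesis
  proof
    show "left_module_hom (alg D) (verma D \<gamma>) M \<Phi>" using \<Phi>(1) by (simp add: verma_def)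
    show "\<Phi> top = v" unfolding top_def using \<Phi>(2)[of "\<one>\<^bsub>alg D\<^esub>" 1] vM
      by (simp add: M.const_one M.smult_one)
  qed
qed

subsection \<open>The standard basis\<close>

lemma gop_X_delta:
  assumes k: "k \<in> I" and e: "e \<in> E" "\<And>j. j \<in> {1..<k} \<Longrightarrow> e j = 0" "Suc (e k) < mord D k"
  shows "gop (GenX k) (delta e) = delta (e(k := Suc (e k)))"
proof
  fix e'
  have "xcoef k (e(k := Suc (e k))) = 1"
    unfolding xcoef_def using e(2) by (intro prod.neutral) auto
  then have up: "gop (GenX k) (delta e) (e(k := Suc (e k))) = 1"
    using E_up[OF e(1) k e(3)] by (simp add: delta_self)
  show "gop (GenX k) (delta e) e' = delta (e(k := Suc (e k))) e'"
  proof (cases "e' = e(k := Suc (e k))")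
    case True
    show ?thesis unfolding True up by (rule delta_self[symmetric])
  next
    case False
    have "e'(k := e' k - 1) \<noteq> e" if "e' k \<noteq> 0"
    proof
      assume "e'(k := e' k - 1) = e"
      then have "e' = e(k := Suc (e k))" using that by (metis Suc_pred' bot_nat_0.not_eq_extremum fun_upd_same fun_upd_triv fun_upd_upd)
      then show False using False by simp
    qed
    then show ?thesis using False by (simp add: delta_def)
  qed
qed

text \<open>
  Under the coordinates \<open>x\<^sup>e \<otimes> 1\<close> becomes the indicator function of \<open>e\<close> without a scalar, because
  each \<open>x\<^sub>j\<close> is applied when no factor of smaller index is present yet.
\<close>

lemma mon_delta:
  assumes e: "e \<in> E" and j: "1 \<le> j" "j \<le> Suc (num D)"
  shows "Vmod.mon [j..<Suc (num D)] e (delta origin) = delta (\<lambda>i\<in>I. if j \<le> i then e i else 0)"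
  using j
proof (induction "Suc (num D) - j" arbitrary: j)
  case 0
  then have "(\<lambda>i\<in>I. if j \<le> i then e i else 0) = origin" by (auto simp: origin_def fun_eq_iff)
  then show ?case using 0 by (simp add: Vmod.mon_def)
next
  case (Suc d)
  then have j: "j \<in> I" by simp
  have upt: "[j..<Suc (num D)] = j # [Suc j..<Suc (num D)]" using Suc by (simp add: upt_rec)
  let ?e = "\<lambda>t i. if i \<in> I then if j < i then e i else if i = j then t else 0 else undefined"
  have power: "((\<lambda>w. hX D j \<odot>\<^bsub>Vmod\<^esub> w) ^^ t) (delta (?e 0)) = delta (?e t)" if "t \<le> e j" for t
    using that
  proof (induction t)
    case (Suc t)
    have lt: "Suc t < mord D j" using Suc.prems E_bound[OF e j] by simp
    have E: "?e t \<in> E"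
      using e lt mord(1) by (auto simp: exponents_def PiE_iff extensional_def)
    have "gop (GenX j) (delta (?e t)) = delta ((?e t)(j := Suc (?e t j)))"
      using E j lt by (intro gop_X_delta) auto
    moreover have "(?e t)(j := Suc (?e t j)) = ?e (Suc t)" using j by (auto simp: fun_eq_iff)
    ultimately show ?case using Suc delta_V[OF E] j by (simp add: vact_gen del: gop.simps atLeastAtMost_iff)
  qed simp
  have e_0: "(\<lambda>i\<in>I. if Suc j \<le> i then e i else 0) = ?e 0" by (auto simp: fun_eq_iff)
  have e_j: "(\<lambda>i\<in>I. if j \<le> i then e i else 0) = ?e (e j)" by (auto simp: fun_eq_iff)
  have "d = Suc (num D) - Suc j" "1 \<le> Suc j" "Suc j \<le> Suc (num D)" using Suc.hyps(2) Suc.prems by linarith+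
  from Suc.hyps(1)[OF this] have IH: "Vmod.mon [Suc j..<Suc (num D)] e (delta origin) = delta (?e 0)"
    unfolding e_0 .
  show ?case unfolding upt Vmod.mon_Cons IH e_j by (rule power[OF order_refl])
qed

lemma xmonom_delta: "e \<in> E \<Longrightarrow> vact (xmonom D e) (delta origin) = delta e"
proof -
  assume e: "e \<in> E"
  have "(\<lambda>i\<in>I. if 1 \<le> i then e i else 0) = e"
    using e by (auto simp: exponents_def PiE_iff extensional_def fun_eq_iff)
  then show ?thesis
    using Vmod.xmonom_smult(2)[of "delta origin" e] mon_delta[OF e, of 1] delta_V[OF origin_E] by simp
qed

lemma highest_origin: "Vmod.highest \<gamma> (delta origin)"
  unfolding Vmod.highest_def
  using delta_V[OF origin_E] by (auto simp: vact_gen vact_const gop_Y_origin gop_G_origin simp del: gop.simps)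

text \<open>
  The coordinates: the homomorphism from \<open>Z(\<gamma>)\<close> to the function module given by the universal property.
\<close>

definition co :: "('g, 'k) verma_elt \<Rightarrow> (nat \<Rightarrow> nat) \<Rightarrow> 'k"
  where "co = (SOME \<Phi>. left_module_hom (alg D) (verma D \<gamma>) Vmod \<Phi> \<and> \<Phi> top = delta origin)"

lemma co: "left_module_hom (alg D) (verma D \<gamma>) Vmod co" "co top = delta origin"
proof -
  have "\<exists>\<Phi>. left_module_hom (alg D) (verma D \<gamma>) Vmod \<Phi> \<and> \<Phi> top = delta origin"
    using verma_universal[OF Vmod.alg_module_axioms highest_origin] by metis
  from someI_ex[OF this] show "left_module_hom (alg D) (verma D \<gamma>) Vmod co" "co top = delta origin"
    unfolding co_def by blast+
qed

interpretation co: left_module_hom "alg D" "verma D \<gamma>" Vmod co by (rule co)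

lemma basis_vec_eq: "basis_vec D \<gamma> e = xmonom D e \<odot>\<^bsub>verma D \<gamma>\<^esub> top"
  unfolding basis_vec_def by (rule pure_eq) (rule Z.xmonom_smult(1)[OF top_closed])

lemma basis_vec_mon: "basis_vec D \<gamma> e = Z.mon [1..<Suc (num D)] e top"
  unfolding basis_vec_eq by (rule Z.xmonom_smult(2)[OF top_closed])

lemma basis_vec_closed: "basis_vec D \<gamma> e \<in> carrier (verma D \<gamma>)"
  unfolding basis_vec_mon by (rule Z.mon_closed) (auto simp: top_closed)

lemma co_basis_vec: "e \<in> E \<Longrightarrow> co (basis_vec D \<gamma> e) = delta e"
  unfolding basis_vec_eq
  using co.hom_smult[OF Z.xmonom_smult(1)[OF top_closed] top_closed] co(2) xmonom_delta by simp

lemma finite_E: "finite E"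
  unfolding exponents_def by (intro finite_PiE) auto

definition comb :: "((nat \<Rightarrow> nat) \<Rightarrow> 'k) \<Rightarrow> ('g, 'k) verma_elt"
  where "comb f = (\<Oplus>\<^bsub>verma D \<gamma>\<^esub>e\<in>E. hconst D (f e) \<odot>\<^bsub>verma D \<gamma>\<^esub> basis_vec D \<gamma> e)"

lemma comb_add: "comb (\<lambda>e. f e + g e) = comb f \<oplus>\<^bsub>verma D \<gamma>\<^esub> comb g"
  unfolding comb_def
  by (subst Z.M.finsum_addf[symmetric])
    (auto simp: Z.const_add basis_vec_closed Z.smult_closed)

lemma comb_scale: "comb (\<lambda>e. c * f e) = hconst D c \<odot>\<^bsub>verma D \<gamma>\<^esub> comb f"
proof -
  have closed: "hconst D c \<odot>\<^bsub>verma D \<gamma>\<^esub> basis_vec D \<gamma> e \<in> carrier (verma D \<gamma>)" for c e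
    by (simp add: basis_vec_closed Z.smult_closed)
  have "(\<Oplus>\<^bsub>verma D \<gamma>\<^esub>e\<in>A. hconst D (c * f e) \<odot>\<^bsub>verma D \<gamma>\<^esub> basis_vec D \<gamma> e) =
      hconst D c \<odot>\<^bsub>verma D \<gamma>\<^esub> (\<Oplus>\<^bsub>verma D \<gamma>\<^esub>e\<in>A. hconst D (f e) \<odot>\<^bsub>verma D \<gamma>\<^esub> basis_vec D \<gamma> e)" if "finite A" for A
    using that
  proof (induction A rule: finite_induct)
    case (insert e A)
    have "(\<Oplus>\<^bsub>verma D \<gamma>\<^esub>e\<in>A. hconst D (f e) \<odot>\<^bsub>verma D \<gamma>\<^esub> basis_vec D \<gamma> e) \<in> carrier (verma D \<gamma>)"
      using closed by (intro Z.M.finsum_closed) auto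
    then show ?case
      using insert closed by (simp add: Z.M.finsum_insert Pi_iff Z.smult_r_distr Z.const_const basis_vec_closed)
  qed simp
  then show ?thesis using finite_E by (simp add: comb_def)
qed

lemma comb_delta: "e \<in> E \<Longrightarrow> comb (delta e) = basis_vec D \<gamma> e"
proof -
  assume e: "e \<in> E"
  have "comb (delta e) = (\<Oplus>\<^bsub>verma D \<gamma>\<^esub>e'\<in>E. if e = e' then basis_vec D \<gamma> e' else \<zero>\<^bsub>verma D \<gamma>\<^esub>)"
    unfolding comb_def
    by (intro Z.M.finsum_cong')
      (auto simp: delta_def Z.const_one basis_vec_closed cls_zero[OF D])
  also have "\<dots> = basis_vec D \<gamma> e"
    using Z.M.finsum_singleton[OF e finite_E, of "basis_vec D \<gamma>"] basis_vec_closed by auto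
  finally show ?thesis .
qed

lemma comb_zero: "comb (\<lambda>e. 0) = \<zero>\<^bsub>verma D \<gamma>\<^esub>"
  unfolding comb_def by (rule Z.M.add.finprod_one_eqI) (simp add: cls_zero[OF D] basis_vec_closed)

lemma comb_closed: "comb f \<in> carrier (verma D \<gamma>)"
  unfolding comb_def by (intro Z.M.finsum_closed) (auto simp: basis_vec_closed Z.smult_closed)

definition recovered :: "('g, 'k) verma_elt set"
  where "recovered = {z \<in> carrier (verma D \<gamma>). comb (co z) = z}"

lemma recovered_zero: "\<zero>\<^bsub>verma D \<gamma>\<^esub> \<in> recovered"
  using co.hom_zero comb_zero by (simp add: recovered_def)

lemma recovered_add: "\<lbrakk>z \<in> recovered; w \<in> recovered\<rbrakk> \<Longrightarrow> z \<oplus>\<^bsub>verma D \<gamma>\<^esub> w \<in> recovered"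
  using comb_add[of "co z" "co w"] by (simp add: recovered_def co.hom_add)

lemma recovered_const: "z \<in> recovered \<Longrightarrow> hconst D c \<odot>\<^bsub>verma D \<gamma>\<^esub> z \<in> recovered"
  using comb_scale[of c "co z"] co.hom_closed[of z]
  by (simp add: recovered_def co.hom_smult Z.smult_closed vact_const)

lemma recovered_basis_vec: "e \<in> E \<Longrightarrow> basis_vec D \<gamma> e \<in> recovered"
  by (simp add: recovered_def basis_vec_closed co_basis_vec comb_delta)

lemma recovered_x:
  assumes i: "i \<in> I" and z: "z \<in> recovered"
  shows "hX D i \<odot>\<^bsub>verma D \<gamma>\<^esub> z \<in> recovered"
proof -
  have X: "hX D i \<in> carrier (alg D)" by (rule Z.gens_closed(2)[OF i])
  have basis: "hX D i \<odot>\<^bsub>verma D \<gamma>\<^esub> basis_vec D \<gamma> e \<in> recovered" if e: "e \<in> E" for e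
  proof -
    have ks: "distinct [1..<Suc (num D)]" "set [1..<Suc (num D)] \<subseteq> I" "i \<in> set [1..<Suc (num D)]"
      using i by auto
    obtain c where c: "hX D i \<odot>\<^bsub>verma D \<gamma>\<^esub> basis_vec D \<gamma> e = hconst D c \<odot>\<^bsub>verma D \<gamma>\<^esub> basis_vec D \<gamma> (e(i := Suc (e i)))"
      unfolding basis_vec_mon using Z.x_mon[OF ks top_closed] by blast
    show ?thesis
    proof (cases "Suc (e i) < mord D i")
      case True
      then show ?thesis unfolding c by (intro recovered_const recovered_basis_vec E_up e i)
    next
      case False
      then have "Suc (e i) = mord D i" using E_bound[OF e i] by simp
      then have "basis_vec D \<gamma> (e(i := Suc (e i))) = \<zero>\<^bsub>verma D \<gamma>\<^esub>"
        unfolding basis_vec_mon by (intro Z.mon_vanish[OF ks(2,3) _ top_closed]) simp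
      then show ?thesis unfolding c using recovered_zero by simp
    qed
  qed
  have "(\<Oplus>\<^bsub>verma D \<gamma>\<^esub>e\<in>A. hconst D (f e) \<odot>\<^bsub>verma D \<gamma>\<^esub> basis_vec D \<gamma> e) \<in> carrier (verma D \<gamma>) \<and>
      hX D i \<odot>\<^bsub>verma D \<gamma>\<^esub> (\<Oplus>\<^bsub>verma D \<gamma>\<^esub>e\<in>A. hconst D (f e) \<odot>\<^bsub>verma D \<gamma>\<^esub> basis_vec D \<gamma> e) \<in> recovered"
    if "finite A" "A \<subseteq> E" for A f
    using that
  proof (induction A rule: finite_induct)
    case (insert e A)
    have closed: "hconst D (f e) \<odot>\<^bsub>verma D \<gamma>\<^esub> basis_vec D \<gamma> e \<in> carrier (verma D \<gamma>)" for e
      by (simp add: basis_vec_closed Z.smult_closed)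
    have "hX D i \<odot>\<^bsub>verma D \<gamma>\<^esub> (hconst D (f e) \<odot>\<^bsub>verma D \<gamma>\<^esub> basis_vec D \<gamma> e) \<in> recovered"
      unfolding Z.const_commute[OF X basis_vec_closed, symmetric]
      using insert.prems by (intro recovered_const basis) auto
    then show ?case
      using insert closed X recovered_add by (simp add: Z.smult_r_distr Pi_iff)
  qed (use X recovered_zero in simp)
  from this[OF finite_E order_refl, of "co z"] show ?thesis
    using z by (simp add: recovered_def comb_def)
qed

text \<open>
  The recovered vectors form a subspace that contains \<open>1 \<otimes> 1\<close> and is stable under the \<open>x\<^sub>i\<close>. So it
  contains all words in the \<open>x\<^sub>i\<close> applied to \<open>1 \<otimes> 1\<close>, and these span \<open>Z(\<gamma>)\<close>.
\<close>

lemma recovered_all: "recovered = carrier (verma D \<gamma>)"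
proof -
  have "top = basis_vec D \<gamma> origin"
  proof -
    have foldr: "foldr (\<lambda>k w. ((\<lambda>w. hX D k \<odot>\<^bsub>verma D \<gamma>\<^esub> w) ^^ origin k) w) ks top = top" if "set ks \<subseteq> I" for ks
      using that by (induction ks) (auto simp: origin_def)
    have "set [1..<Suc (num D)] \<subseteq> I" by auto
    from foldr[OF this] show ?thesis unfolding basis_vec_mon Z.mon_def by (rule sym)
  qed
  then have top: "top \<in> recovered" using recovered_basis_vec[OF origin_E] by simp
  have "v \<in> recovered" if "v \<in> Z.xspan top" for v
    using that
    by (induction rule: Z.xspan.induct)
      (auto intro: top recovered_zero recovered_add recovered_const recovered_x simp del: atLeastAtMost_iff)
  moreover have "Z.xspan top = carrier (verma D \<gamma>)"
    by (rule top_generates[OF Z.xspan_submodule[OF weighted_datum_axioms highest_top] Z.xspan.base])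
  ultimately show ?thesis by (auto simp: recovered_def)
qed

lemma co_comb: "f \<in> V \<Longrightarrow> co (comb f) = f"
proof -
  assume f: "f \<in> V"
  have closed: "hconst D (f e) \<odot>\<^bsub>verma D \<gamma>\<^esub> basis_vec D \<gamma> e \<in> carrier (verma D \<gamma>)" for e
    by (simp add: basis_vec_closed Z.smult_closed)
  have "co (\<Oplus>\<^bsub>verma D \<gamma>\<^esub>e\<in>A. hconst D (f e) \<odot>\<^bsub>verma D \<gamma>\<^esub> basis_vec D \<gamma> e) = (\<lambda>e. if e \<in> A then f e else 0)"
    if "finite A" "A \<subseteq> E" for A
    using that
  proof (induction A rule: finite_induct)
    case empty then show ?case using co.hom_zero by simp
  next
    case (insert e A)
    have "(\<Oplus>\<^bsub>verma D \<gamma>\<^esub>e\<in>A. hconst D (f e) \<odot>\<^bsub>verma D \<gamma>\<^esub> basis_vec D \<gamma> e) \<in> carrier (verma D \<gamma>)"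
      using closed by (intro Z.M.finsum_closed) auto
    moreover have "co (hconst D (f e) \<odot>\<^bsub>verma D \<gamma>\<^esub> basis_vec D \<gamma> e) = (\<lambda>e'. f e * delta e e')"
      using insert.prems delta_V[of e] by (simp add: co.hom_smult basis_vec_closed co_basis_vec vact_const)
    ultimately show ?case
      using insert closed by (intro ext) (auto simp: co.hom_add Pi_iff delta_def)
  qed
  from this[OF finite_E order_refl] show ?thesis
    unfolding comb_def using f by (auto simp: V_def fun_eq_iff)
qed

end

section \<open>The Loewy structure of $Z(\gamma)$\<close>

context weighted_datum
begin

interpretation co: left_module_hom "alg D" "verma D \<gamma>" Vmod co by (rule co)

lemma co_V: "z \<in> carrier (verma D \<gamma>) \<Longrightarrow> co z \<in> V"
  using co.hom_closed by simp

sublocale L: ladder_module "alg D" "verma D \<gamma>" I "mord D" "Sset D \<gamma>" "edge D \<gamma>" co "hconst D"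
  "carrier (grp D)" "hG D" "hX D" "hY D" "\<lambda>g e. \<gamma> g * wchi g e" xcoef
  "\<lambda>i e. ycoef i e * lower i (Suc (e i))" E
proof (intro ladder_module.intro ladder_module_axioms.intro Z.left_module_axioms)
  show "E = (\<Pi>\<^sub>E i\<in>I. {..<mord D i})" by (simp add: exponents_def)
  show "Sset D \<gamma> \<subseteq> I" by (auto simp: Sset_def)
  show "edge D \<gamma> i + 2 \<le> mord D i" if "i \<in> Sset D \<gamma>" for i
    using is_edge_edge[OF that] by (simp add: is_edge_def)
  show "v = w" if v: "v \<in> carrier (verma D \<gamma>)" and w: "w \<in> carrier (verma D \<gamma>)"
    and eq: "\<And>e. e \<in> E \<Longrightarrow> co v e = co w e" for v w
  proof -
    have "co v = co w"
    proof
      fix e show "co v e = co w e"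
        using eq[of e] co_V[OF v] co_V[OF w] by (cases "e \<in> E") (simp_all add: V_def)
    qed
    moreover have recover: "comb (co z) = z" if "z \<in> carrier (verma D \<gamma>)" for z
      using that unfolding recovered_all[symmetric] by (simp add: recovered_def)
    ultimately show ?thesis using recover[OF v] recover[OF w] by metis
  qed
  show "\<exists>v\<in>carrier (verma D \<gamma>). \<forall>e\<in>E. co v e = f e" for f
  proof -
    define g where "g = (\<lambda>e. if e \<in> E then f e else 0)"
    have "g \<in> V" by (simp add: V_def g_def)
    then have "\<forall>e\<in>E. co (comb g) e = f e" unfolding co_comb[OF \<open>g \<in> V\<close>] by (simp add: g_def)
    then show ?thesis using comb_closed[of g] by (rule bexI)
  qed
  show "co (v \<oplus>\<^bsub>verma D \<gamma>\<^esub> w) e = co v e + co w e"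
    if "v \<in> carrier (verma D \<gamma>)" "w \<in> carrier (verma D \<gamma>)" for v w e
    using co.hom_add[OF that] by simp
  show "co (hconst D c \<odot>\<^bsub>verma D \<gamma>\<^esub> v) e = c * co v e" if "v \<in> carrier (verma D \<gamma>)" for c v e
    using co.hom_smult[OF Z.const_closed that] vact_const[OF co_V[OF that]] by simp
  show "co (hG D g \<odot>\<^bsub>verma D \<gamma>\<^esub> v) e = \<gamma> g * wchi g e * co v e"
    if "g \<in> carrier (grp D)" "v \<in> carrier (verma D \<gamma>)" for g v e
    using co.hom_smult[OF Z.gens_closed(1)[OF that(1)] that(2)] vact_gen[of "GenG g", OF _ co_V[OF that(2)]] that(1)
    by simp
  show "co (hX D i \<odot>\<^bsub>verma D \<gamma>\<^esub> v) e = (if e i = 0 then 0 else xcoef i e * co v (e(i := e i - 1)))"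
    if i: "i \<in> I" and v: "v \<in> carrier (verma D \<gamma>)" and e: "e \<in> E" for i v e
    using co.hom_smult[OF Z.gens_closed(2)[OF i] v] vact_gen[of "GenX i", OF _ co_V[OF v]] i e by simp
  show "co (hY D i \<odot>\<^bsub>verma D \<gamma>\<^esub> v) e =
      (if Suc (e i) < mord D i then ycoef i e * lower i (Suc (e i)) * co v (e(i := Suc (e i))) else 0)"
    if i: "i \<in> I" and v: "v \<in> carrier (verma D \<gamma>)" and e: "e \<in> E" for i v e
  proof -
    have "co v (e(i := Suc (e i))) = 0" if "\<not> Suc (e i) < mord D i"
      using up_not_E[OF i, of "e(i := Suc (e i))"] that co_V[OF v] by (simp add: V_def)
    then show ?thesis
      using co.hom_smult[OF Z.gens_closed(3)[OF i] v] vact_gen[of "GenY i", OF _ co_V[OF v]] i e by simp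
  qed
  show "xcoef i e \<noteq> 0" if "i \<in> I" for i e by (rule xcoef_nonzero[OF that])
  show "ycoef i e * lower i (Suc (e i)) = 0 \<longleftrightarrow> i \<in> Sset D \<gamma> \<and> e i = edge D \<gamma> i"
    if "i \<in> I" "Suc (e i) < mord D i" for i e
    using lower_eq_0_iff[OF that] ycoef_nonzero[OF that(1)] by (metis mult_eq_0_iff)
  show "submodule N (alg D) (verma D \<gamma>)"
    if N: "N \<subseteq> carrier (verma D \<gamma>)" "\<zero>\<^bsub>verma D \<gamma>\<^esub> \<in> N"
      "\<And>v w. \<lbrakk>v \<in> N; w \<in> N\<rbrakk> \<Longrightarrow> v \<oplus>\<^bsub>verma D \<gamma>\<^esub> w \<in> N"
      and act: "\<And>s v. \<lbrakk>s \<in> range (hconst D) \<union> hG D ` carrier (grp D) \<union> hX D ` I \<union> hY D ` I; v \<in> N\<rbrakk> \<Longrightarrow>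
        s \<odot>\<^bsub>verma D \<gamma>\<^esub> v \<in> N" for N
  proof (rule Z.alg_submoduleI[OF N])
    show "hconst D c \<odot>\<^bsub>verma D \<gamma>\<^esub> v \<in> N" if "v \<in> N" for c v
      by (rule act[OF _ that]) blast
    show "cls D (fgen s) \<odot>\<^bsub>verma D \<gamma>\<^esub> v \<in> N" if "s \<in> gens D" "v \<in> N" for s v
      by (rule act[OF _ that(2)]) (use that(1) in \<open>cases s; simp only: gens_simps; blast\<close>)
  qed
qed (simp_all add: Z.const_closed Z.gens_closed mord(1) del: atLeastAtMost_iff)

lemma basis_vec_b: "e \<in> E \<Longrightarrow> basis_vec D \<gamma> e = L.b e"
  by (rule L.co_eqI) (simp_all add: basis_vec_closed L.b_closed co_basis_vec L.co_b delta_def)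

lemma has_weight_basis_vec:
  assumes e: "e \<in> E"
  shows "has_weight D (verma D \<gamma>) (basis_vec D \<gamma> e) (\<lambda>g. \<gamma> g * wchi g e)"
proof -
  have "(\<lambda>g. \<gamma> g * wchi g e) \<in> dual_group D"
  proof -
    have "\<gamma> g * wchi g e \<noteq> 0" if "g \<in> carrier (grp D)" for g
      using dual_groupD(1)[OF weight that] chi_nonzero that by (simp add: wchi_def del: atLeastAtMost_iff)
    moreover have "x \<in> Units ground_field" if "x \<noteq> 0" for x :: 'k
      using that by (auto simp: Units_def ground_field_def intro!: exI[of _ "inverse x"])
    ultimately show ?thesis
      using dual_groupD(2)[OF weight] wchi_mult
      by (auto simp: dual_group_def hom_def units_of_def) (simp add: ground_field_def)
  qed
  moreover have "basis_vec D \<gamma> e \<noteq> \<zero>\<^bsub>verma D \<gamma>\<^esub>"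
  proof
    assume "basis_vec D \<gamma> e = \<zero>\<^bsub>verma D \<gamma>\<^esub>"
    then have "delta e e = 0" using co_basis_vec[OF e] L.co_zero[OF e] by metis
    then show False by (simp add: delta_self)
  qed
  moreover have "hG D g \<odot>\<^bsub>verma D \<gamma>\<^esub> basis_vec D \<gamma> e = hconst D (\<gamma> g * wchi g e) \<odot>\<^bsub>verma D \<gamma>\<^esub> basis_vec D \<gamma> e"
    if g: "g \<in> carrier (grp D)" for g
    by (rule L.co_eqI)
      (use g in \<open>auto simp: Z.smult_closed basis_vec_closed L.co_g L.co_cst co_basis_vec[OF e] delta_def\<close>)
  ultimately show ?thesis by (simp add: has_weight_def basis_vec_closed)
qed

text \<open>
  The operator \<open>y\<^sub>i\<close> kills a basis vector exactly if its \<open>i\<close>-th exponent is zero or just above a wall.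
\<close>

lemma primitive_iff_corner:
  assumes e: "e \<in> E"
  shows "primitive D (verma D \<gamma>) (basis_vec D \<gamma> e) \<longleftrightarrow> e = L.corner (L.rho e)"
proof
  assume prim: "primitive D (verma D \<gamma>) (basis_vec D \<gamma> e)"
  have edge: "i \<in> Sset D \<gamma> \<and> e i = Suc (edge D \<gamma> i)" if i: "i \<in> I" and pos: "e i \<noteq> 0" for i
  proof -
    let ?d = "e(i := e i - 1)"
    have d: "?d \<in> E" "Suc (?d i) < mord D i" using E_down[OF e i] E_bound[OF e i] pos by simp_all
    have "hY D i \<odot>\<^bsub>verma D \<gamma>\<^esub> L.b e = \<zero>\<^bsub>verma D \<gamma>\<^esub>"
      using prim i basis_vec_b[OF e] by (simp add: primitive_def del: atLeastAtMost_iff)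
    then have "co (hY D i \<odot>\<^bsub>verma D \<gamma>\<^esub> L.b e) ?d = 0" using L.co_zero[OF d(1)] by simp
    then have "ycoef i ?d * lower i (Suc (?d i)) * co (L.b e) (?d(i := Suc (?d i))) = 0"
      using L.co_y[OF i L.b_closed d(1)] d(2) by simp
    then have "ycoef i ?d * lower i (Suc (?d i)) = 0"
      unfolding L.down_up[of e i, OF pos] using L.co_b[OF e, of e] by simp
    then have "i \<in> Sset D \<gamma> \<and> ?d i = edge D \<gamma> i" using L.cy_eq_0_iff[OF i d] by blast
    then show ?thesis using pos by auto
  qed
  show "e = L.corner (L.rho e)"
  proof
    fix i
    show "e i = L.corner (L.rho e) i"
    proof (cases "i \<in> I")
      case True
      then show ?thesis unfolding L.corner_def L.rho_def using edge[OF True] by (cases "e i = 0") auto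
    next
      case False
      then show ?thesis unfolding L.corner_def using e by (auto simp: exponents_def PiE_iff extensional_def)
    qed
  qed
next
  assume corner: "e = L.corner (L.rho e)"
  have "hY D i \<odot>\<^bsub>verma D \<gamma>\<^esub> basis_vec D \<gamma> e = \<zero>\<^bsub>verma D \<gamma>\<^esub>" if i: "i \<in> I" for i
  proof (rule L.co_eqI)
    fix e' assume e': "e' \<in> E"
    have "ycoef i e' * lower i (Suc (e' i)) = 0" if lt: "Suc (e' i) < mord D i" and eq: "e'(i := Suc (e' i)) = e"
    proof -
      have "e i = Suc (e' i)" using eq by auto
      moreover have "e i = (if i \<in> L.rho e then Suc (edge D \<gamma> i) else 0)"
        using fun_cong[OF corner, of i] i unfolding L.corner_def by simp
      ultimately have "i \<in> Sset D \<gamma> \<and> e' i = edge D \<gamma> i" using L.rho_subset[of e] by (auto split: if_splits)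
      then show ?thesis using L.cy_eq_0_iff[OF i e' lt] by blast
    qed
    then show "co (hY D i \<odot>\<^bsub>verma D \<gamma>\<^esub> basis_vec D \<gamma> e) e' = co \<zero>\<^bsub>verma D \<gamma>\<^esub> e'"
      unfolding L.co_zero[OF e'] L.co_y[OF i basis_vec_closed e'] co_basis_vec[OF e] delta_def by auto
  qed (use i in \<open>simp_all add: Z.smult_closed basis_vec_closed del: atLeastAtMost_iff\<close>)
  then show "primitive D (verma D \<gamma>) (basis_vec D \<gamma> e)"
    using has_weight_basis_vec[OF e] by (auto simp: primitive_def simp del: atLeastAtMost_iff)
qed

lemma primitive_exponents_eq:
  "primitive_exponents D \<gamma> m = L.corner ` {T. T \<subseteq> Sset D \<gamma> \<and> card T = m}"
proof -
  have rank: "rank_of D \<gamma> e = card (L.rho e)" for e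
    by (simp add: rank_of_def L.rho_def Suc_le_eq)
  show ?thesis
  proof
    show "primitive_exponents D \<gamma> m \<subseteq> L.corner ` {T. T \<subseteq> Sset D \<gamma> \<and> card T = m}"
      using primitive_iff_corner L.rho_subset by (auto simp: primitive_exponents_def rank)
    show "L.corner ` {T. T \<subseteq> Sset D \<gamma> \<and> card T = m} \<subseteq> primitive_exponents D \<gamma> m"
      using primitive_iff_corner L.corner_E L.rho_corner by (auto simp: primitive_exponents_def rank)
  qed
qed

lemma primitive_exponentsD:
  assumes "e \<in> primitive_exponents D \<gamma> m"
  shows "e \<in> E" "L.rho e \<subseteq> Sset D \<gamma>" "card (L.rho e) = m" "L.corner (L.rho e) = e"
    "basis_vec D \<gamma> e = L.b e"
  using assms L.rho_corner L.corner_E basis_vec_b unfolding primitive_exponents_eq by auto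

lemma F_eq_gen_submodule:
  "L.F m = gen_submodule (alg D) (verma D \<gamma>) (basis_vec D \<gamma> ` primitive_exponents D \<gamma> m)"
proof
  let ?B = "basis_vec D \<gamma> ` primitive_exponents D \<gamma> m"
  have gen: "submodule (gen_submodule (alg D) (verma D \<gamma>) ?B) (alg D) (verma D \<gamma>)"
    by (rule Z.submodule_gen) (auto simp: basis_vec_closed)
  show "L.F m \<subseteq> gen_submodule (alg D) (verma D \<gamma>) ?B"
  proof (rule L.F_generated[OF gen])
    fix T assume T: "T \<subseteq> Sset D \<gamma>" "card T = m"
    then have "L.corner T \<in> primitive_exponents D \<gamma> m" by (auto simp: primitive_exponents_eq)
    then show "L.b (L.corner T) \<in> gen_submodule (alg D) (verma D \<gamma>) ?B"
      using gen_submodule_incl[of ?B "alg D" "verma D \<gamma>"] basis_vec_b[OF L.corner_E[OF T(1)]] by auto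
  qed
  show "gen_submodule (alg D) (verma D \<gamma>) ?B \<subseteq> L.F m"
  proof (rule gen_submodule_least[OF L.submodule_F])
    show "?B \<subseteq> L.F m"
    proof (rule image_subsetI)
      fix e assume e: "e \<in> primitive_exponents D \<gamma> m"
      show "basis_vec D \<gamma> e \<in> L.F m"
        using L.corner_mem_F[OF primitive_exponentsD(2)[OF e]]
        unfolding primitive_exponentsD(3-5)[OF e] .
    qed
  qed
qed

lemma the_maximal_submodule: "(THE N. maximal_submodule N (alg D) (verma D \<gamma>)) = L.F 1"
  by (simp add: L.maximal_submodule_iff)

text \<open>
  The weight is used only through these two properties: it defines another datum of the same kind, and the
  basis vector satisfies the relations of the generator of \<open>Z(\<eta>)\<close>.
\<close>

lemma weight_of_basis_vec:
  assumes e: "e \<in> primitive_exponents D \<gamma> m"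
  defines "\<eta> \<equiv> weight_of D (verma D \<gamma>) (basis_vec D \<gamma> e)"
  shows "weighted_datum D \<eta>" "Z.highest \<eta> (basis_vec D \<gamma> e)"
proof -
  have "has_weight D (verma D \<gamma>) (basis_vec D \<gamma> e) \<eta>"
    unfolding \<eta>_def weight_of_def
    using has_weight_basis_vec[OF primitive_exponentsD(1)[OF e]]
    by (rule someI[where P = "has_weight D (verma D \<gamma>) (basis_vec D \<gamma> e)"])
  moreover have "primitive D (verma D \<gamma>) (basis_vec D \<gamma> e)"
    using e by (simp add: primitive_exponents_def)
  ultimately show "weighted_datum D \<eta>" "Z.highest \<eta> (basis_vec D \<gamma> e)"
    using D nilpotent by (auto simp: weighted_datum_def Z.highest_def has_weight_def primitive_def
      simp del: atLeastAtMost_iff)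
qed

lemma co_finsum:
  assumes "finite A" "\<And>i. i \<in> A \<Longrightarrow> f i \<in> carrier (verma D \<gamma>)" "e \<in> E"
  shows "co (\<Oplus>\<^bsub>verma D \<gamma>\<^esub>i\<in>A. f i) e = (\<Sum>i\<in>A. co (f i) e)"
  using assms
proof (induction A rule: finite_induct)
  case (insert i A)
  then have "(\<Oplus>\<^bsub>verma D \<gamma>\<^esub>i\<in>A. f i) \<in> carrier (verma D \<gamma>)" by (intro Z.M.finsum_closed) auto
  then show ?case using insert by (simp add: Z.M.finsum_insert Pi_iff L.co_add)
qed (simp add: L.co_zero)

text \<open>
  Below rank \<open>Suc m\<close> the summands have their coordinates in different cells, so they cannot cancel.
\<close>

lemma layer_independent:
  assumes fin: "finite \<Lambda>" and \<Lambda>: "\<Lambda> \<subseteq> primitive_exponents D \<gamma> m"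
    and v: "\<And>e. e \<in> \<Lambda> \<Longrightarrow> v e \<in> L.K (L.rho e)"
    and sum: "(\<Oplus>\<^bsub>verma D \<gamma>\<^esub>e\<in>\<Lambda>. v e) \<in> L.F (Suc m)" and e: "e \<in> \<Lambda>"
  shows "v e \<in> L.F (Suc m)"
proof -
  have vZ: "v e \<in> carrier (verma D \<gamma>)" if "e \<in> \<Lambda>" for e
    using v[OF that] by (simp add: L.K_def L.span_def)
  have "Suc m \<le> card (L.rho e')" if e': "e' \<in> E" "co (v e) e' \<noteq> 0" for e'
  proof (rule ccontr)
    assume not_le: "\<not> Suc m \<le> card (L.rho e')"
    have supp: "L.rho e' = L.rho d" if "d \<in> \<Lambda>" "co (v d) e' \<noteq> 0" for d
    proof -
      have "L.rho e' = L.rho d \<or> card (L.rho d) < card (L.rho e')"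
        using v[OF that(1)] e'(1) that(2) unfolding L.K_def L.span_def by blast
      moreover have "card (L.rho d) = m" using primitive_exponentsD(3) \<Lambda> that(1) by blast
      ultimately show ?thesis using not_le by auto
    qed
    have "co (v d) e' = 0" if d: "d \<in> \<Lambda>" "d \<noteq> e" for d
    proof (rule ccontr)
      assume "co (v d) e' \<noteq> 0"
      then have "L.rho d = L.rho e" using supp[OF d(1)] supp[OF e e'(2)] by simp
      then show False using primitive_exponentsD(4)[of d m] primitive_exponentsD(4)[of e m] \<Lambda> d e
        by (metis subsetD)
    qed
    then have "(\<Sum>d\<in>\<Lambda>. co (v d) e') = co (v e) e'"
      using fin e by (subst sum.remove[of _ e]) auto
    then have "co (\<Oplus>\<^bsub>verma D \<gamma>\<^esub>e\<in>\<Lambda>. v e) e' \<noteq> 0" using co_finsum[OF fin vZ e'(1)] e'(2) by simp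
    then show False using sum e'(1) not_le by (auto simp: L.F_def L.span_def)
  qed
  then show ?thesis using vZ[OF e] by (simp add: L.F_def L.span_def)
qed

text \<open>
  The homomorphism \<open>Z(\<eta>) \<rightarrow> Z(\<gamma>)\<close> that sends the generator to a corner maps into the submodule \<open>K\<close> of
  its cell, which covers \<open>F (Suc m)\<close>; hence the preimage of \<open>F (Suc m)\<close> is the maximal submodule of \<open>Z(\<eta>)\<close>.
\<close>

theorem layer_iso:
  "module_iso (alg D) (loewy_layer (alg D) (verma D \<gamma>) m)
    (direct_sum (primitive_exponents D \<gamma> m)
      (\<lambda>e. simple_top D (weight_of D (verma D \<gamma>) (basis_vec D \<gamma> e))))"
proof -
  let ?\<Lambda> = "primitive_exponents D \<gamma> m"
  let ?\<eta> = "\<lambda>e. weight_of D (verma D \<gamma>) (basis_vec D \<gamma> e)"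
  have "\<forall>e\<in>?\<Lambda>. \<exists>\<Phi>. left_module_hom (alg D) (verma D (?\<eta> e)) (verma D \<gamma>) \<Phi> \<and>
      \<Phi> (weighted_datum.top D (?\<eta> e)) = basis_vec D \<gamma> e"
    using weighted_datum.verma_universal[OF weight_of_basis_vec(1) Z.alg_module_axioms weight_of_basis_vec(2)] by metis
  then obtain \<Phi> where \<Phi>: "\<And>e. e \<in> ?\<Lambda> \<Longrightarrow> left_module_hom (alg D) (verma D (?\<eta> e)) (verma D \<gamma>) (\<Phi> e)"
    "\<And>e. e \<in> ?\<Lambda> \<Longrightarrow> \<Phi> e (weighted_datum.top D (?\<eta> e)) = basis_vec D \<gamma> e"
    by metis
  have image: "\<Phi> e ` carrier (verma D (?\<eta> e)) \<subseteq> L.K (L.rho e)" if e: "e \<in> ?\<Lambda>" for e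
  proof -
    interpret w: weighted_datum D "?\<eta> e" by (rule weight_of_basis_vec(1)[OF e])
    interpret h: left_module_hom "alg D" "verma D (?\<eta> e)" "verma D \<gamma>" "\<Phi> e" by (rule \<Phi>(1)[OF e])
    have "basis_vec D \<gamma> e \<in> L.K (L.rho e)"
      using primitive_exponentsD(5)[OF e] by (simp add: L.K_def L.b_span)
    then have "{z \<in> carrier (verma D (?\<eta> e)). \<Phi> e z \<in> L.K (L.rho e)} = carrier (verma D (?\<eta> e))"
      using \<Phi>(2)[OF e] w.top_closed by (intro w.top_generates h.submodule_vimage L.submodule_K) simp
    then show ?thesis by blast
  qed
  have b_image: "basis_vec D \<gamma> e \<in> \<Phi> e ` carrier (verma D (?\<eta> e))" if e: "e \<in> ?\<Lambda>" for e
    using \<Phi>(2)[OF e] weighted_datum.top_closed[OF weight_of_basis_vec(1)[OF e]] by (metis imageI)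
  have "module_iso (alg D) ((verma D \<gamma>)\<lparr>carrier := L.F m\<rparr> Modulo L.F (Suc m))
      (direct_sum ?\<Lambda> (\<lambda>e. verma D (?\<eta> e) Modulo (THE N. maximal_submodule N (alg D) (verma D (?\<eta> e)))))"
  proof (rule Z.module_iso_direct_sum[where f = \<Phi>])
    show fin: "finite ?\<Lambda>" using finite_E finite_subset[of ?\<Lambda> E] by (auto simp: primitive_exponents_def)
    show "left_module_hom (alg D) (verma D (?\<eta> e)) (verma D \<gamma>) (\<Phi> e)" if "e \<in> ?\<Lambda>" for e
      by (rule \<Phi>(1)[OF that])
    show "submodule (L.F (Suc m)) (alg D) (verma D \<gamma>)" "submodule (L.F m) (alg D) (verma D \<gamma>)"
      by (rule L.submodule_F)+
    show "L.F (Suc m) \<subseteq> L.F m" by (rule L.F_mono) simp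
    show "\<Phi> e ` carrier (verma D (?\<eta> e)) \<subseteq> L.F m" if "e \<in> ?\<Lambda>" for e
      using image[OF that] L.K_le_F[of "L.rho e"] primitive_exponentsD(3)[OF that] by simp
    show "(THE N. maximal_submodule N (alg D) (verma D (?\<eta> e))) =
        {v \<in> carrier (verma D (?\<eta> e)). \<Phi> e v \<in> L.F (Suc m)}" if e: "e \<in> ?\<Lambda>" for e
    proof -
      interpret w: weighted_datum D "?\<eta> e" by (rule weight_of_basis_vec(1)[OF e])
      interpret h: left_module_hom "alg D" "verma D (?\<eta> e)" "verma D \<gamma>" "\<Phi> e" by (rule \<Phi>(1)[OF e])
      have "basis_vec D \<gamma> e \<notin> L.F (Suc m)"
        using L.corner_not_mem_F[OF primitive_exponentsD(2)[OF e]] primitive_exponentsD(3-5)[OF e] by simp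
      then have "maximal_submodule {v \<in> carrier (verma D (?\<eta> e)). \<Phi> e v \<in> L.F (Suc m)} (alg D) (verma D (?\<eta> e))"
        using L.covers_K[OF primitive_exponentsD(2)[OF e]] primitive_exponentsD(3)[OF e] image[OF e] b_image[OF e]
        by (intro h.maximal_vimage[OF _ L.submodule_F]) auto
      then have "{v \<in> carrier (verma D (?\<eta> e)). \<Phi> e v \<in> L.F (Suc m)} = w.L.F 1"
        unfolding w.L.maximal_submodule_iff .
      then show ?thesis unfolding w.the_maximal_submodule by (rule sym)
    qed
    show "L.F m \<subseteq> N" if N: "submodule N (alg D) (verma D \<gamma>)"
      "\<And>e. e \<in> ?\<Lambda> \<Longrightarrow> \<Phi> e ` carrier (verma D (?\<eta> e)) \<subseteq> N" for N
    proof (rule L.F_generated[OF N(1)])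
      fix T assume T: "T \<subseteq> Sset D \<gamma>" "card T = m"
      then have corner: "L.corner T \<in> ?\<Lambda>" by (auto simp: primitive_exponents_eq)
      show "L.b (L.corner T) \<in> N"
        unfolding primitive_exponentsD(5)[OF corner, symmetric] by (rule subsetD[OF N(2)[OF corner] b_image[OF corner]])
    qed
    show "\<Phi> e (z e) \<in> L.F (Suc m)"
      if z: "\<And>e. e \<in> ?\<Lambda> \<Longrightarrow> z e \<in> carrier (verma D (?\<eta> e))"
        and sum: "(\<Oplus>\<^bsub>verma D \<gamma>\<^esub>e\<in>?\<Lambda>. \<Phi> e (z e)) \<in> L.F (Suc m)" and e: "e \<in> ?\<Lambda>" for z e
      using image z by (intro layer_independent[OF fin order_refl _ sum e]) blast
  qed
  then show ?thesis unfolding loewy_layer_def L.radical_series_eq simple_top_def .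
qed

end

theorem theorem3p7:
  fixes D :: "('g, 'k::field_char_0) datum" and \<gamma> :: "'g \<Rightarrow> 'k"
  assumes roots_of_1: "\<forall>N>0. \<exists>rs::'k list. Polynomial.monom 1 N - 1 = (\<Prod>r\<leftarrow>rs. [:- r, 1:])"
    and datum: "simply_linked_datum D" "nilpotent_type D"
    and weight: "\<gamma> \<in> dual_group D"
  shows
    "(\<forall>m < loewy_length (alg D) (verma D \<gamma>).
        radical_series (alg D) (verma D \<gamma>) m =
          gen_submodule (alg D) (verma D \<gamma>) (basis_vec D \<gamma> ` primitive_exponents D \<gamma> m))
     \<and> (\<forall>m \<le> loewy_length (alg D) (verma D \<gamma>).
        radical_series (alg D) (verma D \<gamma>) m =
          socle_series (alg D) (verma D \<gamma>) (loewy_length (alg D) (verma D \<gamma>) - m))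
     \<and> (\<forall>m. module_iso (alg D) (loewy_layer (alg D) (verma D \<gamma>) m)
          (direct_sum (primitive_exponents D \<gamma> m)
             (\<lambda>e. simple_top D (weight_of D (verma D \<gamma>) (basis_vec D \<gamma> e)))))
     \<and> loewy_length (alg D) (verma D \<gamma>) = card (Sset D \<gamma>) + 1"
proof -
  interpret weighted_datum D \<gamma> by (rule weighted_datum.intro[OF datum weight])
  have "L.F m = socle_series (alg D) (verma D \<gamma>) (card (Sset D \<gamma>) + 1 - m)" if "m \<le> card (Sset D \<gamma>) + 1" for m
    using L.socle_series_eq[of "card (Sset D \<gamma>) + 1 - m"] that by simp
  then show ?thesis
    unfolding L.loewy_length_eq L.radical_series_eq using F_eq_gen_submodule layer_iso by blast
qed

end
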